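(* In the setting of the context, let $R_h$ be the stabilization operator in the physical domain (defined in the context). Then there exists $C>0$, independent of $h$ and $K$, such that for every $K\in\mathcal G_h$ $$\|\mathsf h^{1/2}R_h(v_h)\|_{L^2(\Gamma_K)}\le C\,\|\nabla v_h\|_{L^2(\Omega\cap K')}\qquad\forall\,v_h\in\tilde V_h,$$ where $K'=K$ if $K\in\mathcal M_h^g$, and otherwise $K'\in\mathcal N(K)\cap\mathcal M_h^g$ is the good neighbor of $K$ used in the definition of $R_h$.
   Context: Splines. Let $d\in\{2,3\}$ and $p\ge1$. A $p$-open knot vector on $[0,1]$ is $\Xi=\{\xi_1,\dots,\xi_{n+p+1}\}$ with $0=\xi_1=\dots=\xi_{p+1}<\xi_{p+2}\le\dots\le\xi_n<\xi_{n+1}=\dots=\xi_{n+p+1}=1$, internal knots having multiplicity at most $p$; its distinct values are the breakpoints, and $S_p(\Xi)$ is the span of the associated B-splines $\hat B_{i,p}$. For $\mathbf\Xi=\Xi_1\times\dots\times\Xi_d$, $S_p(\mathbf\Xi)=\bigotimes_\ell S_p(\Xi_\ell)$ with tensor-product B-spline basis $\hat B_{\mathbf i,p}$. The breakpoints define a Cartesian mesh $\hat{\mathcal M}_{0,h}$ of open boxes $Q$ of $\hat\Omega_0=(0,1)^d$; $h_Q=\mathrm{diam}(Q)$, $h=\max_Q h_Q$. The family $\{\hat{\mathcal M}_{0,h}\}_h$ is shape-regular: the ratio between the smallest edge of $Q$ and $h_Q$ is bounded below by a positive constant uniformly in $Q$ and $h$. Geometry. $\Omega_0=\mathbf F(\hat\Omega_0)\subset\mathbb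 R^d$ with $\mathbf F\in(S_{p^0}(\mathbf\Xi^0))^d$; $\mathbf F$ is bi-Lipschitz, $\mathbf F|_{\overline Q}\in C^\infty(\overline Q)$ for all $Q\in\hat{\mathcal M}_{0,h}$, and $\mathbf F^{-1}|_{\overline K}\in C^\infty(\overline K)$ for all $K=\mathbf F(Q)$. The space $S_p(\mathbf\Xi)$ is a refinement of $S_{p^0}(\mathbf\Xi^0)$, $B_{\mathbf i,p}=\hat B_{\mathbf i,p}\circ\mathbf F^{-1}$ and $V_h=\mathrm{span}\{B_{\mathbf i,p}\}$. The trimmed domain is $\Omega=\Omega_0\setminus\overline\Omega_1$, with $\Omega_1$ a bounded domain and $\Omega$ Lipschitz; $\Gamma_{trim}=\partial\Omega\cap\partial\Omega_1$; $\hat\Omega=\mathbf F^{-1}(\Omega)$; $\tilde V_h=\mathrm{span}\{B_{\mathbf i,p}|_\Omega\}$. $\partial\Omega=\Gamma_D\cup\Gamma_N$ with disjoint interiors; $n$ is the outward unit normal. $\mathcal M_h=\{\mathbf F(Q):Q\in\hat{\mathcal M}_{0,h},\,Q\cap\hat\Omega\neq\emptyset\}$ and $\mathcal G_h=\{K\in\mathcal M_h:\overline K\cap\Gamma_{trim}\ne\emptyset\}$. $\mathsf h$ is the piecewise constant function with $\mathsf h|_K=h_K:=\mathrm{diam}(K)$, and $\Gamma_K:=\Gamma_D\cap\overline K$. Standing assumption: $|\Gamma_K|\le Ch_K^{d-1}$ for all $K\in\mathcal M_h$, with $C$ independent of $h$ and $K$. Good/bad elements. Fix $\theta\in(0,1]$.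 $Q$ (and $K=\mathbf F(Q)\in\mathcal M_h$) is good if $|\hat\Omega\cap Q|\ge\theta|Q|$, bad otherwise; $\mathcal M_h^g,\mathcal M_h^b$ are the sets of good and bad physical elements. Neighbors: $\mathcal N(K)=\{K'\in\mathcal M_h:\mathrm{dist}(K,K')\le C_{\mathcal N}h_K\}\setminus\{K\}$ with $C_{\mathcal N}$ a fixed constant independent of the mesh size. Standing assumption: $\mathcal N(K)\cap\mathcal M_h^g\neq\emptyset$ for every $K\in\mathcal M_h^b$. Stabilization in the physical domain. $R_h(v_h)$ is defined locally: on $\Gamma_K$, $K\in\mathcal G_h$, $R_h(v_h)=R_K(v_h)$, where: if $K\in\mathcal M_h^g$, $R_K(v_h)=\partial(v_h|_K)/\partial n$; if $K\in\mathcal M_h^b$, with chosen good neighbor $K'\in\mathcal N(K)\cap\mathcal M_h^g$, $R_K(v_h)=\frac{\partial}{\partial n}\,\mathcal E\big(P(v_h|_{K'})\big)$, where $P:L^2(K')\to\mathbb Q_p(K')$ is the $L^2(K')$-orthogonal projection onto polynomials (in the physical coordinates) of degree at most $p$ in each coordinate, and $\mathcal E:\mathbb Q_p(K')\to\mathbb Q_p(K'\cup K)$ is the natural extension of a polynomial. (If $K'$ is itself cut, $v_h|_{K'}$ is the unique extension to $K'$ of $v_h|_{K'\cap\Omega}$ whose pull-back by $\mathbf F$ is a polynomial in $\mathbb Q_p$.) *)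

theory Defs
  imports "HOL-Analysis.Analysis"
begin

section \<open>Surface measure\<close>

text \<open>
  Integrals over pieces of a boundary are taken with respect to the Hausdorff measure, normalised
  so that the s-dimensional measure on an s-dimensional linear subspace is Lebesgue measure.
\<close>

definition hausdorff_gauge :: "nat \<Rightarrow> 'a::metric_space set \<Rightarrow> ennreal" where
  "hausdorff_gauge s U =
     (if U = {} then 0 else ennreal (unit_ball_vol (real s) / 2 ^ s * diameter U ^ s))"

definition hausdorff_pre :: "nat \<Rightarrow> real \<Rightarrow> 'a::metric_space set \<Rightarrow> ennreal" where
  "hausdorff_pre s \<delta> A =
     (INF U\<in>{U :: nat \<Rightarrow> 'a set. A \<subseteq> (\<Union>n. U n) \<and> (\<forall>n. bounded (U n) \<and> diameter (U n) \<le> \<delta>)}.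
        \<Sum>n. hausdorff_gauge s (U n))"

definition hausdorff_outer :: "nat \<Rightarrow> 'a::metric_space set \<Rightarrow> ennreal" where
  "hausdorff_outer s A = (SUP \<delta>\<in>{0<..}. hausdorff_pre s \<delta> A)"

definition hausdorff_measure :: "nat \<Rightarrow> 'a::metric_space measure" where
  "hausdorff_measure s = measure_of UNIV (sets borel) (hausdorff_outer s)"

text \<open>
  The outer measure is a metric outer measure, hence a measure on the Borel sets; thus the
  measure above is not degenerate.
\<close>

lemma hausdorff_gauge_empty [simp]: "hausdorff_gauge s {} = 0"
  by (simp add: hausdorff_gauge_def)

lemma hausdorff_pre_le:
  assumes "A \<subseteq> (\<Union>n. U n)" "\<And>n. bounded (U n)" "\<And>n. diameter (U n) \<le> \<delta>"
  shows "hausdorff_pre s \<delta> A \<le> (\<Sum>n. hausdorff_gauge s (U n))"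
  unfolding hausdorff_pre_def using assms by (intro INF_lower) auto

lemma hausdorff_pre_mono: "A \<subseteq> B \<Longrightarrow> hausdorff_pre s \<delta> A \<le> hausdorff_pre s \<delta> B"
  unfolding hausdorff_pre_def by (intro INF_superset_mono) auto

lemma hausdorff_pre_antimono: "\<delta> \<le> \<delta>' \<Longrightarrow> hausdorff_pre s \<delta>' A \<le> hausdorff_pre s \<delta> A"
  unfolding hausdorff_pre_def by (intro INF_superset_mono) (auto intro: order_trans)

lemma hausdorff_pre_le_outer: "\<delta> > 0 \<Longrightarrow> hausdorff_pre s \<delta> A \<le> hausdorff_outer s A"
  unfolding hausdorff_outer_def by (intro SUP_upper) auto

lemma hausdorff_outer_mono: "A \<subseteq> B \<Longrightarrow> hausdorff_outer s A \<le> hausdorff_outer s B"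
  unfolding hausdorff_outer_def by (intro SUP_mono') (auto intro: hausdorff_pre_mono)

lemma hausdorff_outer_empty [simp]: "hausdorff_outer s {} = 0"
proof -
  have "hausdorff_pre s \<delta> ({} :: 'a set) \<le> 0" if "\<delta> > 0" for \<delta>
    using hausdorff_pre_le[of "{} :: 'a set" "\<lambda>_. {}" \<delta> s] that by simp
  then have "hausdorff_outer s ({} :: 'a set) \<le> 0"
    unfolding hausdorff_outer_def by (intro SUP_least) auto
  then show ?thesis by simp
qed

lemma hausdorff_pre_subadd:
  fixes A :: "nat \<Rightarrow> 'a::metric_space set"
  shows "hausdorff_pre s \<delta> (\<Union>i. A i) \<le> (\<Sum>i. hausdorff_pre s \<delta> (A i))"
proof (rule ennreal_le_epsilon)
  fix e :: real
  assume fin: "(\<Sum>i. hausdorff_pre s \<delta> (A i)) < top" and e: "0 < e"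
  have "\<exists>U. A i \<subseteq> (\<Union>n. U n) \<and> (\<forall>n. bounded (U n) \<and> diameter (U n) \<le> \<delta>) \<and>
      (\<Sum>n. hausdorff_gauge s (U n)) \<le> hausdorff_pre s \<delta> (A i) + ennreal (e * (1/2) ^ Suc i)" for i
  proof -
    have ne: "hausdorff_pre s \<delta> (A i) \<noteq> \<infinity>"
      using ennreal_suminf_lessD[OF fin, of i] by auto
    have "e * (1/2) ^ Suc i > 0" using e by simp
    from INF_approx_ennreal[OF this hausdorff_pre_def ne] show ?thesis
      by (auto intro: less_imp_le)
  qed
  then obtain U where U: "\<And>i. A i \<subseteq> (\<Union>n. U i n)" "\<And>i n. bounded (U i n)"
      "\<And>i n. diameter (U i n) \<le> \<delta>"
      "\<And>i. (\<Sum>n. hausdorff_gauge s (U i n)) \<le> hausdorff_pre s \<delta> (A i) + ennreal (e * (1/2) ^ Suc i)"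
    by metis
  define V where "V k = (case prod_decode k of (i, n) \<Rightarrow> U i n)" for k
  have "hausdorff_pre s \<delta> (\<Union>i. A i) \<le> (\<Sum>k. hausdorff_gauge s (V k))"
  proof (rule hausdorff_pre_le)
    show "(\<Union>i. A i) \<subseteq> (\<Union>k. V k)"
    proof
      fix x assume "x \<in> (\<Union>i. A i)"
      then obtain i n where "x \<in> U i n" using U(1) by blast
      then have "x \<in> V (prod_encode (i, n))" by (simp add: V_def)
      then show "x \<in> (\<Union>k. V k)" by blast
    qed
  qed (auto simp: V_def U split: prod.split)
  also have "\<dots> = (\<Sum>k. (\<lambda>(i, n). hausdorff_gauge s (U i n)) (prod_decode k))"
    by (simp add: V_def prod.case_distrib cong: prod.case_cong)
  also have "\<dots> = (\<Sum>i. \<Sum>n. hausdorff_gauge s (U i n))"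
    by (intro suminf_ennreal_2dimen) auto
  also have "\<dots> \<le> (\<Sum>i. hausdorff_pre s \<delta> (A i) + ennreal (e * (1/2) ^ Suc i))"
    by (intro suminf_le U(4)) auto
  also have "\<dots> = (\<Sum>i. hausdorff_pre s \<delta> (A i)) + (\<Sum>i. ennreal e * ennreal ((1/2) ^ Suc i))"
    using e by (subst suminf_add[symmetric]) (auto simp del: power_Suc simp: ennreal_mult ennreal_mult' intro!: summableI)
  also have "(\<Sum>i. ennreal e * ennreal ((1/2) ^ Suc i)) = ennreal e"
    unfolding ennreal_suminf_cmult
    by (subst suminf_ennreal_eq[OF zero_le_power power_half_series]) auto
  finally show "hausdorff_pre s \<delta> (\<Union>i. A i) \<le> (\<Sum>i. hausdorff_pre s \<delta> (A i)) + ennreal e" .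
qed

lemma hausdorff_outer_subadd:
  fixes A :: "nat \<Rightarrow> 'a::metric_space set"
  shows "hausdorff_outer s (\<Union>i. A i) \<le> (\<Sum>i. hausdorff_outer s (A i))"
  unfolding hausdorff_outer_def[of s "\<Union>i. A i"]
proof (rule SUP_least)
  fix \<delta> :: real assume "\<delta> \<in> {0<..}"
  then have "(\<Sum>i. hausdorff_pre s \<delta> (A i)) \<le> (\<Sum>i. hausdorff_outer s (A i))"
    by (intro suminf_le) (auto intro: hausdorff_pre_le_outer)
  with hausdorff_pre_subadd[of s \<delta> A]
  show "hausdorff_pre s \<delta> (\<Union>i. A i) \<le> (\<Sum>i. hausdorff_outer s (A i))"
    by (rule order_trans)
qed

lemma hausdorff_outer_measure_space: "outer_measure_space UNIV (hausdorff_outer s)"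
  by (auto simp: outer_measure_space_def positive_def increasing_def countably_subadditive_def
      intro: hausdorff_outer_mono hausdorff_outer_subadd)

lemma hausdorff_outer_Un_le:
  "hausdorff_outer s (A \<union> B) \<le> hausdorff_outer s A + hausdorff_outer s B"
proof -
  interpret sigma_algebra UNIV "UNIV :: 'a set set" using sigma_algebra_Pow[of "UNIV :: 'a set"] by simp
  have "subadditive UNIV (hausdorff_outer s :: 'a set \<Rightarrow> _)"
    using hausdorff_outer_measure_space countably_subadditive_subadditive
    by (metis outer_measure_space_def)
  then have *: "hausdorff_outer s (X \<union> Y) \<le> hausdorff_outer s X + hausdorff_outer s Y"
    if "X \<inter> Y = {}" for X Y :: "'a set" using that by (auto simp: subadditive_def)
  have "hausdorff_outer s (A \<union> (B - A)) \<le> hausdorff_outer s A + hausdorff_outer s (B - A)"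
    by (rule *) auto
  also have "\<dots> \<le> hausdorff_outer s A + hausdorff_outer s B"
    by (intro add_left_mono hausdorff_outer_mono) auto
  finally show ?thesis by simp
qed

lemma hausdorff_outer_separated:
  fixes A B :: "'a::metric_space set"
  assumes r: "r > 0" and sep: "\<And>a b. a \<in> A \<Longrightarrow> b \<in> B \<Longrightarrow> r \<le> dist a b"
  shows "hausdorff_outer s A + hausdorff_outer s B \<le> hausdorff_outer s (A \<union> B)"
proof -
  have small: "hausdorff_pre s \<delta> A + hausdorff_pre s \<delta> B \<le> hausdorff_pre s \<delta> (A \<union> B)"
    if d: "0 < \<delta>" "\<delta> < r" for \<delta>
    unfolding hausdorff_pre_def[of s \<delta> "A \<union> B"]
  proof (rule INF_greatest)
    fix U :: "nat \<Rightarrow> 'a set"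
    assume "U \<in> {U. A \<union> B \<subseteq> (\<Union>n. U n) \<and> (\<forall>n. bounded (U n) \<and> diameter (U n) \<le> \<delta>)}"
    then have U: "A \<union> B \<subseteq> (\<Union>n. U n)" "\<And>n. bounded (U n)" "\<And>n. diameter (U n) \<le> \<delta>" by auto
    define UA where "UA n = (if U n \<inter> A \<noteq> {} then U n else {})" for n
    define UB where "UB n = (if U n \<inter> B \<noteq> {} then U n else {})" for n
    have "hausdorff_pre s \<delta> A \<le> (\<Sum>n. hausdorff_gauge s (UA n))"
    proof (rule hausdorff_pre_le)
      show "A \<subseteq> (\<Union>n. UA n)"
      proof
        fix x assume x: "x \<in> A"
        then obtain n where "x \<in> U n" using U(1) by blast
        with x have "x \<in> UA n" by (auto simp: UA_def)
        then show "x \<in> (\<Union>n. UA n)" by blast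
      qed
    qed (use U d in \<open>auto simp: UA_def\<close>)
    moreover have "hausdorff_pre s \<delta> B \<le> (\<Sum>n. hausdorff_gauge s (UB n))"
    proof (rule hausdorff_pre_le)
      show "B \<subseteq> (\<Union>n. UB n)"
      proof
        fix x assume x: "x \<in> B"
        then obtain n where "x \<in> U n" using U(1) by blast
        with x have "x \<in> UB n" by (auto simp: UB_def)
        then show "x \<in> (\<Union>n. UB n)" by blast
      qed
    qed (use U d in \<open>auto simp: UB_def\<close>)
    ultimately have "hausdorff_pre s \<delta> A + hausdorff_pre s \<delta> B \<le>
        (\<Sum>n. hausdorff_gauge s (UA n)) + (\<Sum>n. hausdorff_gauge s (UB n))"
      by (rule add_mono)
    also have "\<dots> = (\<Sum>n. hausdorff_gauge s (UA n) + hausdorff_gauge s (UB n))"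
      by (intro suminf_add) auto
    also have "\<dots> \<le> (\<Sum>n. hausdorff_gauge s (U n))"
    proof (intro suminf_le)
      fix n
      have "U n \<inter> A = {} \<or> U n \<inter> B = {}"
      proof (rule ccontr)
        assume "\<not> ?thesis"
        then obtain a b where ab: "a \<in> U n" "a \<in> A" "b \<in> U n" "b \<in> B" by blast
        then have "dist a b \<le> \<delta>"
          using diameter_bounded_bound[OF U(2), of a n b] U(3)[of n] by linarith
        with sep[of a b] ab d show False by simp
      qed
      then show "hausdorff_gauge s (UA n) + hausdorff_gauge s (UB n) \<le> hausdorff_gauge s (U n)"
        by (auto simp: UA_def UB_def)
    qed auto
    finally show "hausdorff_pre s \<delta> A + hausdorff_pre s \<delta> B \<le> (\<Sum>n. hausdorff_gauge s (U n))" .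
  qed
  have all: "hausdorff_pre s \<delta> A + hausdorff_pre s \<delta>' B \<le> hausdorff_outer s (A \<union> B)"
    if d: "\<delta> > 0" "\<delta>' > 0" for \<delta> \<delta>'
  proof -
    define m where "m = min (r/2) (min \<delta> \<delta>')"
    have m: "0 < m" "m < r" "m \<le> \<delta>" "m \<le> \<delta>'" using d r by (auto simp: m_def min_def)
    have "hausdorff_pre s \<delta> A + hausdorff_pre s \<delta>' B \<le> hausdorff_pre s m A + hausdorff_pre s m B"
      by (intro add_mono hausdorff_pre_antimono m)
    also have "\<dots> \<le> hausdorff_pre s m (A \<union> B)" by (rule small) (use m in auto)
    also have "\<dots> \<le> hausdorff_outer s (A \<union> B)" by (rule hausdorff_pre_le_outer) (use m in auto)
    finally show ?thesis .
  qed
  have half: "hausdorff_pre s \<delta> A + hausdorff_outer s B \<le> hausdorff_outer s (A \<union> B)"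
    if "\<delta> > 0" for \<delta>
    unfolding hausdorff_outer_def[of s B] using that
    by (subst ennreal_SUP_add_right) (auto intro!: SUP_least all simp: greaterThan_non_empty)
  show ?thesis
    unfolding hausdorff_outer_def[of s A]
    by (subst ennreal_SUP_add_left[symmetric]) (auto intro!: SUP_least half simp: greaterThan_non_empty)
qed

lemma hausdorff_outer_separated_sum:
  fixes D :: "nat \<Rightarrow> 'a::metric_space set"
  assumes sep: "\<And>m. \<exists>r>0. \<forall>a\<in>(\<Union>i<m. D i). \<forall>b\<in>D m. r \<le> dist a b"
  shows "(\<Sum>i<m. hausdorff_outer s (D i)) \<le> hausdorff_outer s (\<Union>i<m. D i)"
proof (induction m)
  case (Suc m)
  obtain r where r: "r > 0" "\<And>a b. a \<in> (\<Union>i<m. D i) \<Longrightarrow> b \<in> D m \<Longrightarrow> r \<le> dist a b"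
    using sep[of m] by blast
  have "(\<Sum>i<Suc m. hausdorff_outer s (D i)) \<le> hausdorff_outer s (\<Union>i<m. D i) + hausdorff_outer s (D m)"
    using Suc by (simp add: add_right_mono)
  also have "\<dots> \<le> hausdorff_outer s ((\<Union>i<m. D i) \<union> D m)"
    by (rule hausdorff_outer_separated[OF r])
  also have "(\<Union>i<m. D i) \<union> D m = (\<Union>i<Suc m. D i)" by (auto simp: lessThan_Suc)
  finally show ?case .
qed simp

lemma closed_hausdorff_lambda:
  fixes S E :: "'a::metric_space set"
  assumes "closed S"
  shows "hausdorff_outer s (E \<inter> S) + hausdorff_outer s (E - S) \<le> hausdorff_outer s E"
proof (cases "S = {} \<or> hausdorff_outer s E = \<infinity>")
  case True
  then show ?thesis by auto
next
  case False
  then have ne: "S \<noteq> {}" and fin: "hausdorff_outer s E \<noteq> \<infinity>" by auto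
  define T where "T n = {x \<in> E - S. infdist x S \<ge> 1 / real (Suc n)}" for n
  define D where "D n = T (Suc n) - T n" for n
  have Tmono: "T m \<subseteq> T n" if "m \<le> n" for m n
  proof
    fix x assume x: "x \<in> T m"
    have "1 / real (Suc n) \<le> 1 / real (Suc m)" using that by (intro divide_left_mono) auto
    with x show "x \<in> T n" by (auto simp: T_def)
  qed
  have cover: "E - S \<subseteq> (\<Union>n. T n)"
  proof
    fix x assume x: "x \<in> E - S"
    then have "infdist x S > 0"
      using \<open>closed S\<close> ne by (simp add: infdist_pos_not_in_closed)
    then obtain n where "1 / real (Suc n) < infdist x S"
      using nat_approx_posE by blast
    with x show "x \<in> (\<Union>n. T n)" by (auto simp: T_def intro!: exI[of _ n])
  qed
  have sepT: "hausdorff_outer s (E \<inter> S) + hausdorff_outer s (T n) \<le> hausdorff_outer s E" for n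
  proof -
    have "hausdorff_outer s (E \<inter> S) + hausdorff_outer s (T n) \<le> hausdorff_outer s ((E \<inter> S) \<union> T n)"
    proof (rule hausdorff_outer_separated[of "1 / real (Suc n)"])
      fix a b assume "a \<in> E \<inter> S" "b \<in> T n"
      then show "1 / real (Suc n) \<le> dist a b"
        using infdist_le[of a S b] by (auto simp: T_def dist_commute)
    qed simp
    also have "\<dots> \<le> hausdorff_outer s E" by (rule hausdorff_outer_mono) (auto simp: T_def)
    finally show ?thesis .
  qed
  have sepD: "1 / real (Suc (Suc m)) - 1 / real (Suc n) \<le> dist a b"
    if "Suc m \<le> n" "a \<in> D m" "b \<in> D n" for m n a b
  proof -
    have "infdist a S \<ge> 1 / real (Suc (Suc m))" using that(2) by (auto simp: D_def T_def)
    moreover have "infdist b S < 1 / real (Suc n)" using that(3) by (auto simp: D_def T_def)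
    moreover have "infdist a S \<le> infdist b S + dist a b" by (rule infdist_triangle)
    ultimately show ?thesis by linarith
  qed
  have alt: "(\<Sum>i<m. hausdorff_outer s (D (2 * i + k))) \<le> hausdorff_outer s E" for m k
  proof -
    have "(\<Sum>i<m. hausdorff_outer s (D (2 * i + k))) \<le> hausdorff_outer s (\<Union>i<m. D (2 * i + k))"
    proof (rule hausdorff_outer_separated_sum)
      fix m
      define r where "r = 1 / real (2 * m + k) - 1 / real (Suc (2 * m + k))"
      show "\<exists>r>0. \<forall>a\<in>(\<Union>i<m. D (2 * i + k)). \<forall>b\<in>D (2 * m + k). r \<le> dist a b"
      proof (cases "m = 0")
        case True then show ?thesis by (auto intro: exI[of _ 1])
      next
        case False
        then have "1 / real (Suc (2 * m + k)) < 1 / real (2 * m + k)"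
          by (intro divide_strict_left_mono) auto
        then have "r > 0" by (simp add: r_def)
        moreover have "r \<le> dist a b" if "i < m" "a \<in> D (2 * i + k)" "b \<in> D (2 * m + k)" for i a b
        proof -
          have "1 / real (2 * m + k) \<le> 1 / real (Suc (Suc (2 * i + k)))"
            using that(1) by (intro divide_left_mono) auto
          moreover have "1 / real (Suc (Suc (2 * i + k))) - 1 / real (Suc (2 * m + k)) \<le> dist a b"
            by (rule sepD) (use that in auto)
          ultimately show ?thesis by (simp add: r_def)
        qed
        ultimately show ?thesis by blast
      qed
    qed
    also have "\<dots> \<le> hausdorff_outer s E"
      by (rule hausdorff_outer_mono) (auto simp: D_def T_def)
    finally show ?thesis .
  qed
  have "(\<Sum>n. hausdorff_outer s (D n)) \<le> hausdorff_outer s E + hausdorff_outer s E"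
  proof (intro suminf_le_const summableI)
    fix n
    have "(\<Sum>i<n. hausdorff_outer s (D i)) \<le> (\<Sum>i<2 * n. hausdorff_outer s (D i))"
      by (intro sum_mono2) auto
    also have "\<dots> = (\<Sum>i<n. hausdorff_outer s (D (2 * i))) + (\<Sum>i<n. hausdorff_outer s (D (2 * i + 1)))"
      by (induction n) (auto simp: algebra_simps)
    also have "\<dots> \<le> hausdorff_outer s E + hausdorff_outer s E"
      using alt[where m=n and k=0] alt[where m=n and k=1] by (intro add_mono) simp_all
    finally show "(\<Sum>i<n. hausdorff_outer s (D i)) \<le> \<dots>" .
  qed
  also have "\<dots> < \<infinity>" using fin by (simp add: less_top)
  finally have sumfin: "(\<Sum>n. hausdorff_outer s (D n)) \<noteq> top" by simp
  have tail: "(\<lambda>n. \<Sum>i. hausdorff_outer s (D (i + n))) \<longlonglongrightarrow> 0"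
  proof -
    define d where "d i = enn2real (hausdorff_outer s (D i))" for i
    have fini: "hausdorff_outer s (D i) < top" for i
      using ennreal_suminf_lessD[of "\<lambda>n. hausdorff_outer s (D n)" top] sumfin
      by (simp add: less_top)
    have d: "hausdorff_outer s (D i) = ennreal (d i)" "d i \<ge> 0" for i
      using fini by (auto simp: d_def)
    have sd: "summable d"
      using sumfin by (intro summable_suminf_not_top) (auto simp: d)
    have "(\<Sum>i. hausdorff_outer s (D (i + n))) = ennreal (\<Sum>i. d (i + n))" for n
      using sd by (subst suminf_ennreal2[symmetric]) (auto simp: d summable_iff_shift)
    moreover have "(\<lambda>n. \<Sum>i. d (i + n)) \<longlonglongrightarrow> 0"
      using suminf_exist_split2[OF sd] .
    ultimately show ?thesis
      using tendsto_ennrealI by fastforce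
  qed
  have bound: "hausdorff_outer s (E - S) \<le> hausdorff_outer s (T n) + (\<Sum>i. hausdorff_outer s (D (i + n)))" for n
  proof -
    have "E - S \<subseteq> T n \<union> (\<Union>i. D (i + n))"
    proof
      fix x assume "x \<in> E - S"
      with cover have ex: "\<exists>k. x \<in> T k" by blast
      define k where "k = (LEAST k. x \<in> T k)"
      have k: "x \<in> T k" "\<And>j. j < k \<Longrightarrow> x \<notin> T j"
        using LeastI_ex[OF ex] not_less_Least by (auto simp: k_def)
      show "x \<in> T n \<union> (\<Union>i. D (i + n))"
      proof (cases "k \<le> n")
        case True then show ?thesis using k(1) Tmono by blast
      next
        case False
        then obtain i where "k = Suc (i + n)" by (metis add.commute less_imp_Suc_add not_le)
        then have "x \<in> D (i + n)" using k by (auto simp: D_def)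
        then show ?thesis by blast
      qed
    qed
    then have "hausdorff_outer s (E - S) \<le> hausdorff_outer s (T n \<union> (\<Union>i. D (i + n)))"
      by (rule hausdorff_outer_mono)
    also have "\<dots> \<le> hausdorff_outer s (T n) + hausdorff_outer s (\<Union>i. D (i + n))"
      by (rule hausdorff_outer_Un_le)
    also have "\<dots> \<le> hausdorff_outer s (T n) + (\<Sum>i. hausdorff_outer s (D (i + n)))"
      by (intro add_left_mono hausdorff_outer_subadd)
    finally show ?thesis .
  qed
  have le: "hausdorff_outer s (E \<inter> S) + hausdorff_outer s (E - S) \<le>
      hausdorff_outer s E + (\<Sum>i. hausdorff_outer s (D (i + n)))" for n
  proof -
    have "hausdorff_outer s (E \<inter> S) + hausdorff_outer s (E - S) \<le>
        hausdorff_outer s (E \<inter> S) + (hausdorff_outer s (T n) + (\<Sum>i. hausdorff_outer s (D (i + n))))"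
      by (intro add_left_mono bound)
    also have "\<dots> \<le> hausdorff_outer s E + (\<Sum>i. hausdorff_outer s (D (i + n)))"
      unfolding add.assoc[symmetric] by (intro add_right_mono sepT)
    finally show ?thesis .
  qed
  have "(\<lambda>n. hausdorff_outer s E + (\<Sum>i. hausdorff_outer s (D (i + n)))) \<longlonglongrightarrow> hausdorff_outer s E + 0"
    by (intro tendsto_add tendsto_const tail)
  then show ?thesis
    using le by (intro LIMSEQ_le_const[where X="\<lambda>n. hausdorff_outer s E + (\<Sum>i. hausdorff_outer s (D (i + n)))"]) auto
qed

lemma measure_space_hausdorff:
  "measure_space UNIV (sets borel) (hausdorff_outer s :: 'a::metric_space set \<Rightarrow> ennreal)"
proof -
  interpret sigma_algebra UNIV "UNIV :: 'a set set" using sigma_algebra_Pow[of "UNIV :: 'a set"] by simp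
  let ?L = "lambda_system UNIV UNIV (hausdorff_outer s :: 'a set \<Rightarrow> ennreal)"
  have L: "measure_space UNIV ?L (hausdorff_outer s)"
    by (rule caratheodory_lemma) (rule hausdorff_outer_measure_space)
  then interpret L: sigma_algebra UNIV ?L by (simp add: measure_space_def)
  have "S \<in> ?L" if "closed S" for S :: "'a set"
    unfolding lambda_system_eq
  proof (clarsimp, rule antisym)
    fix x :: "'a set"
    show "hausdorff_outer s (x \<inter> S) + hausdorff_outer s (x - S) \<le> hausdorff_outer s x"
      by (rule closed_hausdorff_lambda[OF that])
    show "hausdorff_outer s x \<le> hausdorff_outer s (x \<inter> S) + hausdorff_outer s (x - S)"
      using hausdorff_outer_Un_le[of s "x \<inter> S" "x - S"] by (simp add: Int_Diff_Un)
  qed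
  then have "sigma_sets UNIV (Collect closed) \<subseteq> ?L"
    by (intro L.sigma_sets_subset) auto
  then have sub: "sets (borel :: 'a measure) \<subseteq> ?L"
    by (simp add: borel_eq_closed)
  show ?thesis
    unfolding measure_space_def
  proof (intro conjI)
    show "sigma_algebra UNIV (sets (borel :: 'a measure))"
      using sets.sigma_algebra_axioms[of "borel :: 'a measure"] by simp
    show "positive (sets borel) (hausdorff_outer s :: 'a set \<Rightarrow> _)"
      by (simp add: positive_def)
    show "countably_additive (sets borel) (hausdorff_outer s :: 'a set \<Rightarrow> _)"
      using L sub unfolding measure_space_def countably_additive_def by blast
  qed
qed

lemma sets_hausdorff_measure [simp, measurable_cong]:
  "sets (hausdorff_measure s) = sets (borel :: 'a::metric_space measure)"
  using sets.sigma_sets_eq[of "borel :: 'a measure"] by (simp add: hausdorff_measure_def)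

lemma space_hausdorff_measure [simp]: "space (hausdorff_measure s) = UNIV"
  by (simp add: hausdorff_measure_def)

lemma emeasure_hausdorff_measure:
  "A \<in> sets borel \<Longrightarrow> emeasure (hausdorff_measure s) A = hausdorff_outer s A"
  using measure_space_hausdorff[of s] sets.sigma_sets_eq[of "borel :: 'a measure"]
  by (intro emeasure_measure_of[OF hausdorff_measure_def])
     (auto simp: measure_space_def sets_hausdorff_measure)


text \<open>
  The norm is an extended nonnegative real, so that a bound by a finite quantity includes
  square-integrability.
\<close>

definition L2_norm :: "'a measure \<Rightarrow> 'a set \<Rightarrow> ('a \<Rightarrow> 'b::real_normed_vector) \<Rightarrow> ennreal" where
  "L2_norm M S f =
     (let I = (\<integral>\<^sup>+x\<in>S. ennreal ((norm (f x))\<^sup>2) \<partial>M)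
      in if I = top then top else ennreal (sqrt (enn2real I)))"


section \<open>Smoothness, Lipschitz domains and normals\<close>

text \<open>For open \<open>U\<close>: \<open>k\<close>-times continuously differentiable on \<open>U\<close>.\<close>

primrec Ck_on :: "nat \<Rightarrow> 'a::euclidean_space set \<Rightarrow> ('a \<Rightarrow> 'b::real_normed_vector) \<Rightarrow> bool" where
  "Ck_on 0 U f \<longleftrightarrow> continuous_on U f"
| "Ck_on (Suc k) U f \<longleftrightarrow>
     (\<forall>x\<in>U. f differentiable (at x)) \<and>
     (\<forall>b\<in>Basis. Ck_on k U (\<lambda>x. frechet_derivative f (at x) b))"

text \<open>Smoothness up to the boundary: a smooth extension to an open neighbourhood exists.\<close>

definition smooth_on_closed :: "'a::euclidean_space set \<Rightarrow> ('a \<Rightarrow> 'b::real_normed_vector) \<Rightarrow> bool" where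
  "smooth_on_closed S f \<longleftrightarrow>
     (\<exists>U g. open U \<and> S \<subseteq> U \<and> (\<forall>k. Ck_on k U g) \<and> (\<forall>x\<in>S. g x = f x))"

definition bilipschitz_on :: "'a::metric_space set \<Rightarrow> ('a \<Rightarrow> 'b::metric_space) \<Rightarrow> bool" where
  "bilipschitz_on S f \<longleftrightarrow>
     inj_on f S \<and> (\<exists>L. L-lipschitz_on S f) \<and> (\<exists>L. L-lipschitz_on (f ` S) (inv_into S f))"

text \<open>
  Near each boundary point the set lies strictly below the graph, in some direction \<open>e\<close>, of a
  Lipschitz function on the hyperplane orthogonal to \<open>e\<close>.
\<close>

definition lipschitz_domain :: "'a::euclidean_space set \<Rightarrow> bool" where
  "lipschitz_domain \<Omega> \<longleftrightarrow> open \<Omega> \<and>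
     (\<forall>x\<in>frontier \<Omega>. \<exists>r>0. \<exists>e g L. norm e = 1 \<and> L-lipschitz_on {z. z \<bullet> e = 0} g \<and>
        \<Omega> \<inter> ball x r = {y \<in> ball x r. y \<bullet> e < g (y - (y \<bullet> e) *\<^sub>R e)})"

text \<open>
  \<open>\<nu>\<close> is normal to the tangent half-space: to first order at \<open>x\<close>, the set \<open>\<Omega>\<close> is
  \<open>{y. (y - x) \<bullet> \<nu> < 0}\<close>.  If \<open>\<Omega>\<close> is given near \<open>x\<close> by a graph, this holds for a
  (unique) \<open>\<nu>\<close> at the points over which the graph function is differentiable, so for a Lipschitz
  domain almost everywhere on the boundary; elsewhere the normal is set to 0.
\<close>

definition is_outward_normal :: "'a::euclidean_space set \<Rightarrow> 'a \<Rightarrow> 'a \<Rightarrow> bool" where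
  "is_outward_normal \<Omega> x \<nu> \<longleftrightarrow> norm \<nu> = 1 \<and>
     (\<forall>\<epsilon>>0. \<exists>r>0. \<forall>y\<in>ball x r.
        (y \<in> \<Omega> \<longrightarrow> (y - x) \<bullet> \<nu> \<le> \<epsilon> * norm (y - x)) \<and>
        (y \<notin> \<Omega> \<longrightarrow> - (\<epsilon> * norm (y - x)) \<le> (y - x) \<bullet> \<nu>))"

definition outward_normal :: "'a::euclidean_space set \<Rightarrow> 'a \<Rightarrow> 'a" where
  "outward_normal \<Omega> x =
     (if \<exists>\<nu>. is_outward_normal \<Omega> x \<nu> then THE \<nu>. is_outward_normal \<Omega> x \<nu> else 0)"

lemma is_outward_normal_unique:
  assumes "is_outward_normal \<Omega> x \<nu>" "is_outward_normal \<Omega> x \<nu>'"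
  shows "\<nu> = \<nu>'"
proof (rule ccontr)
  assume ne: "\<nu> \<noteq> \<nu>'"
  have n: "norm \<nu> = 1" "norm \<nu>' = 1" using assms by (auto simp: is_outward_normal_def)
  define w where "w = \<nu> - \<nu>'"
  have eq: "w \<bullet> \<nu> = (norm w)\<^sup>2 / 2" "w \<bullet> \<nu>' = - (norm w)\<^sup>2 / 2"
    using n by (auto simp: w_def power2_norm_eq_inner inner_diff norm_eq_1 inner_commute)
  have w: "norm w > 0" using ne by (simp add: w_def)
  define e where "e = norm w / 4"
  have e: "e > 0" using w by (simp add: e_def)
  obtain r where r: "r > 0" "\<And>y. y \<in> ball x r \<Longrightarrow> y \<in> \<Omega> \<Longrightarrow> (y - x) \<bullet> \<nu> \<le> e * norm (y - x)"
    using assms(1) e unfolding is_outward_normal_def by blast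
  obtain r' where r': "r' > 0"
      "\<And>y. y \<in> ball x r' \<Longrightarrow> y \<notin> \<Omega> \<Longrightarrow> - (e * norm (y - x)) \<le> (y - x) \<bullet> \<nu>'"
    using assms(2) e unfolding is_outward_normal_def by blast
  define t where "t = min r r' / (2 * norm w)"
  have t: "t > 0" "t * norm w < r" "t * norm w < r'" using r r' w by (auto simp: t_def)
  define y where "y = x + t *\<^sub>R w"
  have y: "y \<in> ball x r" "y \<in> ball x r'" using t by (auto simp: y_def dist_norm)
  have small: "e * norm (y - x) < t * (norm w)\<^sup>2 / 2"
    using t w by (simp add: y_def e_def power2_eq_square)
  show False
  proof (cases "y \<in> \<Omega>")
    case True
    from r(2)[OF y(1) this] small show False by (simp add: y_def eq)
  next
    case False
    from r'(2)[OF y(2) this] small show False by (simp add: y_def eq)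
  qed
qed

lemma outward_normal_eq: "is_outward_normal \<Omega> x \<nu> \<Longrightarrow> outward_normal \<Omega> x = \<nu>"
  unfolding outward_normal_def using is_outward_normal_unique by (auto intro!: the_equality)

definition grad :: "(real^'d \<Rightarrow> real) \<Rightarrow> real^'d \<Rightarrow> real^'d" where
  "grad f x = (\<chi> l. frechet_derivative f (at x) (axis l 1))"


section \<open>Splines\<close>

text \<open>
  A knot vector is a list, so the knot usually written with index \<open>i\<close> is \<open>\<Xi> ! (i - 1)\<close>, and there
  are \<open>length \<Xi> - p - 1\<close> B-splines, numbered from 0.
\<close>

definition open_knot_vector :: "nat \<Rightarrow> real list \<Rightarrow> bool" where
  "open_knot_vector p \<Xi> \<longleftrightarrow> sorted \<Xi> \<and> set \<Xi> \<subseteq> {0..1} \<and>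
     count_list \<Xi> 0 = p + 1 \<and> count_list \<Xi> 1 = p + 1 \<and>
     (\<forall>t. 0 < t \<and> t < 1 \<longrightarrow> count_list \<Xi> t \<le> p)"

text \<open>
  Cox-de Boor recursion; the convention 0/0 = 0 is that of the logic.  The last nonempty knot span
  is closed on the right, so that splines are continuous up to the right end point.
\<close>

fun bspline :: "real list \<Rightarrow> nat \<Rightarrow> nat \<Rightarrow> real \<Rightarrow> real" where
  "bspline \<Xi> 0 i x =
     (if \<Xi> ! i \<le> x \<and> x < \<Xi> ! (i + 1) \<or>
         \<Xi> ! i < \<Xi> ! (i + 1) \<and> \<Xi> ! (i + 1) = last \<Xi> \<and> x = last \<Xi> then 1 else 0)"
| "bspline \<Xi> (Suc q) i x =
     (x - \<Xi> ! i) / (\<Xi> ! (i + Suc q) - \<Xi> ! i) * bspline \<Xi> q i x +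
     (\<Xi> ! (i + Suc q + 1) - x) / (\<Xi> ! (i + Suc q + 1) - \<Xi> ! (i + 1)) * bspline \<Xi> q (i + 1) x"

definition tensor_bspline ::
  "nat \<Rightarrow> ('d \<Rightarrow> real list) \<Rightarrow> ('d \<Rightarrow> nat) \<Rightarrow> real^'d \<Rightarrow> real" where
  "tensor_bspline p \<Xi> i x = (\<Prod>l\<in>UNIV. bspline (\<Xi> l) p (i l) (x $ l))"

definition spline_indices :: "nat \<Rightarrow> ('d \<Rightarrow> real list) \<Rightarrow> ('d \<Rightarrow> nat) set" where
  "spline_indices p \<Xi> = {i. \<forall>l. i l < length (\<Xi> l) - p - 1}"

definition spline_space :: "nat \<Rightarrow> ('d \<Rightarrow> real list) \<Rightarrow> (real^'d \<Rightarrow> real) set" where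
  "spline_space p \<Xi> =
     {s. \<exists>c. \<forall>x. s x = (\<Sum>i\<in>spline_indices p \<Xi>. c i * tensor_bspline p \<Xi> i x)}"

text \<open>Polynomials of degree at most \<open>p\<close> in each coordinate.\<close>

definition poly_Q :: "nat \<Rightarrow> (real^'d \<Rightarrow> real) set" where
  "poly_Q p = {q. \<exists>c. \<forall>x. q x = (\<Sum>a | \<forall>l. a l \<le> p. c a * (\<Prod>l\<in>UNIV. (x $ l) ^ a l))}"

lemma finite_multi_indices: "finite {a :: 'd::finite \<Rightarrow> nat. \<forall>l. a l < n l}"
proof -
  have "{a :: 'd \<Rightarrow> nat. \<forall>l. a l < n l} = Pi\<^sub>E UNIV (\<lambda>l. {..<n l})" by (auto simp: PiE_def Pi_def)
  then show ?thesis by (simp add: finite_PiE)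
qed

lemma finite_spline_indices: "finite (spline_indices p (\<Xi> :: 'd::finite \<Rightarrow> real list))"
  unfolding spline_indices_def by (rule finite_multi_indices)

lemma finite_poly_indices: "finite {a :: 'd::finite \<Rightarrow> nat. \<forall>l. a l \<le> p}"
  using finite_multi_indices[of "\<lambda>_ :: 'd. Suc p"] by (simp add: less_Suc_eq_le)

definition knot_span :: "real list \<Rightarrow> real \<Rightarrow> real \<Rightarrow> bool" where
  "knot_span \<Xi> a b \<longleftrightarrow> a \<in> set \<Xi> \<and> b \<in> set \<Xi> \<and> a < b \<and> set \<Xi> \<inter> {a<..<b} = {}"

definition ref_mesh :: "('d::finite \<Rightarrow> real list) \<Rightarrow> (real^'d) set set" where
  "ref_mesh \<Xi> = {box a b | a b. \<forall>l. knot_span (\<Xi> l) (a $ l) (b $ l)}"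

text \<open>The index \<open>h\<close> labels the members of a family of knot vectors.\<close>

definition shape_regular :: "('h \<Rightarrow> 'd::finite \<Rightarrow> real list) \<Rightarrow> bool" where
  "shape_regular \<Xi> \<longleftrightarrow>
     (\<exists>\<sigma>>0. \<forall>h. \<forall>a b :: real^'d. (\<forall>l. knot_span (\<Xi> h l) (a $ l) (b $ l)) \<longrightarrow>
        \<sigma> \<le> Min (range (\<lambda>l. b $ l - a $ l)) / diameter (box a b))"


section \<open>Trimmed geometry and good elements\<close>

text \<open>
  In the following, \<open>F\<close> is the parametrization, defined on the closed unit cube, whose interior
  is the parametric domain.  The set \<open>pullback F S\<close> is \<open>F\<^sup>-\<^sup>1(S)\<close>: for \<open>S = \<Omega>\<close> the parametric trimmed
  domain, for a physical element \<open>S = F(Q)\<close> the box \<open>Q\<close>.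
\<close>

definition pullback :: "(real^'d \<Rightarrow> real^'d) \<Rightarrow> (real^'d) set \<Rightarrow> (real^'d) set" where
  "pullback F S = {x \<in> box 0 1. F x \<in> S}"

definition geo_inv :: "(real^'d \<Rightarrow> real^'d) \<Rightarrow> real^'d \<Rightarrow> real^'d" where
  "geo_inv F = inv_into (cbox 0 1) F"

definition spline_param :: "nat \<Rightarrow> ('d \<Rightarrow> real list) \<Rightarrow> (real^'d \<Rightarrow> real^'d) \<Rightarrow> bool" where
  "spline_param p \<Xi> F \<longleftrightarrow> (\<forall>j. \<exists>s\<in>spline_space p \<Xi>. \<forall>x\<in>cbox 0 1. F x $ j = s x)"

definition phys_mesh ::
  "(real^'d \<Rightarrow> real^'d) \<Rightarrow> (real^'d) set \<Rightarrow> ('d::finite \<Rightarrow> real list) \<Rightarrow> (real^'d) set set" where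
  "phys_mesh F \<Omega> \<Xi> = {F ` Q | Q. Q \<in> ref_mesh \<Xi> \<and> Q \<inter> pullback F \<Omega> \<noteq> {}}"

definition cut_mesh ::
  "(real^'d \<Rightarrow> real^'d) \<Rightarrow> (real^'d) set \<Rightarrow> (real^'d) set \<Rightarrow> ('d::finite \<Rightarrow> real list) \<Rightarrow> (real^'d) set set" where
  "cut_mesh F \<Omega> \<Gamma> \<Xi> = {K \<in> phys_mesh F \<Omega> \<Xi>. closure K \<inter> \<Gamma> \<noteq> {}}"

definition good_elements ::
  "(real^'d \<Rightarrow> real^'d) \<Rightarrow> (real^'d) set \<Rightarrow> real \<Rightarrow> ('d::finite \<Rightarrow> real list) \<Rightarrow> (real^'d) set set" where
  "good_elements F \<Omega> \<theta> \<Xi> =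
     {K \<in> phys_mesh F \<Omega> \<Xi>.
        measure lborel (pullback F \<Omega> \<inter> pullback F K) \<ge> \<theta> * measure lborel (pullback F K)}"

definition bad_elements ::
  "(real^'d \<Rightarrow> real^'d) \<Rightarrow> (real^'d) set \<Rightarrow> real \<Rightarrow> ('d::finite \<Rightarrow> real list) \<Rightarrow> (real^'d) set set" where
  "bad_elements F \<Omega> \<theta> \<Xi> = phys_mesh F \<Omega> \<Xi> - good_elements F \<Omega> \<theta> \<Xi>"

definition neighbors ::
  "(real^'d \<Rightarrow> real^'d) \<Rightarrow> (real^'d) set \<Rightarrow> ('d::finite \<Rightarrow> real list) \<Rightarrow> real \<Rightarrow> (real^'d) set \<Rightarrow> (real^'d) set set" where
  "neighbors F \<Omega> \<Xi> C\<^sub>N K =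
     {K' \<in> phys_mesh F \<Omega> \<Xi>. setdist K K' \<le> C\<^sub>N * diameter K} - {K}"

text \<open>
  The span of the functions \<open>B\<^sub>i|\<^sub>\<Omega>\<close>, where \<open>B\<^sub>i\<close> is the B-spline composed with the inverse of \<open>F\<close>.
  Its members are functions on \<open>\<Omega>\<close>; as total functions they are arbitrary outside \<open>\<Omega>\<close>.
\<close>

definition trimmed_space ::
  "(real^'d \<Rightarrow> real^'d) \<Rightarrow> (real^'d) set \<Rightarrow> nat \<Rightarrow> ('d \<Rightarrow> real list) \<Rightarrow> (real^'d \<Rightarrow> real) set" where
  "trimmed_space F \<Omega> p \<Xi> =
     {v. \<exists>c. \<forall>x\<in>\<Omega>. v x = (\<Sum>i\<in>spline_indices p \<Xi>. c i * tensor_bspline p \<Xi> i (geo_inv F x))}"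


section \<open>The stabilization operator\<close>

text \<open>
  The extension to \<open>K\<close> of the restriction of \<open>v\<close> to \<open>K \<inter> \<Omega>\<close> whose pull-back is a polynomial.
  For \<open>K \<subseteq> \<Omega>\<close> this is \<open>v\<close> itself on \<open>K\<close>.
\<close>

definition element_ext ::
  "(real^'d \<Rightarrow> real^'d) \<Rightarrow> (real^'d) set \<Rightarrow> nat \<Rightarrow> (real^'d) set \<Rightarrow> (real^'d \<Rightarrow> real) \<Rightarrow> real^'d \<Rightarrow> real" where
  "element_ext F \<Omega> p K v =
     (THE q. q \<in> poly_Q p \<and> (\<forall>x\<in>pullback F (K \<inter> \<Omega>). q x = v (F x))) \<circ> geo_inv F"

text \<open>
  The orthogonal projection of \<open>L\<^sup>2(K)\<close> onto the polynomials.  The result is a polynomial function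
  on the whole space, so it is its own natural extension to any other element.
\<close>

definition L2_proj :: "nat \<Rightarrow> (real^'d) set \<Rightarrow> (real^'d \<Rightarrow> real) \<Rightarrow> real^'d \<Rightarrow> real" where
  "L2_proj p K w =
     (THE q. q \<in> poly_Q p \<and>
        (\<forall>r\<in>poly_Q p. set_lebesgue_integral lborel K (\<lambda>x. (w x - q x) * r x) = 0))"

text \<open>
  On a good element the normal derivative at a point of \<open>closure K\<close> is the trace from inside \<open>K\<close>.
  The map \<open>nb\<close> chooses the good neighbor of each bad element.
\<close>

definition stab_op ::
  "(real^'d \<Rightarrow> real^'d) \<Rightarrow> (real^'d) set \<Rightarrow> nat \<Rightarrow> real \<Rightarrow> ('d::finite \<Rightarrow> real list) \<Rightarrow>
     ((real^'d) set \<Rightarrow> (real^'d) set) \<Rightarrow> (real^'d) set \<Rightarrow> (real^'d \<Rightarrow> real) \<Rightarrow> real^'d \<Rightarrow> real" where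
  "stab_op F \<Omega> p \<theta> \<Xi> nb K v x =
     (if K \<in> good_elements F \<Omega> \<theta> \<Xi>
      then Lim (at x within K) (\<lambda>y. grad (element_ext F \<Omega> p K v) y) \<bullet> outward_normal \<Omega> x
      else grad (L2_proj p (nb K) (element_ext F \<Omega> p (nb K) v)) x \<bullet> outward_normal \<Omega> x)"

end

theory Submission
  imports Defs "HOL-Computational_Algebra.Polynomial"
begin

text \<open>
  On a good element \<open>K' = F(Q')\<close> the function is \<open>v = q \<circ> F\<^sup>-\<^sup>1\<close> with \<open>q\<close> a polynomial.  The polynomial
  \<open>|\<nabla>q|\<^sup>2\<close> can be small only on a small part of \<open>Q'\<close> (a Remez inequality), so its supremum over \<open>Q'\<close> is
  controlled by its values on the fixed fraction of \<open>Q'\<close> that lies in the trimmed domain; as \<open>F\<close> is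
  bi-Lipschitz, \<open>sup |\<nabla>q|\<close> is bounded by \<open>h\<^bsup>-d/2\<^esup>\<close> times the norm of \<open>\<nabla>v\<close> on \<open>\<Omega> \<inter> K'\<close>.
  On a bad element with good neighbor \<open>K'\<close>, subtracting a constant from \<open>v\<close> before projecting shows that the projection
  deviates from a constant by at most a multiple of \<open>h sup |\<nabla>q|\<close> on a large part of \<open>K'\<close>; the Remez and
  Markov inequalities carry this over to the gradient of the extension at distance \<open>O(h)\<close>.  In both
  cases the stabilized normal derivative is bounded pointwise by a multiple of \<open>sup |\<nabla>q|\<close>, and
  integrating over \<open>\<Gamma>\<^sub>K\<close> costs a factor \<open>h\<^bsup>(d-1)/2\<^esup>\<close>.
\<close>

section \<open>Remez and Markov inequalities\<close>

text \<open>The constant may depend neither on the position of the cut nor on the shape of the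
  curved elements, so norm equivalence on one fixed reference configuration is not enough: the
  trimmed part of a good element is an arbitrary open set of sufficient measure, and
  \<open>K'\<close> is controlled only up to bi-Lipschitz distortion. The Remez inequality asks for
  the measure of a set and not for its shape. It therefore serves twice, for the trimmed part of
  \<open>Q'\<close> and for the unknown part of \<open>K'\<close> on which the projection is under
  control. The second obstacle is that \<open>v\<close> is not a polynomial in physical coordinates.
  Polynomial inequalities are applied only to \<open>q\<close> on \<open>Q'\<close> and to the
  projection on the physical side; the passage between the two needs just a pointwise comparison of
  gradients and a volume bound for Lipschitz images, not a change of variables. Finally, neighbors
  are close relative to the size of the bad element \<open>K\<close>, whereas the energy is measured
  on \<open>K'\<close>. The powers of the mesh size cancel only because the size of \<open>K\<close>
  is bounded by that of \<open>K'\<close>, which quasi-uniformity supplies.\<close>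

definition lagrange_poly :: "real set \<Rightarrow> real \<Rightarrow> real poly" where
  "lagrange_poly T t = (\<Prod>s\<in>T - {t}. smult (1 / (t - s)) [:- s, 1:])"

lemma poly_lagrange_poly: "poly (lagrange_poly T t) x = (\<Prod>s\<in>T - {t}. (x - s) / (t - s))"
  by (simp add: lagrange_poly_def poly_prod diff_divide_distrib)

lemma lagrange_interpolation:
  assumes T: "finite T" and deg: "degree P < card T"
  shows "P = (\<Sum>t\<in>T. smult (poly P t) (lagrange_poly T t))"
proof (rule poly_eqI_degree[where A = T])
  show "poly P x = poly (\<Sum>t\<in>T. smult (poly P t) (lagrange_poly T t)) x" if x: "x \<in> T" for x
  proof -
    have "poly (lagrange_poly T t) x = (if t = x then 1 else 0)" if "t \<in> T" for t
    proof (cases "t = x")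
      case False
      then show ?thesis
        using T x unfolding poly_lagrange_poly by (auto intro!: prod_zero bexI[of _ x])
    next
      case True
      have "(\<Prod>s\<in>T - {x}. (x - s) / (x - s)) = (\<Prod>s\<in>T - {x}. 1)"
        by (rule prod.cong) auto
      with True show ?thesis by (simp add: poly_lagrange_poly)
    qed
    then have "poly (\<Sum>t\<in>T. smult (poly P t) (lagrange_poly T t)) x =
        (\<Sum>t\<in>T. poly P t * (if t = x then 1 else 0))"
      by (simp add: poly_sum)
    also have "\<dots> = (\<Sum>t\<in>T. if t = x then poly P t else 0)"
      by (rule sum.cong) auto
    also have "\<dots> = poly P x" using T x by simp
    finally show ?thesis by simp
  qed
  have "degree (smult (poly P t) (lagrange_poly T t)) \<le> card T - 1" if "t \<in> T" for t
  proof -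
    have "degree (lagrange_poly T t) \<le> (\<Sum>s\<in>T - {t}. degree (smult (1 / (t - s)) [:- s, 1:]))"
      unfolding lagrange_poly_def using degree_prod_sum_le[of "T - {t}" "\<lambda>s. smult (1 / (t - s)) [:- s, 1:]"] T
      by (simp only: o_def finite_Diff)
    also have "\<dots> \<le> (\<Sum>s\<in>T - {t}. 1)"
      by (rule sum_mono) (auto intro: order_trans[OF degree_smult_le])
    also have "\<dots> = card T - 1" using T that by simp
    finally show ?thesis using degree_smult_le order_trans by blast
  qed
  then have "degree (\<Sum>t\<in>T. smult (poly P t) (lagrange_poly T t)) \<le> card T - 1"
    using T by (intro degree_sum_le) auto
  then show "degree (\<Sum>t\<in>T. smult (poly P t) (lagrange_poly T t)) < card T"
    using deg by simp
qed (fact deg)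

text \<open>Greedy choice: at most \<open>N\<close> intervals of radius \<open>\<delta>\<close>
  around the points already chosen have total length at most \<open>2 * N * \<delta>\<close>, hence
  cannot cover \<open>E\<close>. This is why \<open>N + 1\<close> points can be reached.\<close>

lemma exists_separated_points:
  fixes E :: "real set"
  assumes E: "E \<in> sets borel" and big: "emeasure lborel E > ennreal (2 * real N * \<delta>)" and \<delta>: "\<delta> > 0"
  shows "n \<le> Suc N \<Longrightarrow> \<exists>T\<subseteq>E. finite T \<and> card T = n \<and> (\<forall>s\<in>T. \<forall>t\<in>T. s \<noteq> t \<longrightarrow> \<delta> \<le> \<bar>s - t\<bar>)"
proof (induction n)
  case (Suc n)
  then obtain T where T: "T \<subseteq> E" "finite T" "card T = n"
    "\<And>s t. s \<in> T \<Longrightarrow> t \<in> T \<Longrightarrow> s \<noteq> t \<Longrightarrow> \<delta> \<le> \<bar>s - t\<bar>" by auto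
  have "emeasure lborel (\<Union>t\<in>T. cball t \<delta>) \<le> (\<Sum>t\<in>T. emeasure lborel (cball t \<delta>))"
    using T(2) by (intro emeasure_subadditive_finite) auto
  also have "\<dots> = (\<Sum>t\<in>T. ennreal (2 * \<delta>))"
    using \<delta> by (simp add: cball_eq_atLeastAtMost)
  also have "\<dots> = ennreal (2 * real n * \<delta>)"
    using \<delta> T(3) by (simp add: ennreal_of_nat_eq_real_of_nat ennreal_mult'[symmetric] mult_ac)
  also have "\<dots> \<le> ennreal (2 * real N * \<delta>)"
    using \<delta> Suc.prems by (intro ennreal_leI) auto
  also have "\<dots> < emeasure lborel E" by (rule big)
  finally have less: "emeasure lborel (\<Union>t\<in>T. cball t \<delta>) < emeasure lborel E" .
  have "\<not> E \<subseteq> (\<Union>t\<in>T. cball t \<delta>)"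
  proof
    assume "E \<subseteq> (\<Union>t\<in>T. cball t \<delta>)"
    then have "emeasure lborel E \<le> emeasure lborel (\<Union>t\<in>T. cball t \<delta>)"
      using T(2) by (intro emeasure_mono) auto
    with less show False by simp
  qed
  then obtain x where "x \<in> E" "x \<notin> (\<Union>t\<in>T. cball t \<delta>)" by blast
  then have x: "x \<in> E" "\<And>t. t \<in> T \<Longrightarrow> \<delta> < dist t x" by (auto simp: not_le)
  have "x \<notin> T" using x(2)[of x] \<delta> by auto
  then show ?case
    using T x by (intro exI[of _ "insert x T"])
      (auto simp: dist_real_def abs_minus_commute less_imp_le)
qed auto

text \<open>Interpolate at \<open>N + 1\<close> separated nodes in \<open>E\<close>. Nodes lie in
  the unit interval, so every factor of a Lagrange basis polynomial at 0 is at most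
  \<open>1 / \<delta>\<close>. The end point 0 is the case needed on rays, where it represents the
  centre.\<close>

lemma remez_interval:
  assumes \<eta>: "\<eta> > 0"
  shows "\<exists>C>0. \<forall>P E e. degree P \<le> N \<longrightarrow> E \<in> sets borel \<longrightarrow> E \<subseteq> {0..1} \<longrightarrow>
    ennreal \<eta> \<le> emeasure lborel E \<longrightarrow> (\<forall>t\<in>E. \<bar>poly P t\<bar> \<le> e) \<longrightarrow> \<bar>poly P 0\<bar> \<le> C * (e::real)"
proof -
  \<comment> \<open>The added 1 makes \<open>2 * N * \<delta> < \<eta>\<close> strict and covers
    \<open>N = 0\<close>.\<close>
  define \<delta> where "\<delta> = \<eta> / (2 * real N + 1)"
  have \<delta>: "\<delta> > 0" using \<eta> by (simp add: \<delta>_def)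
  show ?thesis
  proof (intro exI[of _ "real (Suc N) * (1 / \<delta>) ^ N"] conjI allI impI)
    show "real (Suc N) * (1 / \<delta>) ^ N > 0" using \<delta> by simp
    fix P :: "real poly" and E e
    assume P: "degree P \<le> N" and E: "E \<in> sets borel" "E \<subseteq> {0..1}" "ennreal \<eta> \<le> emeasure lborel E"
      and e: "\<forall>t\<in>E. \<bar>poly P t\<bar> \<le> e"
    have "2 * real N * \<delta> < \<eta>" using \<eta> by (simp add: \<delta>_def field_simps)
    then have "ennreal (2 * real N * \<delta>) < ennreal \<eta>"
      using \<delta> by (intro ennreal_lessI) (auto simp: \<eta>)
    then have big: "ennreal (2 * real N * \<delta>) < emeasure lborel E" using E(3) by simp
    obtain T where T: "T \<subseteq> E" "finite T" "card T = Suc N"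
      "\<And>s t. s \<in> T \<Longrightarrow> t \<in> T \<Longrightarrow> s \<noteq> t \<Longrightarrow> \<delta> \<le> \<bar>s - t\<bar>"
      using exists_separated_points[OF E(1) big \<delta>, of "Suc N"] by auto
    have "\<bar>poly P 0\<bar> = \<bar>\<Sum>t\<in>T. poly P t * poly (lagrange_poly T t) 0\<bar>"
      using P T by (subst lagrange_interpolation[of T P]) (auto simp: poly_sum)
    also have "\<dots> \<le> (\<Sum>t\<in>T. \<bar>poly P t * poly (lagrange_poly T t) 0\<bar>)" by (rule sum_abs)
    also have "\<dots> \<le> (\<Sum>t\<in>T. e * (1 / \<delta>) ^ N)"
    proof (rule sum_mono)
      fix t assume t: "t \<in> T"
      have "\<bar>poly (lagrange_poly T t) 0\<bar> = (\<Prod>s\<in>T - {t}. \<bar>s\<bar> / \<bar>t - s\<bar>)"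
        by (simp add: poly_lagrange_poly abs_prod)
      also have "\<dots> \<le> (\<Prod>s\<in>T - {t}. 1 / \<delta>)"
      proof (intro prod_mono conjI)
        fix s assume s: "s \<in> T - {t}"
        then have "\<bar>s\<bar> \<le> 1" using T(1) E(2) by auto
        moreover have "\<delta> \<le> \<bar>t - s\<bar>" using T(4)[of t s] s t by auto
        ultimately show "\<bar>s\<bar> / \<bar>t - s\<bar> \<le> 1 / \<delta>" using \<delta> by (intro frac_le) auto
      qed auto
      also have "\<dots> = (1 / \<delta>) ^ N" using t T by simp
      finally have "\<bar>poly (lagrange_poly T t) 0\<bar> \<le> (1 / \<delta>) ^ N" .
      moreover have "\<bar>poly P t\<bar> \<le> e" using e t T(1) by blast
      ultimately show "\<bar>poly P t * poly (lagrange_poly T t) 0\<bar> \<le> e * (1 / \<delta>) ^ N"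
        unfolding abs_mult using \<delta> by (intro mult_mono) auto
    qed
    also have "\<dots> = real (Suc N) * (1 / \<delta>) ^ N * e" using T(3) by simp
    finally show "\<bar>poly P 0\<bar> \<le> real (Suc N) * (1 / \<delta>) ^ N * e" .
  qed
qed

text \<open>Differentiating the interpolation formula at fixed nodes expresses the derivative at 0
  through finitely many values of \<open>P\<close>, with weights that depend on \<open>N\<close>
  alone.\<close>

lemma markov_at_0:
  "\<exists>C>0. \<forall>P B. degree P \<le> N \<longrightarrow> (\<forall>t\<in>{0..1}. \<bar>poly P t\<bar> \<le> B) \<longrightarrow> \<bar>poly (pderiv P) 0\<bar> \<le> C * (B::real)"
proof -
  \<comment> \<open>Equispaced nodes; the denominator \<open>Suc N\<close> stays positive for
    \<open>N = 0\<close>.\<close>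
  define T where "T = (\<lambda>j. real j / real (Suc N)) ` {..N}"
  have "inj_on (\<lambda>j. real j / real (Suc N)) {..N}" by (auto simp: inj_on_def)
  then have T: "finite T" "card T = Suc N" "T \<subseteq> {0..1}" by (auto simp: T_def card_image)
  define C where "C = 1 + (\<Sum>t\<in>T. \<bar>poly (pderiv (lagrange_poly T t)) 0\<bar>)"
  have sum0: "0 \<le> (\<Sum>t\<in>T. \<bar>poly (pderiv (lagrange_poly T t)) 0\<bar>)" by (rule sum_nonneg) auto
  show ?thesis
  proof (intro exI[of _ C] conjI allI impI)
    show "C > 0" using sum0 unfolding C_def by linarith
    fix P :: "real poly" and B
    assume P: "degree P \<le> N" and B: "\<forall>t\<in>{0..1}. \<bar>poly P t\<bar> \<le> B"
    have B0: "0 \<le> B" using B[rule_format, of 0] by simp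
    have "P = (\<Sum>t\<in>T. smult (poly P t) (lagrange_poly T t))"
      using P T by (intro lagrange_interpolation) auto
    \<comment> \<open>Exponent 1 puts the derivative into the form to which
      \<open>higher_pderiv_sum\<close> applies.\<close>
    then have "(pderiv ^^ 1) P = (pderiv ^^ 1) (\<Sum>t\<in>T. smult (poly P t) (lagrange_poly T t))"
      by (rule arg_cong)
    then have "pderiv P = (\<Sum>t\<in>T. smult (poly P t) (pderiv (lagrange_poly T t)))"
      unfolding higher_pderiv_sum by (simp add: pderiv_smult)
    then have "\<bar>poly (pderiv P) 0\<bar> = \<bar>\<Sum>t\<in>T. poly P t * poly (pderiv (lagrange_poly T t)) 0\<bar>"
      by (simp add: poly_sum)
    also have "\<dots> \<le> (\<Sum>t\<in>T. \<bar>poly P t * poly (pderiv (lagrange_poly T t)) 0\<bar>)" by (rule sum_abs)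
    also have "\<dots> \<le> (\<Sum>t\<in>T. B * \<bar>poly (pderiv (lagrange_poly T t)) 0\<bar>)"
      using B T(3) by (intro sum_mono) (auto simp: abs_mult intro!: mult_right_mono)
    also have "\<dots> \<le> C * B"
      using B0 by (simp add: C_def sum_distrib_left[symmetric] algebra_simps)
    finally show "\<bar>poly (pderiv P) 0\<bar> \<le> C * B" .
  qed
qed

text \<open>The one-dimensional inequalities see a function only along lines. This property is
  closed under sums and products, so it covers coordinatewise polynomials, their partial derivatives
  and the squared length of the gradient, with \<open>N\<close> as a bound on the total
  degree.\<close>

definition line_poly :: "nat \<Rightarrow> ('a::real_vector \<Rightarrow> real) \<Rightarrow> bool" where
  "line_poly N f \<longleftrightarrow> (\<forall>x y. \<exists>P. degree P \<le> N \<and> (\<forall>t. f (x + t *\<^sub>R y) = poly P t))"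

lemma line_polyE:
  assumes "line_poly N f"
  obtains P where "degree P \<le> N" "\<And>t. f (x + t *\<^sub>R y) = poly P t"
  using assms unfolding line_poly_def by metis

lemma line_poly_mono: "line_poly M f \<Longrightarrow> M \<le> N \<Longrightarrow> line_poly N f"
  unfolding line_poly_def by (meson order_trans)

lemma line_poly_const: "line_poly N (\<lambda>_. c)"
  unfolding line_poly_def by (intro allI exI[of _ "[:c:]"]) auto

lemma line_poly_add:
  assumes "line_poly N f" "line_poly N g"
  shows "line_poly N (\<lambda>x. f x + g x)"
  unfolding line_poly_def
proof (intro allI)
  fix x y
  obtain P where P: "degree P \<le> N" "\<And>t. f (x + t *\<^sub>R y) = poly P t" using assms(1) by (rule line_polyE) blast
  obtain R where R: "degree R \<le> N" "\<And>t. g (x + t *\<^sub>R y) = poly R t" using assms(2) by (rule line_polyE) blast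
  show "\<exists>Q. degree Q \<le> N \<and> (\<forall>t. f (x + t *\<^sub>R y) + g (x + t *\<^sub>R y) = poly Q t)"
    using P R by (intro exI[of _ "P + R"]) (auto intro: degree_add_le)
qed

lemma line_poly_mult:
  assumes "line_poly M f" "line_poly N g"
  shows "line_poly (M + N) (\<lambda>x. f x * g x)"
  unfolding line_poly_def
proof (intro allI)
  fix x y
  obtain P where P: "degree P \<le> M" "\<And>t. f (x + t *\<^sub>R y) = poly P t" using assms(1) by (rule line_polyE) blast
  obtain R where R: "degree R \<le> N" "\<And>t. g (x + t *\<^sub>R y) = poly R t" using assms(2) by (rule line_polyE) blast
  show "\<exists>Q. degree Q \<le> M + N \<and> (\<forall>t. f (x + t *\<^sub>R y) * g (x + t *\<^sub>R y) = poly Q t)"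
    using P R degree_mult_le[of P R] by (intro exI[of _ "P * R"]) auto
qed

lemma line_poly_sum:
  assumes "\<And>i. i \<in> I \<Longrightarrow> line_poly N (f i)"
  shows "line_poly N (\<lambda>x. \<Sum>i\<in>I. f i x)"
  using assms by (induction I rule: infinite_finite_induct) (auto intro: line_poly_const line_poly_add)

lemma line_poly_prod:
  assumes "finite I" "\<And>i. i \<in> I \<Longrightarrow> line_poly (N i) (f i)"
  shows "line_poly (\<Sum>i\<in>I. N i) (\<lambda>x. \<Prod>i\<in>I. f i x)"
  using assms by (induction I) (auto intro: line_poly_const line_poly_mult)

lemma line_poly_component: "line_poly 1 (\<lambda>x :: real^'n. x $ l)"
  unfolding line_poly_def
  by (intro allI) (auto intro!: exI[of _ "[:_, _:]"])

lemma line_poly_power: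
  assumes "line_poly M f"
  shows "line_poly (n * M) (\<lambda>x. f x ^ n)"
  using assms by (induction n) (auto intro: line_poly_const line_poly_mult)

text \<open>The preimage is a translate of \<open>A\<close> scaled by \<open>1 / t\<close>, and
  \<open>1 / t\<close> is at least 1.\<close>

lemma emeasure_lborel_homothety_ge:
  fixes A :: "'a::euclidean_space set"
  assumes A: "A \<in> sets borel" and t: "0 < t" "t \<le> 1"
  shows "emeasure lborel A \<le> emeasure lborel {y. x + t *\<^sub>R y \<in> A}"
proof -
  have m: "{y. x + t *\<^sub>R y \<in> A} \<in> sets borel"
    using A by measurable
  have "emeasure lborel A =
      emeasure (density (distr lborel borel (\<lambda>y. x + t *\<^sub>R y)) (\<lambda>_. ennreal (\<bar>t\<bar> ^ DIM('a)))) A"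
    using lborel_affine[of t x] t by simp
  also have "\<dots> = ennreal (\<bar>t\<bar> ^ DIM('a)) * emeasure lborel {y. x + t *\<^sub>R y \<in> A}"
    using A by (simp add: emeasure_density_const emeasure_distr vimage_def)
  also have "\<dots> \<le> 1 * emeasure lborel {y. x + t *\<^sub>R y \<in> A}"
    using t by (intro mult_right_mono) (auto simp: power_le_one)
  finally show ?thesis by simp
qed

text \<open>
  Average over the homotheties \<open>y \<mapsto> x + t y\<close>, \<open>1/2 \<le> t \<le> 1\<close>: a large set \<open>A\<close> meets some ray from \<open>x\<close>
  in a large set of parameters, and the one-dimensional inequality applies on that ray.
\<close>

lemma remez:
  assumes \<kappa>: "\<kappa> > 0"
  shows "\<exists>C>0. \<forall>(f :: 'a::euclidean_space \<Rightarrow> real) x D A e. line_poly N f \<longrightarrow> A \<in> sets borel \<longrightarrow> A \<subseteq> cball x D \<longrightarrow>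
    0 < D \<longrightarrow> ennreal (\<kappa> * D ^ DIM('a)) \<le> emeasure lborel A \<longrightarrow> (\<forall>y\<in>A. \<bar>f y\<bar> \<le> e) \<longrightarrow> \<bar>f x\<bar> \<le> C * e"
proof -
  define V where "V = unit_ball_vol (real DIM('a))"
  have V: "V > 0" by (simp add: V_def)
  \<comment> \<open>With this value the upper bound \<open>\<eta> * V * (2 * D) ^ DIM('a)\<close> of
    the double integral below is \<open>\<kappa> * D ^ DIM('a) / 4\<close>, half of its lower
    bound.\<close>
  define \<eta> where "\<eta> = \<kappa> / (4 * V * 2 ^ DIM('a))"
  have \<eta>: "\<eta> > 0" using \<kappa> V by (simp add: \<eta>_def)
  obtain C where C: "C > 0" "\<And>P E e. degree P \<le> N \<Longrightarrow> E \<in> sets borel \<Longrightarrow> E \<subseteq> {0..1} \<Longrightarrow>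
    ennreal \<eta> \<le> emeasure lborel E \<Longrightarrow> (\<And>t. t \<in> E \<Longrightarrow> \<bar>poly P t\<bar> \<le> e) \<Longrightarrow> \<bar>poly P 0\<bar> \<le> C * (e::real)"
    using remez_interval[OF \<eta>, of N] by metis
  have "\<bar>f x\<bar> \<le> C * e"
    if f: "line_poly N f" and A: "A \<in> sets borel" "A \<subseteq> cball x D" and D: "0 < D"
      and big: "ennreal (\<kappa> * D ^ DIM('a)) \<le> emeasure lborel A" and e: "\<And>y. y \<in> A \<Longrightarrow> \<bar>f y\<bar> \<le> e"
    for f :: "'a \<Rightarrow> real" and x D A e
  proof (rule ccontr)
    assume contra: "\<not> \<bar>f x\<bar> \<le> C * e"
    \<comment> \<open>Parameters stay above 1/2 so that only \<open>y\<close> in the ball of radius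
      \<open>2 * D\<close> can contribute.\<close>
    define E where "E y = {t \<in> {1/2..1}. x + t *\<^sub>R y \<in> A}" for y
    \<comment> \<open>A larger parameter set would let the one-dimensional inequality on this ray
      bound \<open>f x\<close> by \<open>C * e\<close>, against the assumption.\<close>
    have small: "emeasure lborel (E y) \<le> ennreal \<eta>" for y
    proof (rule ccontr)
      assume "\<not> emeasure lborel (E y) \<le> ennreal \<eta>"
      then have le: "ennreal \<eta> \<le> emeasure lborel (E y)" by simp
      obtain P where P: "degree P \<le> N" "\<And>t. f (x + t *\<^sub>R y) = poly P t"
        using f by (rule line_polyE) blast
      have "E y \<in> sets borel" unfolding E_def using A(1) by measurable
      then have "\<bar>poly P 0\<bar> \<le> C * e"
        by (rule C(2)[OF P(1) _ _ le]) (auto simp: E_def P(2)[symmetric] e)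
      with contra P(2)[of 0] show False by simp
    qed
    have [measurable]: "A \<in> sets borel" by fact
    define k where "k = (\<lambda>t y. indicator {1/2..1::real} t * indicator A (x + t *\<^sub>R y) :: ennreal)"
    have [measurable]: "case_prod k \<in> borel_measurable (lborel \<Otimes>\<^sub>M lborel)"
      unfolding k_def by measurable
    have "ennreal (1/2) * emeasure lborel A = (\<integral>\<^sup>+t. indicator {1/2..1::real} t * emeasure lborel A \<partial>lborel)"
      by (simp add: nn_integral_multc)
    also have "\<dots> \<le> (\<integral>\<^sup>+t. (\<integral>\<^sup>+y. k t y \<partial>lborel) \<partial>lborel)"
    proof (rule nn_integral_mono)
      fix t :: real
      have "(\<integral>\<^sup>+y. k t y \<partial>lborel) = indicator {1/2..1} t * (\<integral>\<^sup>+y. indicator A (x + t *\<^sub>R y) \<partial>lborel)"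
        unfolding k_def by (intro nn_integral_cmult) measurable
      also have "(\<integral>\<^sup>+y. indicator A (x + t *\<^sub>R y) \<partial>lborel) = (\<integral>\<^sup>+y. indicator {y. x + t *\<^sub>R y \<in> A} y \<partial>lborel)"
        by (intro nn_integral_cong) (auto simp: indicator_def)
      also have "\<dots> = emeasure lborel {y. x + t *\<^sub>R y \<in> A}"
        by (intro nn_integral_indicator) measurable
      finally show "indicator {1/2..1} t * emeasure lborel A \<le> (\<integral>\<^sup>+y. k t y \<partial>lborel)"
        using emeasure_lborel_homothety_ge[OF A(1), of t x] by (auto simp: indicator_def)
    qed
    also have "\<dots> = (\<integral>\<^sup>+y. (\<integral>\<^sup>+t. k t y \<partial>lborel) \<partial>lborel)"
      by (rule lborel_pair.Fubini'[symmetric]) measurable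
    also have "\<dots> \<le> (\<integral>\<^sup>+y. ennreal \<eta> * indicator (cball 0 (2 * D)) y \<partial>(lborel :: 'a measure))"
    proof (rule nn_integral_mono)
      fix y :: 'a
      have "(\<integral>\<^sup>+t. k t y \<partial>lborel) = (\<integral>\<^sup>+t. indicator (E y) t \<partial>lborel)"
        by (intro nn_integral_cong) (auto simp: k_def E_def indicator_def)
      also have "\<dots> = emeasure lborel (E y)"
        unfolding E_def by (intro nn_integral_indicator) measurable
      also have "\<dots> \<le> ennreal \<eta> * indicator (cball 0 (2 * D)) y"
      proof (cases "y \<in> cball 0 (2 * D)")
        case False
        have "E y = {}"
        proof (rule ccontr)
          assume "E y \<noteq> {}"
          then obtain t where t: "1/2 \<le> t" "x + t *\<^sub>R y \<in> A" by (auto simp: E_def)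
          then have "t * norm y \<le> D" using A(2) by (auto simp: dist_norm)
          moreover have "1/2 * norm y \<le> t * norm y" using t by (intro mult_right_mono) auto
          ultimately show False using False by simp
        qed
        then show ?thesis by simp
      qed (use small in simp)
      finally show "(\<integral>\<^sup>+t. k t y \<partial>lborel) \<le> ennreal \<eta> * indicator (cball 0 (2 * D)) y" .
    qed
    also have "\<dots> = ennreal \<eta> * emeasure lborel (cball (0::'a) (2 * D))"
      by (rule nn_integral_cmult_indicator) simp
    also have "\<dots> = ennreal (\<eta> * (V * (2 * D) ^ DIM('a)))"
      using D \<eta> V by (simp add: emeasure_cball V_def ennreal_mult)
    also have "\<eta> * (V * (2 * D) ^ DIM('a)) = \<kappa> * D ^ DIM('a) / 4"
      using V by (simp add: \<eta>_def power_mult_distrib)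
    finally have "ennreal (1/2) * emeasure lborel A \<le> ennreal (\<kappa> * D ^ DIM('a) / 4)" .
    moreover have "ennreal (1/2) * ennreal (\<kappa> * D ^ DIM('a)) \<le> ennreal (1/2) * emeasure lborel A"
      by (intro mult_left_mono big) auto
    ultimately have "ennreal (1/2) * ennreal (\<kappa> * D ^ DIM('a)) \<le> ennreal (\<kappa> * D ^ DIM('a) / 4)"
      by (rule order_trans[rotated])
    then have "ennreal (1/2 * (\<kappa> * D ^ DIM('a))) \<le> ennreal (\<kappa> * D ^ DIM('a) / 4)"
      using \<kappa> D by (subst ennreal_mult) auto
    then have "1/2 * (\<kappa> * D ^ DIM('a)) \<le> \<kappa> * D ^ DIM('a) / 4"
      using \<kappa> D by (subst (asm) ennreal_le_iff) auto
    moreover have "\<kappa> * D ^ DIM('a) > 0" using \<kappa> D by simp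
    ultimately show False by simp
  qed
  then show ?thesis using C(1) by blast
qed

section \<open>Coordinatewise polynomials\<close>

lemma poly_Q_add: "f \<in> poly_Q p \<Longrightarrow> g \<in> poly_Q p \<Longrightarrow> (\<lambda>x. f x + g x) \<in> poly_Q p"
proof -
  assume "f \<in> poly_Q p" "g \<in> poly_Q p"
  then obtain c c' where "\<And>x. f x = (\<Sum>a | \<forall>l. a l \<le> p. c a * (\<Prod>l\<in>UNIV. (x $ l) ^ a l))"
    "\<And>x. g x = (\<Sum>a | \<forall>l. a l \<le> p. c' a * (\<Prod>l\<in>UNIV. (x $ l) ^ a l))"
    by (auto simp: poly_Q_def)
  then show ?thesis
    unfolding poly_Q_def
    by (auto intro!: exI[of _ "\<lambda>a. c a + c' a"] simp: sum.distrib[symmetric] distrib_right)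
qed

lemma poly_Q_cmult: "f \<in> poly_Q p \<Longrightarrow> (\<lambda>x. k * f x) \<in> poly_Q p"
proof -
  assume "f \<in> poly_Q p"
  then obtain c where "\<And>x. f x = (\<Sum>a | \<forall>l. a l \<le> p. c a * (\<Prod>l\<in>UNIV. (x $ l) ^ a l))"
    by (auto simp: poly_Q_def)
  then show ?thesis
    unfolding poly_Q_def
    by (auto intro!: exI[of _ "\<lambda>a. k * c a"] simp: sum_distrib_left mult.assoc)
qed

lemma poly_Q_diff: "f \<in> poly_Q p \<Longrightarrow> g \<in> poly_Q p \<Longrightarrow> (\<lambda>x. f x - g x) \<in> poly_Q p"
  using poly_Q_add[of f p "\<lambda>x. (-1) * g x"] poly_Q_cmult[of g p "-1"] by simp

lemma poly_Q_sum: "(\<And>i. i \<in> I \<Longrightarrow> f i \<in> poly_Q p) \<Longrightarrow> (\<lambda>x. \<Sum>i\<in>I. f i x) \<in> poly_Q p"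
proof (induction I rule: infinite_finite_induct)
  case (insert i I)
  then show ?case by (auto intro: poly_Q_add)
qed (auto simp: poly_Q_def intro!: exI[of _ "\<lambda>_. 0"])

text \<open>Expanding the product of sums yields one monomial per multi-index, with the product of
  the univariate coefficients in front. Tensor-product B-splines restricted to an element have this
  form.\<close>

lemma poly_Q_prod_poly:
  fixes P :: "'d::finite \<Rightarrow> real poly"
  assumes "\<And>l. degree (P l) \<le> p"
  shows "(\<lambda>x. \<Prod>l\<in>UNIV. poly (P l) (x $ l)) \<in> poly_Q p"
proof -
  have eq: "poly (P l) y = (\<Sum>i\<le>p. coeff (P l) i * y ^ i)" for l y
    using assms[of l] unfolding poly_altdef
    by (intro sum.mono_neutral_left) (auto simp: coeff_eq_0)
  have PiE: "Pi\<^sub>E UNIV (\<lambda>_. {..p}) = {a :: 'd \<Rightarrow> nat. \<forall>l. a l \<le> p}" by (auto simp: PiE_def Pi_def)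
  have "(\<Prod>l\<in>UNIV. poly (P l) (x $ l)) =
      (\<Sum>a | \<forall>l. a l \<le> p. (\<Prod>l\<in>UNIV. coeff (P l) (a l)) * (\<Prod>l\<in>UNIV. (x $ l) ^ a l))" for x
    unfolding eq by (subst prod_sum_PiE) (auto simp: PiE prod.distrib)
  then show ?thesis
    unfolding poly_Q_def by (auto intro!: exI[of _ "\<lambda>a. \<Prod>l\<in>UNIV. coeff (P l) (a l)"])
qed

lemma poly_Q_const: "(\<lambda>_ :: real^'d. k) \<in> poly_Q p"
  using poly_Q_cmult[OF poly_Q_prod_poly[where P = "\<lambda>_ :: 'd. 1"], where k = k] by simp

lemma poly_Q_monomial: "\<forall>l. a l \<le> p \<Longrightarrow> (\<lambda>x :: real^'d. \<Prod>l\<in>UNIV. (x $ l) ^ a l) \<in> poly_Q p"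
  using poly_Q_prod_poly[where P = "\<lambda>l :: 'd. monom 1 (a l)" and p = p]
  by (auto simp: poly_monom degree_monom_eq)

section \<open>Gradients of coordinatewise polynomials\<close>

lemma grad_has_derivative:
  assumes "f differentiable (at x)"
  shows "(f has_derivative (\<lambda>v. grad f x \<bullet> v)) (at x)"
proof -
  have D: "(f has_derivative frechet_derivative f (at x)) (at x)"
    using assms by (simp add: frechet_derivative_works)
  then interpret bounded_linear "frechet_derivative f (at x)" by (rule has_derivative_bounded_linear)
  have "frechet_derivative f (at x) v = grad f x \<bullet> v" for v
  proof -
    have "v = (\<Sum>l\<in>UNIV. v $ l *\<^sub>R axis l 1)"
      by (simp add: vec_eq_iff axis_def if_distrib[of "times _"] cong: if_cong)
    then have "frechet_derivative f (at x) v = (\<Sum>l\<in>UNIV. v $ l *\<^sub>R frechet_derivative f (at x) (axis l 1))"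
      by (metis (no_types, lifting) scaleR sum sum.cong)
    then show ?thesis by (simp add: grad_def inner_vec_def mult.commute)
  qed
  then show ?thesis using D by presburger
qed

lemma grad_eqI: "(f has_derivative (\<lambda>v. g \<bullet> v)) (at x) \<Longrightarrow> grad f x = g"
  by (auto simp: grad_def vec_eq_iff inner_axis dest!: frechet_derivative_at[symmetric])

text \<open>The product rule on each monomial. Explicit partial derivatives make both continuity and
  the degree bound along lines visible.\<close>

lemma poly_Q_derivative:
  fixes q :: "real^'d \<Rightarrow> real"
  assumes "q \<in> poly_Q p"
  shows "\<exists>g. (\<forall>l. line_poly (p * CARD('d)) (g l) \<and> continuous_on UNIV (g l)) \<and>
    (\<forall>x. (q has_derivative (\<lambda>v. (\<chi> l. g l x) \<bullet> v)) (at x))"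
proof -
  obtain c where c: "\<And>x. q x = (\<Sum>a | \<forall>l. a l \<le> p. c a * (\<Prod>l\<in>UNIV. (x $ l) ^ a l))"
    using assms by (auto simp: poly_Q_def)
  let ?A = "{a :: 'd \<Rightarrow> nat. \<forall>l. a l \<le> p}"
  \<comment> \<open>For \<open>a l = 0\<close> the truncated exponent \<open>a l - 1\<close> is
    harmless, since the factor \<open>real (a l)\<close> vanishes.\<close>
  define g where "g l x = (\<Sum>a\<in>?A. c a * ((real (a l) * (x $ l) ^ (a l - 1)) * (\<Prod>m\<in>UNIV - {l}. (x $ m) ^ a m)))"
    for l and x :: "real^'d"
  show ?thesis
  proof (intro exI[of _ g] conjI allI)
    fix l
    have "line_poly (p * CARD('d)) (\<lambda>x :: real^'d. c a * ((real (a l) * (x $ l) ^ (a l - 1)) * (\<Prod>m\<in>UNIV - {l}. (x $ m) ^ a m)))"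
      if a: "a \<in> ?A" for a
    proof (rule line_poly_mono)
      show "line_poly (0 + ((0 + (a l - 1) * 1) + (\<Sum>m\<in>UNIV - {l}. a m * 1)))
          (\<lambda>x :: real^'d. c a * ((real (a l) * (x $ l) ^ (a l - 1)) * (\<Prod>m\<in>UNIV - {l}. (x $ m) ^ a m)))"
        by (intro line_poly_mult line_poly_const line_poly_power line_poly_component line_poly_prod) auto
      have "(a l - 1) + (\<Sum>m\<in>UNIV - {l}. a m) \<le> a l + (\<Sum>m\<in>UNIV - {l}. a m)" by simp
      also have "\<dots> = (\<Sum>m\<in>UNIV. a m)" by (subst (2) sum.remove[of _ l]) auto
      also have "\<dots> \<le> p * CARD('d)" using sum_bounded_above[of UNIV a p] a by (simp add: mult.commute)
      finally show "0 + ((0 + (a l - 1) * 1) + (\<Sum>m\<in>UNIV - {l}. a m * 1)) \<le> p * CARD('d)" by simp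
    qed
    then show "line_poly (p * CARD('d)) (g l)"
      unfolding g_def by (rule line_poly_sum)
    show "continuous_on UNIV (g l)"
      unfolding g_def by (intro continuous_intros)
  next
    fix x :: "real^'d"
    have "(q has_derivative (\<lambda>v. \<Sum>a\<in>?A. c a * (\<Sum>l\<in>UNIV. (real (a l) * v $ l * (x $ l) ^ (a l - 1)) * (\<Prod>m\<in>UNIV - {l}. (x $ m) ^ a m)))) (at x)"
      unfolding c[abs_def]
      by (rule has_derivative_sum has_derivative_mult_right has_derivative_prod has_derivative_power
          bounded_linear_imp_has_derivative[OF bounded_linear_vec_nth] derivative_eq_intros refl | simp)+
    moreover have "(\<Sum>a\<in>?A. c a * (\<Sum>l\<in>UNIV. (real (a l) * v $ l * (x $ l) ^ (a l - 1)) * (\<Prod>m\<in>UNIV - {l}. (x $ m) ^ a m))) =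
       (\<chi> l. g l x) \<bullet> v" for v
      unfolding inner_vec_def g_def
      by (simp add: sum_distrib_left sum_distrib_right mult_ac) (rule sum.swap)
    ultimately show "(q has_derivative (\<lambda>v. (\<chi> l. g l x) \<bullet> v)) (at x)" by simp
  qed
qed

lemma
  fixes q :: "real^'d \<Rightarrow> real"
  assumes "q \<in> poly_Q p"
  shows poly_Q_has_derivative: "(q has_derivative (\<lambda>v. grad q x \<bullet> v)) (at x)"
    and continuous_on_grad_poly_Q: "continuous_on S (grad q)"
    and line_poly_grad_poly_Q: "line_poly (p * CARD('d)) (\<lambda>x. grad q x $ l)"
proof -
  obtain g where g: "\<And>l. line_poly (p * CARD('d)) (g l)" "\<And>l. continuous_on UNIV (g l)"
    "\<And>x. (q has_derivative (\<lambda>v. (\<chi> l. g l x) \<bullet> v)) (at x)"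
    using poly_Q_derivative[OF assms] by blast
  have eq: "grad q = (\<lambda>x. \<chi> l. g l x)"
    using g(3) by (intro ext grad_eqI)
  show "(q has_derivative (\<lambda>v. grad q x \<bullet> v)) (at x)" using g(3) by (simp add: eq)
  show "continuous_on S (grad q)"
    unfolding eq by (intro continuous_on_vec_lambda continuous_on_subset[OF g(2)]) auto
  show "line_poly (p * CARD('d)) (\<lambda>x. grad q x $ l)" using g(1) by (simp add: eq)
qed

lemma poly_Q_differentiable: "q \<in> poly_Q p \<Longrightarrow> q differentiable (at x)"
  using poly_Q_has_derivative unfolding differentiable_def by blast

lemma poly_Q_continuous: "q \<in> poly_Q p \<Longrightarrow> continuous_on S q"
  using poly_Q_has_derivative has_derivative_continuous
  by (metis continuous_at_imp_continuous_on)

lemma line_poly_poly_Q: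
  fixes q :: "real^'d \<Rightarrow> real"
  assumes "q \<in> poly_Q p"
  shows "line_poly (p * CARD('d)) q"
proof -
  obtain c where c: "\<And>x. q x = (\<Sum>a | \<forall>l. a l \<le> p. c a * (\<Prod>l\<in>UNIV. (x $ l) ^ a l))"
    using assms by (auto simp: poly_Q_def)
  have "line_poly (p * CARD('d)) (\<lambda>x :: real^'d. c a * (\<Prod>l\<in>UNIV. (x $ l) ^ a l))"
    if a: "\<forall>l. a l \<le> p" for a
  proof (rule line_poly_mono)
    show "line_poly (0 + (\<Sum>l\<in>UNIV. a l * 1)) (\<lambda>x :: real^'d. c a * (\<Prod>l\<in>UNIV. (x $ l) ^ a l))"
      by (intro line_poly_mult line_poly_const line_poly_power line_poly_component line_poly_prod) auto
    show "0 + (\<Sum>l\<in>UNIV. a l * 1) \<le> p * CARD('d)"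
      using sum_bounded_above[of UNIV a p] a by (simp add: mult.commute)
  qed
  then show ?thesis unfolding c[abs_def] by (intro line_poly_sum) auto
qed

text \<open>Squaring keeps the size of the gradient polynomial along lines, so that the Remez
  inequality applies to it.\<close>

lemma line_poly_norm_grad:
  fixes q :: "real^'d \<Rightarrow> real"
  assumes "q \<in> poly_Q p"
  shows "line_poly (2 * (p * CARD('d))) (\<lambda>x. (norm (grad q x))\<^sup>2)"
proof -
  have "(\<lambda>x. (norm (grad q x))\<^sup>2) = (\<lambda>x. \<Sum>l\<in>UNIV. (grad q x $ l) ^ 2)"
    by (simp only: power2_norm_eq_inner inner_vec_def) (simp add: power2_eq_square)
  then show ?thesis
    using line_poly_grad_poly_Q[OF assms] by (auto intro!: line_poly_sum line_poly_power)
qed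

text \<open>On the line from \<open>x\<close> to a point of \<open>S\<close> the restriction
  vanishes for an open, nonempty and hence infinite set of parameters.\<close>

lemma line_poly_eq_0:
  fixes f :: "'a::euclidean_space \<Rightarrow> real"
  assumes f: "line_poly N f" and S: "open S" "S \<noteq> {}" "\<And>x. x \<in> S \<Longrightarrow> f x = 0"
  shows "f x = 0"
proof -
  obtain s where s: "s \<in> S" using S(2) by blast
  obtain P where P: "\<And>t. f (x + t *\<^sub>R (s - x)) = poly P t" using f by (rule line_polyE) blast
  have "open ((\<lambda>t. x + t *\<^sub>R (s - x)) -` S)"
    using S(1) by (intro open_vimage continuous_intros) auto
  moreover have "1 \<in> (\<lambda>t. x + t *\<^sub>R (s - x)) -` S" using s by simp
  ultimately have "infinite ((\<lambda>t. x + t *\<^sub>R (s - x)) -` S)"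
    using finite_imp_not_open by blast
  moreover have "(\<lambda>t. x + t *\<^sub>R (s - x)) -` S \<subseteq> {t. poly P t = 0}"
    using S(3) by (auto simp: P[symmetric])
  ultimately have "infinite {t. poly P t = 0}" using finite_subset by blast
  then have "P = 0" using poly_roots_finite by blast
  then show ?thesis using P[of 0] by simp
qed

text \<open>Identity principle; it gives the uniqueness behind the definite descriptions in
  \<open>element_ext\<close> and \<open>L2_proj\<close>.\<close>

lemma poly_Q_eqI:
  assumes "q \<in> poly_Q p" "r \<in> poly_Q p" and S: "open S" "S \<noteq> {}" "\<And>x. x \<in> S \<Longrightarrow> q x = r x"
  shows "q = r"
proof
  fix x
  have "(\<lambda>x. q x - r x) x = 0"
    by (rule line_poly_eq_0[OF line_poly_poly_Q[OF poly_Q_diff[OF assms(1,2)]] S(1,2)]) (use S in auto)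
  then show "q x = r x" by simp
qed

text \<open>\<open>markov_at_0\<close> is applied to \<open>f\<close> along each coordinate segment
  of length \<open>\<delta>\<close> starting at \<open>x\<close>, whose derivative at 0 is
  \<open>\<delta>\<close> times a partial derivative. Bounding the norm by the sum of the components
  costs the factor \<open>CARD('d)\<close>.\<close>

lemma markov_grad:
  "\<exists>C>0. \<forall>(f :: real^'d \<Rightarrow> real) x \<delta> B. line_poly N f \<longrightarrow> f differentiable (at x) \<longrightarrow> 0 < \<delta> \<longrightarrow>
     (\<forall>y\<in>cball x \<delta>. \<bar>f y\<bar> \<le> B) \<longrightarrow> norm (grad f x) \<le> C * B / \<delta>"
proof -
  obtain C where C: "C > 0" "\<And>P B. degree P \<le> N \<Longrightarrow> (\<And>t. t \<in> {0..1} \<Longrightarrow> \<bar>poly P t\<bar> \<le> B) \<Longrightarrow>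
    \<bar>poly (pderiv P) 0\<bar> \<le> C * (B::real)"
    using markov_at_0[of N] by metis
  have "norm (grad f x) \<le> real CARD('d) * C * B / \<delta>"
    if f: "line_poly N f" "f differentiable (at x)" "0 < \<delta>" and B: "\<And>y. y \<in> cball x \<delta> \<Longrightarrow> \<bar>f y\<bar> \<le> B"
    for f :: "real^'d \<Rightarrow> real" and x \<delta> B
  proof -
    have "\<bar>grad f x $ l\<bar> \<le> C * B / \<delta>" for l
    proof -
      obtain P where P: "degree P \<le> N" "\<And>t. f (x + t *\<^sub>R (\<delta> *\<^sub>R axis l 1)) = poly P t"
        using f(1) by (rule line_polyE) blast
      have "((\<lambda>t. x + t *\<^sub>R (\<delta> *\<^sub>R axis l 1)) has_derivative (\<lambda>t. t *\<^sub>R (\<delta> *\<^sub>R axis l 1))) (at (0::real))"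
        by (auto intro!: derivative_eq_intros)
      from has_derivative_compose[OF this, of f "\<lambda>v. grad f x \<bullet> v"]
      have "((\<lambda>t. f (x + t *\<^sub>R (\<delta> *\<^sub>R axis l 1))) has_derivative (\<lambda>t. grad f x \<bullet> (t *\<^sub>R (\<delta> *\<^sub>R axis l 1)))) (at 0)"
        using grad_has_derivative[OF f(2)] by simp
      then have "((\<lambda>t. poly P t) has_derivative (\<lambda>t. (\<delta> * grad f x $ l) * t)) (at 0)"
        unfolding P(2) by (simp add: inner_axis mult_ac)
      then have "(poly P has_field_derivative \<delta> * grad f x $ l) (at 0)"
        by (simp add: has_field_derivative_def)
      then have "poly (pderiv P) 0 = \<delta> * grad f x $ l"
        using poly_DERIV DERIV_unique by blast
      moreover have "\<bar>poly (pderiv P) 0\<bar> \<le> C * B"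
        by (rule C(2)[OF P(1)]) (use f(3) in \<open>auto simp: P(2)[symmetric] dist_norm intro!: B\<close>)
      ultimately show ?thesis using f(3) by (simp add: abs_mult field_simps)
    qed
    then have "(\<Sum>l\<in>UNIV. \<bar>grad f x $ l\<bar>) \<le> real CARD('d) * (C * B / \<delta>)"
      using sum_bounded_above[of UNIV "\<lambda>l. \<bar>grad f x $ l\<bar>" "C * B / \<delta>"] by simp
    then show ?thesis using norm_le_l1_cart[of "grad f x"] by simp
  qed
  then show ?thesis using C(1) by (intro exI[of _ "real CARD('d) * C"]) auto
qed

section \<open>Splines and meshes\<close>

text \<open>Induction along the Cox-de Boor recursion, whose coefficients are affine in
  \<open>x\<close>. The bound on \<open>i\<close> keeps every knot lookup inside the list.\<close>

lemma bspline_eq_poly: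
  assumes span: "knot_span \<Xi> a b" and "i + Suc p < length \<Xi>"
  shows "\<exists>P. degree P \<le> p \<and> (\<forall>x\<in>{a<..<b}. bspline \<Xi> p i x = poly P x)"
  using assms(2)
proof (induction p arbitrary: i)
  case 0
  \<comment> \<open>No knot lies inside the span, so the indicator of degree 0 is constant there;
    the special value at the last knot concerns only a point outside the open span.\<close>
  have side: "t \<le> a \<or> b \<le> t" if "t \<in> set \<Xi>" for t
    using span that by (force simp: knot_span_def)
  have "\<Xi> \<noteq> []" using 0 by auto
  then have "last \<Xi> \<in> set \<Xi>" "\<Xi> ! i \<in> set \<Xi>" "\<Xi> ! (i + 1) \<in> set \<Xi>" using 0 by auto
  from side[OF this(1)] side[OF this(2)] side[OF this(3)]
  have "\<forall>x\<in>{a<..<b}. bspline \<Xi> 0 i x = poly [:if \<Xi> ! i \<le> a \<and> b \<le> \<Xi> ! (i + 1) then 1 else 0:] x"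
    by auto
  then show ?case by (intro exI[of _ "[:if \<Xi> ! i \<le> a \<and> b \<le> \<Xi> ! (i + 1) then 1 else 0:]"]) auto
next
  case (Suc q)
  obtain P where P: "degree P \<le> q" "\<And>x. x \<in> {a<..<b} \<Longrightarrow> bspline \<Xi> q i x = poly P x"
    using Suc.IH[of i] Suc.prems by auto
  obtain R where R: "degree R \<le> q" "\<And>x. x \<in> {a<..<b} \<Longrightarrow> bspline \<Xi> q (i + 1) x = poly R x"
    using Suc.IH[of "i + 1"] Suc.prems by auto
  \<comment> \<open>Coinciding knots make \<open>k\<close> or \<open>m\<close> equal to 0, in
    agreement with the convention 0/0 = 0.\<close>
  define k where "k = 1 / (\<Xi> ! (i + Suc q) - \<Xi> ! i)"
  define m where "m = 1 / (\<Xi> ! (i + Suc q + 1) - \<Xi> ! (i + 1))"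
  let ?S = "[:- k * \<Xi> ! i, k:] * P + [:m * \<Xi> ! (i + Suc q + 1), - m:] * R"
  have "degree ?S \<le> Suc q"
  proof (rule degree_add_le)
    show "degree ([:- k * \<Xi> ! i, k:] * P) \<le> Suc q"
      using degree_mult_le[of "[:- k * \<Xi> ! i, k:]" P] degree_pCons_le[of "- k * \<Xi> ! i" "[:k:]"] P(1) by simp
    show "degree ([:m * \<Xi> ! (i + Suc q + 1), - m:] * R) \<le> Suc q"
      using degree_mult_le[of "[:m * \<Xi> ! (i + Suc q + 1), - m:]" R]
        degree_pCons_le[of "m * \<Xi> ! (i + Suc q + 1)" "[:- m:]"] R(1) by simp
  qed
  moreover have "bspline \<Xi> (Suc q) i x = poly ?S x" if "x \<in> {a<..<b}" for x
  proof -
    have "bspline \<Xi> (Suc q) i x =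
        (x - \<Xi> ! i) * k * poly P x + (\<Xi> ! (i + Suc q + 1) - x) * m * poly R x"
      using P(2)[OF that] R(2)[OF that] by (simp add: k_def m_def)
    then show ?thesis by (simp add: algebra_simps)
  qed
  ultimately show ?case by blast
qed

lemma
  fixes a b :: "real^'d"
  assumes "\<And>l. knot_span (\<Xi> l) (a $ l) (b $ l)"
  shows knot_span_edge_le: "b $ l - a $ l \<le> diameter (box a b)"
    and knot_span_diameter_pos: "0 < diameter (box a b)"
proof -
  have less: "a $ l < b $ l" for l using assms by (simp add: knot_span_def)
  then have ne: "box a b \<noteq> {}" by (simp add: box_ne_empty Basis_vec_def inner_axis less_imp_le)
  have "dist a b \<le> diameter (cbox a b)"
    using less by (intro diameter_bounded_bound) (auto simp: mem_box_cart less_imp_le)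
  also have "\<dots> = diameter (box a b)"
    using ne diameter_closure[of "box a b"] by (simp add: bounded_box closure_box)
  finally have d: "dist a b \<le> diameter (box a b)" .
  have le: "b $ l - a $ l \<le> diameter (box a b)" for l
    using component_le_norm_cart[of "a - b" l] less[of l] d by (simp add: dist_norm)
  then show "b $ l - a $ l \<le> diameter (box a b)" .
  show "0 < diameter (box a b)" using less[of undefined] le[of undefined] by linarith
qed

lemma shape_regular_edge_ge:
  fixes \<Xi> :: "'h \<Rightarrow> 'd::finite \<Rightarrow> real list"
  assumes "shape_regular \<Xi>"
  obtains \<sigma> where "0 < \<sigma>" "\<And>h (a :: real^'d) b l. (\<And>l. knot_span (\<Xi> h l) (a $ l) (b $ l)) \<Longrightarrow>
    \<sigma> * diameter (box a b) \<le> b $ l - a $ l"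
proof -
  obtain \<sigma> where \<sigma>: "0 < \<sigma>" "\<And>h (a :: real^'d) b. (\<And>l. knot_span (\<Xi> h l) (a $ l) (b $ l)) \<Longrightarrow>
    \<sigma> \<le> Min (range (\<lambda>l. b $ l - a $ l)) / diameter (box a b)"
    using assms unfolding shape_regular_def by blast
  have "\<sigma> * diameter (box a b) \<le> b $ l - a $ l" if s: "\<And>l. knot_span (\<Xi> h l) (a $ l) (b $ l)"
    for h and a b :: "real^'d" and l
  proof -
    have "\<sigma> * diameter (box a b) \<le> Min (range (\<lambda>l. b $ l - a $ l))"
      using \<sigma>(2)[OF s] knot_span_diameter_pos[OF s] by (simp add: pos_le_divide_eq)
    also have "\<dots> \<le> b $ l - a $ l" by (rule Min_le) auto
    finally show ?thesis .
  qed
  with \<sigma>(1) show ?thesis by (rule that)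
qed

text \<open>
  For tensor-product meshes in dimension at least two shape regularity implies quasi-uniformity:
  compare both elements with the element that takes one knot span from the first and all others
  from the second.
\<close>

lemma shape_regular_quasi_uniform:
  fixes a b a' b' :: "real^'d"
  assumes card: "CARD('d) \<ge> 2" and \<sigma>0: "0 < \<sigma>"
    and \<sigma>: "\<And>(a :: real^'d) b l. (\<And>l. knot_span (\<Xi> l) (a $ l) (b $ l)) \<Longrightarrow>
    \<sigma> * diameter (box a b) \<le> b $ l - a $ l"
    and s: "\<And>l. knot_span (\<Xi> l) (a $ l) (b $ l)" and s': "\<And>l. knot_span (\<Xi> l) (a' $ l) (b' $ l)"
  shows "\<sigma>\<^sup>2 * diameter (box a' b') \<le> diameter (box a b)"
proof -
  obtain k m :: 'd where km: "k \<noteq> m"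
    using card card_le_Suc0_iff_eq[of "UNIV :: 'd set"] by auto
  define u where "u = (\<chi> l. if l = k then a $ l else a' $ l)"
  define w where "w = (\<chi> l. if l = k then b $ l else b' $ l)"
  have uw: "knot_span (\<Xi> l) (u $ l) (w $ l)" for l using s s' by (simp add: u_def w_def)
  have "\<sigma> * diameter (box a' b') \<le> b' $ m - a' $ m" by (rule \<sigma>[OF s'])
  also have "\<dots> = w $ m - u $ m" using km by (simp add: u_def w_def)
  also have "\<dots> \<le> diameter (box u w)" by (rule knot_span_edge_le[OF uw])
  finally have "\<sigma> * (\<sigma> * diameter (box a' b')) \<le> \<sigma> * diameter (box u w)"
    using \<sigma>0 by (intro mult_left_mono) auto
  also have "\<dots> \<le> w $ k - u $ k" by (rule \<sigma>[OF uw])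
  also have "\<dots> = b $ k - a $ k" by (simp add: u_def w_def)
  also have "\<dots> \<le> diameter (box a b)" by (rule knot_span_edge_le[OF s])
  finally show ?thesis by (simp add: power2_eq_square mult.assoc)
qed

lemma knot_span_measure_ge:
  fixes a b :: "real^'d"
  assumes s: "\<And>l. knot_span (\<Xi> l) (a $ l) (b $ l)"
    and \<sigma>: "0 < \<sigma>" "\<And>l. \<sigma> * diameter (box a b) \<le> b $ l - a $ l"
  shows "\<sigma> ^ CARD('d) * diameter (box a b) ^ CARD('d) \<le> measure lborel (box a b)"
proof -
  have less: "a $ l < b $ l" for l using s by (simp add: knot_span_def)
  have "(\<sigma> * diameter (box a b)) ^ CARD('d) = (\<Prod>i\<in>(Basis :: (real^'d) set). \<sigma> * diameter (box a b))"
    by simp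
  also have "\<dots> \<le> (\<Prod>i\<in>Basis. (b - a) \<bullet> i)"
    using \<sigma> knot_span_diameter_pos[OF s]
    by (intro prod_mono) (auto simp: Basis_vec_def inner_axis)
  also have "\<dots> = measure lborel (box a b)"
    using less by (subst measure_lborel_box) (auto simp: Basis_vec_def inner_axis less_imp_le)
  finally show ?thesis by (simp add: power_mult_distrib)
qed

text \<open>The image of a cube of edge \<open>s\<close> lies in a ball of radius
  \<open>L * sqrt n * s\<close>, where \<open>sqrt n * s\<close> is the diagonal; this is the volume
  of that ball divided by \<open>s ^ n\<close>. It is not the sharp factor \<open>L ^ n\<close>, but
  any uniform factor will do.\<close>

definition lip_vol :: "nat \<Rightarrow> real \<Rightarrow> real" where
  "lip_vol n L = unit_ball_vol (real n) * (L * sqrt (real n)) ^ n"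

text \<open>\<open>S\<close> is covered by countably many dyadic cubes inside \<open>S\<close> with
  disjoint interiors, and the image of each cube is enclosed in a ball around the image of a corner.
  Interiors measure the cubes fully and can be summed without overlap.\<close>

lemma emeasure_lipschitz_image_le:
  fixes f :: "'a::euclidean_space \<Rightarrow> 'a"
  assumes S: "open S" "bounded S" and f: "L-lipschitz_on S f"
  shows "emeasure lborel (f ` S) \<le> ennreal (lip_vol DIM('a) L) * emeasure lborel S"
proof -
  define c where "c = unit_ball_vol (real DIM('a)) * (L * sqrt (real DIM('a))) ^ DIM('a)"
  have L0: "0 \<le> L" by (rule lipschitz_on_nonneg[OF f])
  have c0: "0 \<le> c" using L0 by (simp add: c_def)
  obtain r where r: "r > 0" "S \<subseteq> cbox (- r *\<^sub>R One) (r *\<^sub>R One)"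
  proof -
    obtain k where k: "k > 0" "\<And>x. x \<in> S \<Longrightarrow> norm x \<le> k" using S(2) by (auto simp: bounded_pos)
    have "S \<subseteq> cbox (- k *\<^sub>R One) (k *\<^sub>R One)"
    proof
      fix x assume x: "x \<in> S"
      have "\<bar>x \<bullet> i\<bar> \<le> k" if "i \<in> Basis" for i using k(2)[OF x] Basis_le_norm[OF that, of x] by simp
      then show "x \<in> cbox (- k *\<^sub>R One) (k *\<^sub>R One)" by (auto simp: mem_box abs_le_iff minus_le_iff)
    qed
    then show thesis using k(1) that by blast
  qed
  have "\<exists>e>0. ball x e \<subseteq> S" if "x \<in> S" for x using S(1) that open_contains_ball by blast
  then obtain e where e: "\<And>x. x \<in> S \<Longrightarrow> 0 < e x \<and> ball x (e x) \<subseteq> S" by metis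
  \<comment> \<open>The covering lemma places each cube in \<open>g x\<close> for some
    \<open>x\<close> in \<open>S\<close>; this gauge thereby forces the cube into
    \<open>S\<close>.\<close>
  define g where "g x = (if x \<in> S then ball x (e x) else ball x 1)" for x
  have gau: "gauge g" using e by (auto simp: gauge_def g_def)
  have ne: "box (- r *\<^sub>R One) (r *\<^sub>R One :: 'a) \<noteq> {}" using r(1) by (auto simp: box_ne_empty)
  obtain \<D> where \<D>: "countable \<D>" "\<Union>\<D> \<subseteq> cbox (- r *\<^sub>R One) (r *\<^sub>R One)"
      "\<And>K. K \<in> \<D> \<Longrightarrow> interior K \<noteq> {} \<and> (\<exists>c d. K = cbox c d)"
      "pairwise (\<lambda>A B. interior A \<inter> interior B = {}) \<D>"
      "\<And>K. K \<in> \<D> \<Longrightarrow> \<exists>x \<in> S \<inter> K. K \<subseteq> g x"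
      "\<And>u v. cbox u v \<in> \<D> \<Longrightarrow> \<exists>n. \<forall>i\<in>Basis. v \<bullet> i - u \<bullet> i = (r *\<^sub>R One \<bullet> i - (- r *\<^sub>R One) \<bullet> i) / 2 ^ n"
      "S \<subseteq> \<Union>\<D>"
  proof (rule covering_lemma[OF r(2) ne gau], goal_cases)
    case (1 \<D>)
    from 1(1)[OF 1(2-8)] show ?case .
  qed
  have sub: "K \<subseteq> S" if "K \<in> \<D>" for K using \<D>(5)[OF that] e by (auto simp: g_def)
  have cube: "f ` K \<in> sets borel \<and> emeasure lborel (f ` K) \<le> ennreal c * emeasure lborel (interior K)"
    if K: "K \<in> \<D>" for K
  proof -
    obtain u v where uv: "K = cbox u v" using \<D>(3)[OF K] by blast
    obtain n where n: "\<And>i. i \<in> Basis \<Longrightarrow> v \<bullet> i - u \<bullet> i = (r *\<^sub>R One \<bullet> i - (- r *\<^sub>R One) \<bullet> i) / 2 ^ n"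
      using \<D>(6) K uv by blast
    \<comment> \<open>The common edge length: the covering cubes arise from the bounding cube of
      edge \<open>2 * r\<close> by \<open>n\<close> bisections.\<close>
    define s where "s = 2 * r / 2 ^ n"
    have s: "s > 0" "\<And>i. i \<in> Basis \<Longrightarrow> v \<bullet> i - u \<bullet> i = s"
      using n r(1) by (auto simp: s_def inner_diff_left algebra_simps)
    have le: "\<And>i. i \<in> Basis \<Longrightarrow> u \<bullet> i \<le> v \<bullet> i" using s by (metis diff_ge_0_iff_ge less_imp_le)
    then have u: "u \<in> K" by (auto simp: uv mem_box)
    have "f ` K \<subseteq> cball (f u) (L * (sqrt (real DIM('a)) * s))"
    proof clarify
      fix x assume x: "x \<in> K"
      have "\<bar>(u - x) \<bullet> i\<bar> \<le> s" if "i \<in> Basis" for i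
        using x s(2)[OF that] that by (auto simp: uv mem_box inner_diff_left)
      then have "infnorm (u - x) \<le> s" by (simp add: infnorm_Max)
      then have "norm (u - x) \<le> sqrt (real DIM('a)) * s"
        using norm_le_infnorm[of "u - x"] order_trans mult_left_mono[of "infnorm (u - x)" s "sqrt (real DIM('a))"]
        by fastforce
      then have "L * dist u x \<le> L * (sqrt (real DIM('a)) * s)"
        using L0 by (intro mult_left_mono) (auto simp: dist_norm)
      then show "f x \<in> cball (f u) (L * (sqrt (real DIM('a)) * s))"
        using lipschitz_onD[OF f, of u x] u x sub[OF K] by fastforce
    qed
    moreover have "compact (f ` K)"
      using lipschitz_on_continuous_on[OF lipschitz_on_subset[OF f sub[OF K]]] uv by (auto intro: compact_continuous_image)
    ultimately have "emeasure lborel (f ` K) \<le> emeasure lborel (cball (f u) (L * (sqrt (real DIM('a)) * s)))"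
      by (intro emeasure_mono) auto
    also have "\<dots> = ennreal (unit_ball_vol (real DIM('a)) * (L * (sqrt (real DIM('a)) * s)) ^ DIM('a))"
      using L0 s(1) by (intro emeasure_cball) auto
    also have "\<dots> = ennreal c * ennreal (s ^ DIM('a))"
      using c0 s(1) by (simp add: ennreal_mult[symmetric] c_def power_mult_distrib mult_ac)
    also have "s ^ DIM('a) = (\<Prod>i\<in>Basis. (v - u) \<bullet> i)"
      using s(2) by (simp add: inner_diff_left)
    also have "ennreal \<dots> = emeasure lborel (interior K)"
      using le by (simp add: uv interior_cbox)
    finally have "emeasure lborel (f ` K) \<le> ennreal c * emeasure lborel (interior K)" .
    with \<open>compact (f ` K)\<close> show ?thesis by (auto intro: borel_compact)
  qed
  \<comment> \<open>Numbering of the possibly finite family by all naturals: \<open>A n\<close> is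
    the cube with number \<open>n\<close>, or empty.\<close>
  define A where "A n = \<Union>{K \<in> \<D>. to_nat_on \<D> K = n}" for n
  have A: "A n = {} \<or> (A n \<in> \<D> \<and> to_nat_on \<D> (A n) = n)" for n
  proof (cases "\<exists>K\<in>\<D>. to_nat_on \<D> K = n")
    case True
    then obtain K where K: "K \<in> \<D>" "to_nat_on \<D> K = n" by blast
    have "{K \<in> \<D>. to_nat_on \<D> K = n} = {K}"
      using K inj_on_to_nat_on[OF \<D>(1)] by (auto dest: inj_onD)
    then show ?thesis using K by (simp add: A_def)
  qed (auto simp: A_def)
  have UA: "S \<subseteq> (\<Union>n. A n)" using \<D>(7) by (force simp: A_def)
  have disj: "disjoint_family (\<lambda>n. interior (A n))"
    unfolding disjoint_family_on_def
  proof (intro ballI impI)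
    fix m n :: nat assume "m \<noteq> n"
    then have "A m = {} \<or> A n = {} \<or> (A m \<in> \<D> \<and> A n \<in> \<D> \<and> A m \<noteq> A n)" using A[of m] A[of n] by auto
    then show "interior (A m) \<inter> interior (A n) = {}"
      using \<D>(4) by (auto simp: pairwise_def)
  qed
  have AS: "A n \<subseteq> S" for n using A[of n] sub by auto
  have fA: "f ` A n \<in> sets borel" "emeasure lborel (f ` A n) \<le> ennreal c * emeasure lborel (interior (A n))" for n
    using A[of n] cube[of "A n"] by auto
  have "f ` S \<subseteq> (\<Union>n. f ` A n)" using UA by blast
  then have "emeasure lborel (f ` S) \<le> emeasure lborel (\<Union>n. f ` A n)"
    using fA(1) by (intro emeasure_mono) auto
  also have "\<dots> \<le> (\<Sum>n. emeasure lborel (f ` A n))"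
    using fA(1) by (intro emeasure_subadditive_countably) auto
  also have "\<dots> \<le> (\<Sum>n. ennreal c * emeasure lborel (interior (A n)))"
    by (intro suminf_le fA) auto
  also have "\<dots> = ennreal c * (\<Sum>n. emeasure lborel (interior (A n)))"
    by (rule ennreal_suminf_cmult)
  also have "(\<Sum>n. emeasure lborel (interior (A n))) = emeasure lborel (\<Union>n. interior (A n))"
    using disj by (intro suminf_emeasure) auto
  also have "\<dots> \<le> emeasure lborel S"
    using AS S(1) interior_subset by (intro emeasure_mono) fastforce+
  finally show ?thesis by (simp add: c_def lip_vol_def mult_left_mono)
qed

section \<open>Orthogonal projection onto polynomials\<close>

definition L2_ip :: "'a::euclidean_space set \<Rightarrow> ('a \<Rightarrow> real) \<Rightarrow> ('a \<Rightarrow> real) \<Rightarrow> real" where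
  "L2_ip K f g = set_lebesgue_integral lborel K (\<lambda>x. f x * g x)"

text \<open>A class closed under sums and products whose members are integrable over bounded open
  sets. On it \<open>L2_ip\<close> is bilinear, and definite in the pointwise sense. Continuity is
  asked on \<open>K\<close> only, which suits functions that involve the inverse of
  \<open>F\<close>.\<close>

definition bounded_cont :: "'a::euclidean_space set \<Rightarrow> ('a \<Rightarrow> real) \<Rightarrow> bool" where
  "bounded_cont K f \<longleftrightarrow> continuous_on K f \<and> (\<exists>B. \<forall>x\<in>K. \<bar>f x\<bar> \<le> B)"

lemma bounded_cont_add: "bounded_cont K f \<Longrightarrow> bounded_cont K g \<Longrightarrow> bounded_cont K (\<lambda>x. f x + g x)"
  unfolding bounded_cont_def
  by (auto intro!: continuous_intros) (meson abs_triangle_ineq add_mono order_trans)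

lemma bounded_cont_mult: "bounded_cont K f \<Longrightarrow> bounded_cont K g \<Longrightarrow> bounded_cont K (\<lambda>x. f x * g x)"
  unfolding bounded_cont_def
  by (auto intro!: continuous_intros simp: abs_mult) (meson abs_ge_zero mult_mono order_trans)

lemma bounded_cont_const: "bounded_cont K (\<lambda>_. c)"
  by (auto simp: bounded_cont_def)

lemma bounded_cont_diff:
  assumes "bounded_cont K f" "bounded_cont K g" shows "bounded_cont K (\<lambda>x. f x - g x)"
  using bounded_cont_add[OF assms(1) bounded_cont_mult[OF bounded_cont_const[of K "-1"] assms(2)]] by simp

lemma bounded_cont_sum:
  assumes "\<And>i. i \<in> I \<Longrightarrow> bounded_cont K (f i)"
  shows "bounded_cont K (\<lambda>x. \<Sum>i\<in>I. f i x)"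
  using assms
  by (induction I rule: infinite_finite_induct) (auto intro: bounded_cont_const bounded_cont_add)

lemma bounded_cont_poly_Q:
  assumes "q \<in> poly_Q p" "bounded K" shows "bounded_cont K q"
proof -
  have "compact (closure K)" using assms(2) by (simp add: compact_closure)
  then have "bounded (q ` closure K)"
    by (intro compact_imp_bounded compact_continuous_image poly_Q_continuous[OF assms(1)])
  then obtain B where "\<And>y. y \<in> q ` closure K \<Longrightarrow> norm y \<le> B" by (auto simp: bounded_iff)
  then have "\<forall>x\<in>K. \<bar>q x\<bar> \<le> B" using closure_subset by fastforce
  then show ?thesis using poly_Q_continuous[OF assms(1)] by (auto simp: bounded_cont_def)
qed

lemma bounded_cont_integrable:
  assumes K: "open K" "bounded K" and f: "bounded_cont K f"
  shows "set_integrable lborel K f"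
proof -
  obtain B where B: "continuous_on K f" "\<And>x. x \<in> K \<Longrightarrow> \<bar>f x\<bar> \<le> B"
    using f by (auto simp: bounded_cont_def)
  have "emeasure lborel K < \<infinity>" using K(2) by (rule emeasure_bounded_finite)
  moreover have "(\<lambda>x. indicator K x *\<^sub>R f x) \<in> borel_measurable lborel"
    using borel_measurable_continuous_on_indicator[OF borel_open[OF K(1)] B(1)] by simp
  ultimately show ?thesis
    unfolding set_integrable_def
    using K(1) B(2) by (intro integrableI_bounded_set[where A = K and B = B]) (auto simp: indicator_def)
qed

section \<open>The inner product on a bounded open set\<close>

lemma L2_ip_commute: "L2_ip K f g = L2_ip K g f"
  by (simp add: L2_ip_def mult.commute)

lemma L2_ip_cmult_left: "L2_ip K (\<lambda>x. c * f x) r = c * L2_ip K f r"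
  by (simp add: L2_ip_def mult.assoc)

lemma L2_ip_nonneg: "0 \<le> L2_ip K f f"
  unfolding L2_ip_def set_lebesgue_integral_def by (intro integral_nonneg_AE) simp

context
  fixes K :: "'a::euclidean_space set"
  assumes K: "open K" "bounded K"
begin

lemma L2_ip_add_left:
  assumes "bounded_cont K f" "bounded_cont K g" "bounded_cont K r"
  shows "L2_ip K (\<lambda>x. f x + g x) r = L2_ip K f r + L2_ip K g r"
  unfolding L2_ip_def distrib_right
  by (intro set_integral_add bounded_cont_integrable K bounded_cont_mult assms)

lemma L2_ip_diff_left:
  assumes "bounded_cont K f" "bounded_cont K g" "bounded_cont K r"
  shows "L2_ip K (\<lambda>x. f x - g x) r = L2_ip K f r - L2_ip K g r"
  using L2_ip_add_left[OF assms(1) bounded_cont_mult[OF bounded_cont_const[of K "-1"] assms(2)] assms(3)]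
    L2_ip_cmult_left[of K "-1" g r] by simp

lemma L2_ip_sum_left:
  assumes "\<And>i. i \<in> I \<Longrightarrow> bounded_cont K (f i)" "bounded_cont K r"
  shows "L2_ip K (\<lambda>x. \<Sum>i\<in>I. f i x) r = (\<Sum>i\<in>I. L2_ip K (f i) r)"
  using assms
proof (induction I rule: infinite_finite_induct)
  case (insert i I)
  then show ?case by (simp add: L2_ip_add_left bounded_cont_sum)
qed (simp_all add: L2_ip_def)

text \<open>The set where \<open>f\<close> is nonzero is a null set and open, by continuity, hence
  empty.\<close>

lemma L2_ip_self_eq_0:
  assumes f: "bounded_cont K f" and 0: "L2_ip K f f = 0" and x: "x \<in> K"
  shows "f x = 0"
proof -
  have int: "integrable lborel (\<lambda>x. indicator K x *\<^sub>R (f x * f x))"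
    using bounded_cont_integrable[OF K bounded_cont_mult[OF f f]] by (simp add: set_integrable_def)
  have "AE x in lborel. indicator K x *\<^sub>R (f x * f x) = 0"
    using 0 unfolding L2_ip_def set_lebesgue_integral_def
    by (subst (asm) integral_nonneg_eq_0_iff_AE[OF int]) auto
  then have AE: "AE x in lborel. x \<notin> {x \<in> K. f x \<noteq> 0}"
    by eventually_elim (auto simp: indicator_def)
  have op: "open {x \<in> K. f x \<noteq> 0}"
  proof -
    have "open (K \<inter> f -` (- {0}))"
      using f K(1) by (intro continuous_open_preimage) (auto simp: bounded_cont_def)
    moreover have "K \<inter> f -` (- {0}) = {x \<in> K. f x \<noteq> 0}" by auto
    ultimately show ?thesis by simp
  qed
  then have "{x \<in> K. f x \<noteq> 0} \<in> null_sets lborel" using AE by (simp add: AE_iff_null_sets)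
  then have "{x \<in> K. f x \<noteq> 0} = {}"
    using op open_not_negligible negligible_iff_null_sets null_sets_completionI by blast
  with x show ?thesis by blast
qed

lemma L2_ip_eq_0:
  assumes "bounded_cont K f" "L2_ip K f f = 0"
  shows "L2_ip K g f = 0"
  unfolding L2_ip_def set_lebesgue_integral_def
  using L2_ip_self_eq_0[OF assms] by (intro integral_eq_zero_AE) (auto simp: indicator_def)

text \<open>A Gram-Schmidt step. The induction hypothesis is used for \<open>w\<close> and also for
  the new function \<open>b\<close>; the residual \<open>u\<close> of \<open>w\<close> is then freed
  of its component along the residual \<open>b'\<close> of \<open>b\<close>. Linear independence of
  \<open>B\<close> is not assumed.\<close>

lemma ex_orthogonal_combination:
  assumes "finite B" "\<And>b. b \<in> B \<Longrightarrow> bounded_cont K b" "bounded_cont K w"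
  shows "\<exists>c. \<forall>r\<in>B. L2_ip K (\<lambda>x. w x - (\<Sum>b\<in>B. c b * b x)) r = 0"
  using assms
proof (induction B arbitrary: w)
  case (insert b B)
  have bc: "bounded_cont K (\<lambda>x. \<Sum>b\<in>B. c b * b x)" for c
    using insert.prems by (intro bounded_cont_sum bounded_cont_mult bounded_cont_const) auto
  have b: "bounded_cont K b" and w: "bounded_cont K w" using insert.prems by auto
  obtain c0 where c0: "\<And>r. r \<in> B \<Longrightarrow> L2_ip K (\<lambda>x. w x - (\<Sum>b\<in>B. c0 b * b x)) r = 0"
    using insert.IH[of w] insert.prems by auto
  obtain c1 where c1: "\<And>r. r \<in> B \<Longrightarrow> L2_ip K (\<lambda>x. b x - (\<Sum>b\<in>B. c1 b * b x)) r = 0"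
    using insert.IH[of b] insert.prems by auto
  define u where "u x = w x - (\<Sum>b\<in>B. c0 b * b x)" for x
  define b' where "b' x = b x - (\<Sum>b\<in>B. c1 b * b x)" for x
  have u: "bounded_cont K u" "\<And>r. r \<in> B \<Longrightarrow> L2_ip K u r = 0"
    using bc w c0 unfolding u_def[abs_def] by (auto intro!: bounded_cont_diff)
  have b': "bounded_cont K b'" "\<And>r. r \<in> B \<Longrightarrow> L2_ip K b' r = 0"
    using bc b c1 unfolding b'_def[abs_def] by (auto intro!: bounded_cont_diff)
  \<comment> \<open>If \<open>b'\<close> has norm 0, then \<open>b\<close> depends on
    \<open>B\<close> over \<open>K\<close>, and every function is already orthogonal to
    \<open>b'\<close> by \<open>L2_ip_eq_0\<close>.\<close>
  define \<alpha> where "\<alpha> = (if L2_ip K b' b' = 0 then 0 else L2_ip K u b' / L2_ip K b' b')"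
  define v where "v x = u x - \<alpha> * b' x" for x
  have v: "bounded_cont K v" unfolding v_def[abs_def] by (intro bounded_cont_diff bounded_cont_mult bounded_cont_const u b')
  have v_eq: "L2_ip K v r = L2_ip K u r - \<alpha> * L2_ip K b' r" if "bounded_cont K r" for r
    unfolding v_def[abs_def]
    using that by (subst L2_ip_diff_left) (auto intro!: bounded_cont_mult bounded_cont_const u b' simp: L2_ip_cmult_left)
  have vB: "L2_ip K v r = 0" if "r \<in> B" for r
    using that insert.prems(1)[of r] u(2) b'(2) by (simp add: v_eq)
  have "L2_ip K v b' = 0"
    using L2_ip_eq_0[OF b'(1), of u] by (simp add: v_eq b' \<alpha>_def)
  moreover have "L2_ip K v (\<lambda>x. \<Sum>b\<in>B. c1 b * b x) = 0"
    using vB insert.prems(1) v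
    by (subst L2_ip_commute, subst L2_ip_sum_left)
      (auto intro!: bounded_cont_mult bounded_cont_const sum.neutral simp: L2_ip_cmult_left L2_ip_commute[of K _ v])
  ultimately have "L2_ip K (\<lambda>x. b' x + (\<Sum>b\<in>B. c1 b * b x)) v = 0"
    using L2_ip_add_left[OF b'(1) bc[of c1] v] by (simp only: L2_ip_commute[of K _ v])
  moreover have "(\<lambda>x. b' x + (\<Sum>b\<in>B. c1 b * b x)) = b" by (auto simp: b'_def)
  ultimately have vb: "L2_ip K v b = 0" by (simp only: L2_ip_commute[of K _ v])
  define c where "c = (\<lambda>r. if r = b then \<alpha> else c0 r - \<alpha> * c1 r)"
  have "w x - (\<Sum>b\<in>insert b B. c b * b x) = v x" for x
  proof -
    have "(\<Sum>r\<in>B. c r * r x) = (\<Sum>r\<in>B. c0 r * r x - \<alpha> * (c1 r * r x))"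
      using insert.hyps by (intro sum.cong) (auto simp: c_def algebra_simps)
    then show ?thesis
      using insert.hyps
      by (simp add: v_def u_def b'_def c_def sum_subtractf sum_distrib_left algebra_simps)
  qed
  then show ?case using vB vb by (intro exI[of _ c]) auto
qed auto

end

text \<open>Existence comes from \<open>ex_orthogonal_combination\<close> for the monomials. The
  difference of two candidates is a polynomial orthogonal to itself, so it vanishes on
  \<open>K\<close> and, \<open>K\<close> being open and nonempty, everywhere. Hence the description
  in \<open>L2_proj\<close> is met by exactly one function.\<close>

lemma L2_proj:
  fixes K :: "(real^'d) set"
  assumes K: "open K" "bounded K" "K \<noteq> {}" and w: "bounded_cont K w"
  shows L2_proj_poly_Q: "L2_proj p K w \<in> poly_Q p"
    and L2_proj_orthogonal: "r \<in> poly_Q p \<Longrightarrow> L2_ip K (\<lambda>x. w x - L2_proj p K w x) r = 0"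
proof -
  let ?mono = "\<lambda>a (x :: real^'d). \<Prod>l\<in>UNIV. (x $ l) ^ a l"
  let ?A = "{a :: 'd \<Rightarrow> nat. \<forall>l. a l \<le> p}"
  let ?P = "\<lambda>q. q \<in> poly_Q p \<and> (\<forall>r\<in>poly_Q p. L2_ip K (\<lambda>x. w x - q x) r = 0)"
  have bc: "bounded_cont K q" if "q \<in> poly_Q p" for q
    using bounded_cont_poly_Q[OF that K(2)] .
  have mono: "?mono a \<in> poly_Q p" if "a \<in> ?A" for a using that by (intro poly_Q_monomial) auto
  obtain c where c: "\<And>r. r \<in> ?mono ` ?A \<Longrightarrow> L2_ip K (\<lambda>x. w x - (\<Sum>b\<in>?mono ` ?A. c b * b x)) r = 0"
    using ex_orthogonal_combination[OF K(1,2), of "?mono ` ?A" w] w bc mono finite_poly_indices by blast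
  define q where "q x = (\<Sum>b\<in>?mono ` ?A. c b * b x)" for x
  have q: "q \<in> poly_Q p"
    unfolding q_def[abs_def] using mono by (intro poly_Q_sum poly_Q_cmult) auto
  have "L2_ip K (\<lambda>x. w x - q x) r = 0" if r: "r \<in> poly_Q p" for r
  proof -
    obtain k where k: "r = (\<lambda>x. \<Sum>a\<in>?A. k a * ?mono a x)" using r by (auto simp: poly_Q_def)
    have "L2_ip K r (\<lambda>x. w x - q x) = (\<Sum>a\<in>?A. L2_ip K (\<lambda>x. k a * ?mono a x) (\<lambda>x. w x - q x))"
      unfolding k using K w bc[OF q] bc[OF mono]
      by (intro L2_ip_sum_left bounded_cont_mult bounded_cont_const bounded_cont_diff) auto
    also have "\<dots> = (\<Sum>a\<in>?A. k a * L2_ip K (\<lambda>x. w x - q x) (?mono a))"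
      by (simp add: L2_ip_cmult_left L2_ip_commute[of K _ "\<lambda>x. w x - q x"])
    also have "\<dots> = 0" using c by (auto simp: q_def intro!: sum.neutral)
    finally show ?thesis by (metis L2_ip_commute)
  qed
  with q have Pq: "?P q" by blast
  have unique: "q' = q" if "?P q'" for q'
  proof -
    have d: "(\<lambda>x. q' x - q x) \<in> poly_Q p" using that q by (intro poly_Q_diff) auto
    have q': "q' \<in> poly_Q p" using that by blast
    let ?d = "\<lambda>x. q' x - q x"
    have "L2_ip K (\<lambda>x. (w x - q x) - (w x - q' x)) ?d = L2_ip K (\<lambda>x. w x - q x) ?d - L2_ip K (\<lambda>x. w x - q' x) ?d"
      using K w bc q q' d by (intro L2_ip_diff_left bounded_cont_diff) auto
    also have "\<dots> = 0" using d Pq that by auto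
    finally have "L2_ip K ?d ?d = 0" by simp
    then have "?d x = 0" if "x \<in> K" for x
      using L2_ip_self_eq_0[OF K(1,2) bc[OF d]] that by blast
    then show ?thesis using poly_Q_eqI[OF q' q K(1,3)] by auto
  qed
  have "?P (L2_proj p K w)"
    unfolding L2_proj_def L2_ip_def[symmetric] using Pq unique by (rule theI)
  then show "L2_proj p K w \<in> poly_Q p" "r \<in> poly_Q p \<Longrightarrow> L2_ip K (\<lambda>x. w x - L2_proj p K w x) r = 0"
    by blast+
qed

text \<open>With \<open>r\<close> the projection minus \<open>k\<close> and \<open>e\<close> the
  projection error, \<open>w - k = e + r\<close>, and \<open>e\<close> is orthogonal to the
  polynomial \<open>r\<close>. By Pythagoras the squared norm of \<open>r\<close> is at most
  \<open>B\<^sup>2\<close> times the volume of \<open>K\<close>, and Chebyshev's inequality confines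
  the set where \<open>\<bar>r\<bar> > 2 * B\<close> to a quarter of \<open>K\<close>.\<close>

lemma L2_proj_small_set:
  fixes K :: "(real^'d) set"
  assumes K: "open K" "bounded K" "K \<noteq> {}" and w: "bounded_cont K w"
    and B: "0 \<le> B" "\<And>x. x \<in> K \<Longrightarrow> \<bar>w x - k\<bar> \<le> B"
  shows "\<exists>A\<in>sets borel. A \<subseteq> K \<and> measure lborel K / 2 \<le> measure lborel A \<and>
    (\<forall>x\<in>A. \<bar>L2_proj p K w x - k\<bar> \<le> 2 * B)"
proof -
  define r where "r x = L2_proj p K w x - k" for x
  have r: "r \<in> poly_Q p"
    unfolding r_def[abs_def] by (intro poly_Q_diff poly_Q_const L2_proj_poly_Q K w)
  have bcr: "bounded_cont K r" by (rule bounded_cont_poly_Q[OF r K(2)])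
  define e where "e x = w x - L2_proj p K w x" for x
  have e: "bounded_cont K e"
    unfolding e_def[abs_def] by (intro bounded_cont_diff w bounded_cont_poly_Q[OF L2_proj_poly_Q] K)
  have er: "L2_ip K e r = 0"
    unfolding e_def[abs_def] by (intro L2_proj_orthogonal K w r)
  have fin: "emeasure lborel K < \<infinity>" using K(2) by (rule emeasure_bounded_finite)
  define f where "f x = e x + r x" for x
  have f: "bounded_cont K f" unfolding f_def[abs_def] by (intro bounded_cont_add e bcr)
  have split: "L2_ip K f g = L2_ip K e g + L2_ip K r g" if "bounded_cont K g" for g
    using L2_ip_add_left[OF K(1,2) e bcr that] by (simp add: f_def[abs_def])
  have "L2_ip K f f = L2_ip K f e + L2_ip K f r"
    using split[OF f] by (simp only: L2_ip_commute[of K f e] L2_ip_commute[of K f r])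
  also have "\<dots> = L2_ip K e e + L2_ip K r r"
    using split[OF e] split[OF bcr] er L2_ip_commute[of K r e] by linarith
  finally have "L2_ip K r r \<le> L2_ip K f f" using L2_ip_nonneg[of K e] by linarith
  also have "\<dots> \<le> (LINT x:K|lborel. B\<^sup>2)"
    unfolding L2_ip_def
  proof (intro set_integral_mono bounded_cont_integrable K bounded_cont_mult f bounded_cont_const)
    fix x assume "x \<in> K"
    then have "\<bar>f x\<bar>\<^sup>2 \<le> B\<^sup>2" using B(2) by (intro power_mono) (auto simp: f_def e_def r_def)
    then show "f x * f x \<le> B\<^sup>2" by (simp add: power2_eq_square)
  qed
  also have "\<dots> = B\<^sup>2 * measure lborel K"
    using K(1) fin by (simp add: set_lebesgue_integral_def)
  finally have le: "L2_ip K r r \<le> B\<^sup>2 * measure lborel K" .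
  have cr: "continuous_on UNIV r" by (rule poly_Q_continuous[OF r])
  define A where "A = {x \<in> K. \<bar>r x\<bar> \<le> 2 * B}"
  have [measurable]: "r \<in> borel_measurable borel" using cr by (rule borel_measurable_continuous_onI)
  have [measurable]: "K \<in> sets borel" using K(1) by simp
  have A: "A \<in> sets borel" unfolding A_def by measurable
  have KA: "K - A = {x \<in> K. 2 * B < \<bar>r x\<bar>}" by (auto simp: A_def)
  have mA: "measure lborel (K - A) = measure lborel K - measure lborel A"
    using fin A by (intro measure_Diff) (auto simp: A_def)
  have "measure lborel K / 2 \<le> measure lborel A"
  \<comment> \<open>Chebyshev's inequality divides by \<open>B\<close>; for \<open>B = 0\<close> the
    norm of \<open>r\<close> is 0 and \<open>r\<close> vanishes on \<open>K\<close>.\<close>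
  proof (cases "B = 0")
    case True
    then have "L2_ip K r r = 0" using le L2_ip_nonneg[of K r] by simp
    then have "r x = 0" if "x \<in> K" for x using L2_ip_self_eq_0[OF K(1,2) bcr _ that] by blast
    then have "A = K" by (auto simp: A_def True)
    then show ?thesis by simp
  next
    case False
    then have B0: "B > 0" using B(1) by simp
    have rr: "set_integrable lborel (K - A) (\<lambda>x. r x * r x)"
      using bounded_cont_integrable[OF K(1,2) bounded_cont_mult[OF bcr bcr]]
      by (rule set_integrable_subset) (use A in auto)
    have "measure lborel (K - A) * (2 * B)\<^sup>2 = (LINT x:K - A|lborel. (2 * B)\<^sup>2)"
      using A fin by (simp add: set_lebesgue_integral_def emeasure_Diff)
    also have "\<dots> \<le> (LINT x:K - A|lborel. r x * r x)"
    proof (rule set_integral_mono[OF _ rr])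
      show "set_integrable lborel (K - A) (\<lambda>x. (2 * B)\<^sup>2)"
        using bounded_cont_integrable[OF K(1,2) bounded_cont_const[of K "(2 * B)\<^sup>2"]]
        by (rule set_integrable_subset) (use A in auto)

      fix x assume "x \<in> K - A"
      then have "(2 * B)\<^sup>2 \<le> \<bar>r x\<bar>\<^sup>2" using B0 by (intro power_mono) (auto simp: KA)
      then show "(2 * B)\<^sup>2 \<le> r x * r x" by (simp add: power2_eq_square)
    qed
    also have "\<dots> \<le> L2_ip K r r"
      unfolding L2_ip_def set_lebesgue_integral_def
    proof (rule integral_mono)
      show "integrable lborel (\<lambda>x. indicator K x *\<^sub>R (r x * r x))"
        using bounded_cont_integrable[OF K(1,2) bounded_cont_mult[OF bcr bcr]]
        by (simp add: set_integrable_def)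
      show "integrable lborel (\<lambda>x. indicator (K - A) x *\<^sub>R (r x * r x))"
        using rr by (simp add: set_integrable_def)
    qed (auto simp: indicator_def)
    also have "\<dots> \<le> B\<^sup>2 * measure lborel K" by (rule le)
    finally have "B\<^sup>2 * (4 * measure lborel (K - A)) \<le> B\<^sup>2 * measure lborel K"
      by (simp add: power2_eq_square mult_ac)
    then have "4 * measure lborel (K - A) \<le> measure lborel K" using B0 by simp
    moreover have "0 \<le> measure lborel K" by simp
    ultimately show ?thesis using mA by linarith
  qed
  then show ?thesis using A by (intro bexI[of _ A]) (auto simp: A_def r_def)
qed

section \<open>Bi-Lipschitz elements\<close>

text \<open>Both Lipschitz bounds are applied to \<open>y\<close> and \<open>y + t w\<close>; the
  linearization error is at most \<open>e * t * norm w\<close>, so dividing by \<open>t\<close> and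
  letting \<open>e\<close> tend to 0 transfers them to \<open>f'\<close>.\<close>

lemma derivative_bilipschitz:
  assumes f: "(f has_derivative f') (at y)" and S: "open S" "y \<in> S"
    and up: "\<And>z. z \<in> S \<Longrightarrow> norm (f z - f y) \<le> L * norm (z - y)"
    and lo: "\<And>z. z \<in> S \<Longrightarrow> norm (z - y) \<le> L * norm (f z - f y)"
    and L: "0 < L"
  shows "norm (f' w) \<le> L * norm w" "norm w \<le> L * norm (f' w)"
proof -
  interpret bounded_linear f' using f by (rule has_derivative_bounded_linear)
  obtain r where r: "r > 0" "ball y r \<subseteq> S" using S open_contains_ball by blast
  have approx: "\<exists>t>0. y + t *\<^sub>R w \<in> S \<and> norm (f (y + t *\<^sub>R w) - f y - t *\<^sub>R f' w) \<le> e * (t * norm w)"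
    if e: "e > 0" for e
  proof -
    obtain d where d: "d > 0" "\<And>z. norm (z - y) < d \<Longrightarrow> norm (f z - f y - f' (z - y)) \<le> e * norm (z - y)"
      using f e unfolding has_derivative_at_alt by blast
    \<comment> \<open>Then \<open>t * norm w\<close> is below both radii; the added 1 covers
      \<open>w = 0\<close>.\<close>
    define t where "t = min r d / (2 * (norm w + 1))"
    have t0: "t > 0" using r(1) d(1) by (simp add: t_def add_nonneg_pos)
    have "t * norm w \<le> t * (norm w + 1)" using t0 by simp
    also have "\<dots> = min r d / 2" by (simp add: t_def field_simps add_nonneg_eq_0_iff)
    also have "\<dots> < min r d" using r(1) d(1) by (auto simp: min_def)
    finally have t: "t * norm w < min r d" .
    have "y + t *\<^sub>R w \<in> S" using r(2) t t0 by (auto simp: dist_norm)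
    moreover have "norm (f (y + t *\<^sub>R w) - f y - t *\<^sub>R f' w) \<le> e * (t * norm w)"
      using d(2)[of "y + t *\<^sub>R w"] t t0 by (simp add: scaleR)
    ultimately show ?thesis using t0 by blast
  qed
  show "norm (f' w) \<le> L * norm w"
  proof (rule field_le_epsilon)
    fix e :: real assume e: "e > 0"
    define e' where "e' = e / (norm w + 1)"
    have n: "norm w + 1 > 0" by (rule add_nonneg_pos) auto
    have e': "e' > 0" "e' * (norm w + 1) = e" using e n by (simp_all add: e'_def)
    obtain t where t: "t > 0" "y + t *\<^sub>R w \<in> S" "norm (f (y + t *\<^sub>R w) - f y - t *\<^sub>R f' w) \<le> e' * (t * norm w)"
      using approx[OF e'(1)] by blast
    have "t * norm (f' w) = norm (t *\<^sub>R f' w)" using t(1) by simp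
    also have "\<dots> \<le> norm (f (y + t *\<^sub>R w) - f y) + norm (f (y + t *\<^sub>R w) - f y - t *\<^sub>R f' w)"
      by (metis norm_triangle_sub norm_minus_commute)
    also have "\<dots> \<le> L * (t * norm w) + e' * (t * norm w)"
      using up[OF t(2)] t by (intro add_mono) auto
    also have "\<dots> = t * (L * norm w + e' * norm w)" by (simp add: algebra_simps)
    finally have "norm (f' w) \<le> L * norm w + e' * norm w" using t(1) by simp
    then show "norm (f' w) \<le> L * norm w + e" using e' by (simp add: distrib_left)
  qed
  show "norm w \<le> L * norm (f' w)"
  proof (rule field_le_epsilon)
    fix e :: real assume e: "e > 0"
    define e' where "e' = e / (L * (norm w + 1))"
    have n: "norm w + 1 > 0" by (rule add_nonneg_pos) auto
    have e': "e' > 0" "L * (e' * (norm w + 1)) = e" using e L n by (simp_all add: e'_def)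
    obtain t where t: "t > 0" "y + t *\<^sub>R w \<in> S" "norm (f (y + t *\<^sub>R w) - f y - t *\<^sub>R f' w) \<le> e' * (t * norm w)"
      using approx[OF e'(1)] by blast
    have "t * norm w \<le> L * norm (f (y + t *\<^sub>R w) - f y)"
      using lo[OF t(2)] t(1) by simp
    also have "norm (f (y + t *\<^sub>R w) - f y) \<le> norm (t *\<^sub>R f' w) + norm (f (y + t *\<^sub>R w) - f y - t *\<^sub>R f' w)"
      by (rule norm_triangle_sub)
    also have "\<dots> \<le> t * norm (f' w) + e' * (t * norm w)" using t by auto
    finally have "t * norm w \<le> t * (L * norm (f' w) + L * (e' * norm w))"
      using L by (simp add: algebra_simps)
    then have "norm w \<le> L * norm (f' w) + L * (e' * norm w)" using t(1) by simp
    moreover have "L * (e' * norm w) \<le> L * (e' * (norm w + 1))" using L e'(1) by simp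
    ultimately show "norm w \<le> L * norm (f' w) + e" unfolding e'(2) by linarith
  qed
qed

text \<open>The gradient of \<open>q \<circ> G\<close> is the transpose of \<open>G'\<close> applied
  to the gradient of \<open>q\<close>. Testing with a gradient itself gives the upper bound, testing
  with its preimage under \<open>G'\<close> the lower one.\<close>

lemma grad_compose_bilipschitz:
  fixes q :: "real^'d \<Rightarrow> real" and G :: "real^'d \<Rightarrow> real^'d"
  assumes G: "(G has_derivative G') (at y)" and q: "q differentiable (at (G y))" and L: "0 < L"
    and up: "\<And>w. norm (G' w) \<le> L * norm w" and lo: "\<And>w. norm w \<le> L * norm (G' w)"
  shows "norm (grad (q \<circ> G) y) \<le> L * norm (grad q (G y))"
    and "norm (grad q (G y)) \<le> L * norm (grad (q \<circ> G) y)"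
proof -
  let ?g = "grad q (G y)" and ?k = "grad (q \<circ> G) y"
  interpret bounded_linear G' using G by (rule has_derivative_bounded_linear)
  have D: "((q \<circ> G) has_derivative (\<lambda>w. ?g \<bullet> G' w)) (at y)"
    using has_derivative_compose[OF G grad_has_derivative[OF q]] by (simp add: o_def)
  then have "(q \<circ> G) differentiable (at y)" by (auto simp: differentiable_def)
  from has_derivative_unique[OF D grad_has_derivative[OF this]]
  have eq: "?k \<bullet> w = ?g \<bullet> G' w" for w by metis
  have "norm ?k * norm ?k = ?g \<bullet> G' ?k"
    using eq[of ?k] by (metis power2_norm_eq_inner power2_eq_square)
  also have "\<dots> \<le> norm ?g * norm (G' ?k)" by (rule norm_cauchy_schwarz)
  also have "\<dots> \<le> norm ?g * (L * norm ?k)" by (intro mult_left_mono up) auto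
  finally have "norm ?k * norm ?k \<le> (L * norm ?g) * norm ?k" by (simp add: mult_ac)
  then show "norm ?k \<le> L * norm ?g"
    using L by (cases "?k = 0") auto
  \<comment> \<open>The lower bound makes \<open>G'\<close> injective, hence bijective in equal
    dimensions, which provides that preimage.\<close>
  have "inj G'" using lo by (intro injI) (metis diff norm_le_zero_iff mult_zero_right norm_zero right_minus_eq)
  then have "surj G'" by (rule linear_injective_imp_surjective[OF linear_axioms]) simp
  then obtain w where w: "G' w = ?g" by (metis surjD)
  have "norm ?g * norm ?g = ?k \<bullet> w"
    by (simp add: eq w flip: power2_norm_eq_inner power2_eq_square)
  also have "\<dots> \<le> norm ?k * norm w" by (rule norm_cauchy_schwarz)
  also have "\<dots> \<le> norm ?k * (L * norm ?g)" using lo[of w] w by (intro mult_left_mono) auto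
  finally have "norm ?g * norm ?g \<le> (L * norm ?k) * norm ?g" by (simp add: mult_ac)
  then show "norm ?g \<le> L * norm ?k"
    using L by (cases "?g = 0") auto
qed

text \<open>Used for a smooth extension \<open>g\<close> of the inverse of \<open>F\<close> beyond
  an element: it guarantees that the gradient has a limit at boundary points.\<close>

lemma continuous_on_grad_compose:
  fixes q :: "real^'d \<Rightarrow> real" and g :: "real^'d \<Rightarrow> real^'d"
  assumes q: "q \<in> poly_Q p" and g: "Ck_on 1 U g"
  shows "continuous_on U (grad (q \<circ> g))"
proof -
  have diff: "g differentiable (at y)" if "y \<in> U" for y using g that by simp
  have cont: "continuous_on U (\<lambda>y. frechet_derivative g (at y) b)" if "b \<in> Basis" for b
    using g that by simp
  have gc: "continuous_on U g"
    using diff differentiable_imp_continuous_within continuous_at_imp_continuous_on by blast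
  have "grad (q \<circ> g) y $ l = grad q (g y) \<bullet> frechet_derivative g (at y) (axis l 1)" if y: "y \<in> U" for y l
  proof -
    have "(g has_derivative frechet_derivative g (at y)) (at y)"
      using diff[OF y] by (simp add: frechet_derivative_works)
    from has_derivative_compose[OF this poly_Q_has_derivative[OF q]]
    have "((q \<circ> g) has_derivative (\<lambda>w. grad q (g y) \<bullet> frechet_derivative g (at y) w)) (at y)"
      by (simp add: o_def)
    then show ?thesis unfolding grad_def[of "q \<circ> g"] by (simp add: frechet_derivative_at[symmetric])
  qed
  then have "continuous_on U (\<lambda>y. \<chi> l. grad (q \<circ> g) y $ l) \<longleftrightarrow>
      continuous_on U (\<lambda>y. \<chi> l. grad q (g y) \<bullet> frechet_derivative g (at y) (axis l 1))"
    by (intro continuous_on_cong) auto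
  moreover have "continuous_on U (\<lambda>y. \<chi> l. grad q (g y) \<bullet> frechet_derivative g (at y) (axis l 1))"
    by (intro continuous_on_vec_lambda continuous_on_inner cont
        continuous_on_compose2[OF continuous_on_grad_poly_Q[OF q, of UNIV] gc]) (auto simp: axis_in_Basis_iff)
  ultimately show ?thesis by simp
qed

text \<open>One mesh element together with constants that are shared by the whole family:
  \<open>L\<close> serves for \<open>F\<close> and for its inverse, \<open>\<sigma>\<close> is the
  shape-regularity constant. Bounds built from these stay uniform in the mesh.\<close>

locale element =
  fixes F :: "real^'d \<Rightarrow> real^'d" and \<Omega> :: "(real^'d) set" and \<Xi> :: "'d \<Rightarrow> real list"
    and a b :: "real^'d" and L \<sigma> :: real
  assumes inj: "inj_on F (cbox 0 1)"
    and L_pos: "0 < L"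
    and lip: "L-lipschitz_on (cbox 0 1) F"
    and lip_inv: "L-lipschitz_on (F ` cbox 0 1) (geo_inv F)"
    and open_Omega: "open \<Omega>"
    and knots_le: "\<And>l. set (\<Xi> l) \<subseteq> {0..1}"
    and span: "\<And>l. knot_span (\<Xi> l) (a $ l) (b $ l)"
    and \<sigma>_pos: "0 < \<sigma>"
    and edge_ge: "\<And>l. \<sigma> * diameter (box a b) \<le> b $ l - a $ l"
    and inv_smooth: "smooth_on_closed (closure (F ` box a b)) (geo_inv F)"
begin

abbreviation "G \<equiv> geo_inv F"
abbreviation "Q \<equiv> box a b"
abbreviation "K \<equiv> F ` box a b"
abbreviation "D \<equiv> diameter (box a b)"
lemma c_pos: "0 < lip_vol CARD('d) L" using L_pos by (simp add: lip_vol_def)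

lemma Q_subset: "Q \<subseteq> box 0 1" "Q \<subseteq> cbox 0 1"
proof -
  have "0 \<le> a $ l \<and> b $ l \<le> 1" for l
    using span[of l] knots_le[of l] by (auto simp: knot_span_def)
  then show "Q \<subseteq> box 0 1"
    by (auto simp: mem_box_cart) (meson le_less_trans less_le_trans)+
  then show "Q \<subseteq> cbox 0 1" using box_subset_cbox by blast
qed

lemma G_F: "x \<in> cbox 0 1 \<Longrightarrow> G (F x) = x"
  unfolding geo_inv_def using inj by (rule inv_into_f_f)

lemma G_F_Q: "x \<in> Q \<Longrightarrow> G (F x) = x"
  using G_F Q_subset by blast

text \<open>Invariance of domain.\<close>

lemma open_image: "open T \<Longrightarrow> T \<subseteq> Q \<Longrightarrow> open (F ` T)"
  using lipschitz_on_continuous_on[OF lip] inj Q_subset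
  by (intro invariance_of_domain_gen) (auto intro: continuous_on_subset inj_on_subset)

lemma open_K: "open K" by (rule open_image) auto

lemma bounded_K: "bounded K"
  using compact_continuous_image[OF lipschitz_on_continuous_on[OF lip] compact_cbox] Q_subset
  by (meson bounded_subset compact_imp_bounded image_mono)

lemma Q_nonempty: "Q \<noteq> {}" using knot_span_diameter_pos[OF span] by auto

lemma pullback_K: "pullback F K = Q"
  using Q_subset inj by (force simp: pullback_def dest: inj_onD box_subset_cbox[THEN subsetD])

lemma pullback_Int: "pullback F (K \<inter> \<Omega>) = Q \<inter> pullback F \<Omega>"
  using pullback_K by (auto simp: pullback_def)

lemma open_pullback: "open (Q \<inter> pullback F \<Omega>)"
proof -
  have "continuous_on Q F" using lipschitz_on_continuous_on[OF lip] Q_subset(2) continuous_on_subset by blast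
  then have "open (Q \<inter> F -` \<Omega>)" by (intro continuous_open_preimage open_Omega) auto
  also have "Q \<inter> F -` \<Omega> = Q \<inter> pullback F \<Omega>" using Q_subset(1) by (auto simp: pullback_def)
  finally show ?thesis .
qed

lemma D_pos: "0 < D" by (rule knot_span_diameter_pos[OF span])

lemma lip_F: "x \<in> Q \<Longrightarrow> y \<in> Q \<Longrightarrow> norm (F x - F y) \<le> L * norm (x - y)"
  using lipschitz_onD[OF lip] Q_subset(2) by (auto simp: dist_norm)

lemma lip_G: "x \<in> K \<Longrightarrow> y \<in> K \<Longrightarrow> norm (G x - G y) \<le> L * norm (x - y)"
  using lipschitz_onD[OF lip_inv] Q_subset(2) by (auto simp: dist_norm image_iff subset_iff Bex_def)

lemma diameter_K_le: "diameter K \<le> L * D"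
proof (rule diameter_le)
  fix x y assume "x \<in> K" "y \<in> K"
  then obtain u v where uv: "x = F u" "y = F v" "u \<in> Q" "v \<in> Q" by blast
  have "norm (x - y) \<le> L * dist u v" using lip_F uv by (simp add: dist_norm)
  also have "\<dots> \<le> L * D" using L_pos uv by (intro mult_left_mono diameter_bounded_bound) auto
  finally show "norm (x - y) \<le> L * D" .
qed (use Q_nonempty in simp)

text \<open>Differentiability comes from the smooth extension, which agrees with \<open>G\<close> on
  the open set \<open>K\<close>. The lower bound for \<open>G'\<close> is the Lipschitz bound of
  \<open>F\<close>.\<close>

lemma G_derivative:
  assumes y: "y \<in> K"
  obtains G' where "(G has_derivative G') (at y)"
    "\<And>w. norm (G' w) \<le> L * norm w" "\<And>w. norm w \<le> L * norm (G' w)"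
proof -
  obtain U g where U: "open U" "closure K \<subseteq> U" "\<And>k. Ck_on k U g" "\<And>x. x \<in> closure K \<Longrightarrow> g x = G x"
    using inv_smooth unfolding smooth_on_closed_def by blast
  have "g differentiable (at y)" using U(2) U(3)[of "Suc 0"] y closure_subset[of K] by auto
  then obtain G' where "(g has_derivative G') (at y)" by (auto simp: differentiable_def)
  then have D: "(G has_derivative G') (at y)"
    by (rule has_derivative_transform_within_open[OF _ open_K y]) (use U(4) closure_subset in blast)
  have "norm (z - y) \<le> L * norm (G z - G y)" if "z \<in> K" for z
    using that y lip_F by (auto simp: G_F_Q)
  from derivative_bilipschitz[OF D open_K y _ this L_pos] lip_G y D show ?thesis
    by (intro that) auto
qed

lemma grad_pullback:
  assumes y: "y \<in> K" and q: "q \<in> poly_Q p"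
  shows "norm (grad (q \<circ> G) y) \<le> L * norm (grad q (G y))"
    and "norm (grad q (G y)) \<le> L * norm (grad (q \<circ> G) y)"
proof -
  obtain G' where G': "(G has_derivative G') (at y)"
    "\<And>w. norm (G' w) \<le> L * norm w" "\<And>w. norm w \<le> L * norm (G' w)"
    using G_derivative[OF y] by blast
  show "norm (grad (q \<circ> G) y) \<le> L * norm (grad q (G y))"
    "norm (grad q (G y)) \<le> L * norm (grad (q \<circ> G) y)"
    using grad_compose_bilipschitz[OF G'(1) poly_Q_differentiable[OF q] L_pos G'(2,3)] by auto
qed

text \<open>Near \<open>x\<close> the gradient of \<open>q \<circ> G\<close> on \<open>K\<close>
  coincides with that of \<open>q \<circ> g\<close> for a smooth extension \<open>g\<close>, so the
  limit exists also on the boundary of \<open>K\<close> and inherits the pointwise bound from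
  inside.\<close>

lemma norm_Lim_grad_le:
  assumes x: "x \<in> closure K" and q: "q \<in> poly_Q p"
    and W: "\<And>z. z \<in> Q \<Longrightarrow> norm (grad q z) \<le> W"
  shows "norm (Lim (at x within K) (\<lambda>y. grad (q \<circ> G) y)) \<le> L * W"
proof -
  obtain U g where U: "open U" "closure K \<subseteq> U" "Ck_on 1 U g" "\<And>x. x \<in> closure K \<Longrightarrow> g x = G x"
    using inv_smooth unfolding smooth_on_closed_def by blast
  have eq: "grad (q \<circ> g) y = grad (q \<circ> G) y" if y: "y \<in> K" for y
  proof -
    obtain G' where G': "(G has_derivative G') (at y)" by (rule G_derivative[OF y])
    have "(q \<circ> G) differentiable (at y)"
      unfolding differentiable_def o_def
      using has_derivative_compose[OF G' poly_Q_has_derivative[OF q]] by blast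
    then have "frechet_derivative (q \<circ> g) (at y) = frechet_derivative (q \<circ> G) (at y)"
      using U(4) closure_subset[of K] y open_K by (intro frechet_derivative_transform_within_open[symmetric, where X = K]) auto
    then show ?thesis by (simp add: grad_def)
  qed
  have "x \<in> U" using x U(2) by blast
  then have "isCont (grad (q \<circ> g)) x"
    using continuous_on_grad_compose[OF q U(3)] U(1) continuous_on_eq_continuous_at by blast
  then have "((grad (q \<circ> g)) \<longlongrightarrow> grad (q \<circ> g) x) (at x within K)"
    using isCont_def tendsto_within_subset by blast
  moreover have "eventually (\<lambda>y. grad (q \<circ> g) y = grad (q \<circ> G) y) (at x within K)"
    using eq by (auto simp: eventually_at_filter)
  ultimately have lim: "((\<lambda>y. grad (q \<circ> G) y) \<longlongrightarrow> grad (q \<circ> g) x) (at x within K)"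
    using tendsto_cong by fastforce
  \<comment> \<open>\<open>Lim\<close> is determined only along a nontrivial filter; a point in the
    closure of an open set is a limit point of that set.\<close>
  have nt: "at x within K \<noteq> bot"
    using x interior_limit_point[of x K] open_K
    by (auto simp: trivial_limit_within closure_def interior_open)
  have "norm (grad (q \<circ> G) y) \<le> L * W" if y: "y \<in> K" for y
  proof -
    have "G y \<in> Q" using y by (auto simp: G_F_Q)
    then have "L * norm (grad q (G y)) \<le> L * W" using L_pos W by (intro mult_left_mono) auto
    with grad_pullback(1)[OF y q] show ?thesis by linarith
  qed
  then have "eventually (\<lambda>y. norm (grad (q \<circ> G) y) \<le> L * W) (at x within K)"
    by (auto simp: eventually_at_filter)
  then have "norm (grad (q \<circ> g) x) \<le> L * W"
    by (rule tendsto_upperbound[OF tendsto_norm[OF lim] _ nt])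
  then show ?thesis using tendsto_Lim[OF nt lim] by simp
qed

text \<open>Uniqueness holds because the uncut part of \<open>Q\<close> is open and
  nonempty.\<close>

lemma element_ext_eq:
  assumes q: "q \<in> poly_Q p" "\<And>x. x \<in> Q \<inter> pullback F \<Omega> \<Longrightarrow> q x = v (F x)"
    and ne: "Q \<inter> pullback F \<Omega> \<noteq> {}"
  shows "element_ext F \<Omega> p K v = q \<circ> G"
proof -
  have "(THE q. q \<in> poly_Q p \<and> (\<forall>x\<in>pullback F (K \<inter> \<Omega>). q x = v (F x))) = q"
    unfolding pullback_Int
  proof (rule the_equality)
    show "q \<in> poly_Q p \<and> (\<forall>x\<in>Q \<inter> pullback F \<Omega>. q x = v (F x))" using q by blast
    fix r assume r: "r \<in> poly_Q p \<and> (\<forall>x\<in>Q \<inter> pullback F \<Omega>. r x = v (F x))"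
    show "r = q"
    proof (rule poly_Q_eqI[OF _ q(1) open_pullback ne])
      show "r \<in> poly_Q p" using r by blast
      show "r x = q x" if "x \<in> Q \<inter> pullback F \<Omega>" for x using r q(2)[OF that] that by metis
    qed
  qed
  then show ?thesis by (simp add: element_ext_def)
qed

lemma ex_element_poly:
  assumes v: "v \<in> trimmed_space F \<Omega> p \<Xi>"
  shows "\<exists>q\<in>poly_Q p. \<forall>x\<in>Q \<inter> pullback F \<Omega>. q x = v (F x)"
proof -
  obtain c where c: "\<And>y. y \<in> \<Omega> \<Longrightarrow> v y = (\<Sum>i\<in>spline_indices p \<Xi>. c i * tensor_bspline p \<Xi> i (G y))"
    using v by (auto simp: trimmed_space_def)
  have "\<exists>P. \<forall>l. degree (P l) \<le> p \<and> (\<forall>t\<in>{a $ l<..<b $ l}. bspline (\<Xi> l) p (i l) t = poly (P l) t)"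
    if i: "i \<in> spline_indices p \<Xi>" for i
  proof (rule choice, rule allI)
    fix l
    have "i l < length (\<Xi> l) - p - 1" using i by (auto simp: spline_indices_def)
    then have "i l + Suc p < length (\<Xi> l)" by simp
    then show "\<exists>P. degree P \<le> p \<and> (\<forall>t\<in>{a $ l<..<b $ l}. bspline (\<Xi> l) p (i l) t = poly P t)"
      by (rule bspline_eq_poly[OF span])
  qed
  then obtain P where P: "\<And>i l. i \<in> spline_indices p \<Xi> \<Longrightarrow> degree (P i l) \<le> p"
    "\<And>i l t. i \<in> spline_indices p \<Xi> \<Longrightarrow> t \<in> {a $ l<..<b $ l} \<Longrightarrow> bspline (\<Xi> l) p (i l) t = poly (P i l) t"
    by metis
  show ?thesis
  proof (intro bexI ballI)
    show "(\<lambda>x. \<Sum>i\<in>spline_indices p \<Xi>. c i * (\<Prod>l\<in>UNIV. poly (P i l) (x $ l))) \<in> poly_Q p"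
      using P(1) by (intro poly_Q_sum poly_Q_cmult poly_Q_prod_poly) auto
    fix x assume x: "x \<in> Q \<inter> pullback F \<Omega>"
    have "v (F x) = (\<Sum>i\<in>spline_indices p \<Xi>. c i * tensor_bspline p \<Xi> i x)"
      using c[of "F x"] x by (simp add: pullback_def G_F_Q)
    also have "\<dots> = (\<Sum>i\<in>spline_indices p \<Xi>. c i * (\<Prod>l\<in>UNIV. poly (P i l) (x $ l)))"
      using x P(2) by (intro sum.cong) (auto simp: tensor_bspline_def mem_box_cart intro!: prod.cong)
    finally show "(\<Sum>i\<in>spline_indices p \<Xi>. c i * (\<Prod>l\<in>UNIV. poly (P i l) (x $ l))) = v (F x)" by simp
  qed
qed

text \<open>The volume bound for Lipschitz images, applied to the inverse map.\<close>

lemma emeasure_image_ge: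
  assumes T: "open T" "T \<subseteq> Q"
  shows "emeasure lborel T \<le> ennreal (lip_vol CARD('d) L) * emeasure lborel (F ` T)"
proof -
  have "G ` F ` T = T" using T(2) by (force simp: image_image G_F_Q)
  moreover have "L-lipschitz_on (F ` T) G"
    using T(2) Q_subset(2) by (intro lipschitz_on_subset[OF lip_inv]) auto
  moreover have "bounded (F ` T)" using bounded_K T(2) by (meson bounded_subset image_mono)
  ultimately show ?thesis
    using emeasure_lipschitz_image_le[OF open_image[OF T], of L G] by simp
qed

lemma measure_Q_ge: "\<sigma> ^ CARD('d) * D ^ CARD('d) \<le> measure lborel Q"
  by (rule knot_span_measure_ge[OF span \<sigma>_pos edge_ge])

lemma measure_K_ge: "\<sigma> ^ CARD('d) / lip_vol CARD('d) L * D ^ CARD('d) \<le> measure lborel K"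
proof -
  have fin: "emeasure lborel K = ennreal (measure lborel K)" "emeasure lborel Q = ennreal (measure lborel Q)"
    using emeasure_bounded_finite[OF bounded_K] emeasure_bounded_finite[OF bounded_box[of a b]]
    by (auto intro!: emeasure_eq_ennreal_measure simp: less_top)
  have "ennreal (measure lborel Q) \<le> ennreal (lip_vol CARD('d) L * measure lborel K)"
    using emeasure_image_ge[OF open_box order_refl] fin c_pos by (simp add: ennreal_mult)
  then have "measure lborel Q \<le> lip_vol CARD('d) L * measure lborel K" using c_pos by (subst (asm) ennreal_le_iff) auto
  with measure_Q_ge c_pos show ?thesis by (simp add: field_simps)
qed

end

section \<open>Estimates on a good element\<close>

context element
begin

text \<open>Let \<open>T\<close> be the part of the trimmed element where the squared gradient
  exceeds a fixed fraction of its value at \<open>x\<close>. By Remez the rest is too small to fill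
  half of the guaranteed volume, so \<open>T\<close> fills the other half. Its image under
  \<open>F\<close> contributes enough to the energy.\<close>

lemma energy_bound:
  assumes \<theta>: "0 < \<theta>" and good: "\<theta> * measure lborel Q \<le> measure lborel (pullback F \<Omega> \<inter> Q)"
    and q: "q \<in> poly_Q p" and v: "\<And>x. x \<in> Q \<inter> pullback F \<Omega> \<Longrightarrow> q x = v (F x)"
    and C: "0 < C"
    and remez: "\<And>(f :: real^'d \<Rightarrow> real) x R A e. line_poly (2 * (p * CARD('d))) f \<Longrightarrow> A \<in> sets borel \<Longrightarrow>
      A \<subseteq> cball x R \<Longrightarrow> 0 < R \<Longrightarrow> ennreal (\<theta> * \<sigma> ^ CARD('d) / 2 * R ^ CARD('d)) \<le> emeasure lborel A \<Longrightarrow>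
      (\<And>y. y \<in> A \<Longrightarrow> \<bar>f y\<bar> \<le> e) \<Longrightarrow> \<bar>f x\<bar> \<le> C * e"
    and x: "x \<in> Q"
  shows "ennreal ((norm (grad q x))\<^sup>2 * D ^ CARD('d)) \<le>
    ennreal (4 * C * L\<^sup>2 * lip_vol CARD('d) L / (\<theta> * \<sigma> ^ CARD('d))) *
      (\<integral>\<^sup>+y\<in>\<Omega> \<inter> K. ennreal ((norm (grad v y))\<^sup>2) \<partial>lborel)"
proof (cases "grad q x = 0")
  case False
  define f where "f y = (norm (grad q y))\<^sup>2" for y
  \<comment> \<open>With \<open>2 * C\<close> in the denominator, Remez at level \<open>e\<close>
    would give \<open>f x \<le> f x / 2\<close>. The constant \<open>\<kappa>\<close> below is half
    of the guaranteed density \<open>\<theta> * \<sigma> ^ CARD('d)\<close>, leaving as much for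
    \<open>T\<close>.\<close>
  define e where "e = f x / (2 * C)"
  define \<kappa> where "\<kappa> = \<theta> * \<sigma> ^ CARD('d) / 2"
  let ?J = "\<integral>\<^sup>+y\<in>\<Omega> \<inter> K. ennreal ((norm (grad v y))\<^sup>2) \<partial>lborel"
  let ?c = "lip_vol CARD('d) L"
  have fx: "0 < f x" using False by (simp add: f_def)
  have e: "0 < e" using fx C by (simp add: e_def)
  have \<kappa>: "0 < \<kappa>" using \<theta> \<sigma>_pos by (simp add: \<kappa>_def)
  define A where "A = Q \<inter> pullback F \<Omega>"
  have A: "open A" unfolding A_def by (rule open_pullback)
  have f_line: "line_poly (2 * (p * CARD('d))) f"
    unfolding f_def[abs_def] by (rule line_poly_norm_grad[OF q])
  have cf: "continuous_on UNIV f"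
    unfolding f_def by (intro continuous_intros continuous_on_grad_poly_Q[OF q])
  define T where "T = A \<inter> f -` {e<..}"
  define B where "B = A - T"
  have T: "open T" "T \<subseteq> Q"
    unfolding T_def using cf A
    by (auto intro!: continuous_open_preimage continuous_on_subset[OF cf] simp: A_def)
  have finA: "emeasure lborel A < \<infinity>"
    by (rule emeasure_bounded_finite) (auto simp: A_def intro: bounded_Int)
  have small: "measure lborel B < \<kappa> * D ^ CARD('d)"
  proof (rule ccontr)
    assume "\<not> ?thesis"
    then have "ennreal (\<kappa> * D ^ CARD('d)) \<le> ennreal (measure lborel B)" by (intro ennreal_leI) simp
    also have "\<dots> \<le> emeasure lborel B" by (simp add: measure_def ennreal_enn2real_if)
    finally have big: "ennreal (\<theta> * \<sigma> ^ CARD('d) / 2 * D ^ CARD('d)) \<le> emeasure lborel B" by (simp add: \<kappa>_def)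
    have "B \<subseteq> cball x D"
      using x by (auto simp: B_def A_def intro!: diameter_bounded_bound)
    moreover have "B \<in> sets borel" using A T by (auto simp: B_def)
    moreover have "\<bar>f y\<bar> \<le> e" if "y \<in> B" for y
      using that by (auto simp: B_def T_def) (auto simp: f_def)
    ultimately have "\<bar>f x\<bar> \<le> C * e"
      using remez[OF f_line _ _ D_pos big] by blast
    then show False using C fx by (simp add: e_def)
  qed
  have "2 * (\<kappa> * D ^ CARD('d)) = \<theta> * (\<sigma> ^ CARD('d) * D ^ CARD('d))" by (simp add: \<kappa>_def)
  also have "\<dots> \<le> \<theta> * measure lborel Q" using \<theta> measure_Q_ge by (intro mult_left_mono) auto
  also have "\<dots> \<le> measure lborel A" using good by (simp add: A_def Int_commute)
  also have "\<dots> = measure lborel B + measure lborel T"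
  proof -
    have "measure lborel B = measure lborel A - measure lborel T"
      unfolding B_def using finA A T by (intro measure_Diff) (auto simp: T_def)
    then show ?thesis by simp
  qed
  finally have "\<kappa> * D ^ CARD('d) \<le> measure lborel T" using small by linarith
  then have "ennreal (\<kappa> * D ^ CARD('d)) \<le> ennreal (measure lborel T)" by (rule ennreal_leI)
  also have "\<dots> \<le> emeasure lborel T" by (simp add: measure_def ennreal_enn2real_if)
  also have "\<dots> \<le> ennreal ?c * emeasure lborel (F ` T)" by (rule emeasure_image_ge[OF T])
  finally have vol: "ennreal (\<kappa> * D ^ CARD('d)) \<le> ennreal ?c * emeasure lborel (F ` T)" .
  have oK: "open (\<Omega> \<inter> K)" using open_Omega open_K by blast
  have low: "e / L\<^sup>2 \<le> (norm (grad v (F z)))\<^sup>2" and in_K: "F z \<in> \<Omega> \<inter> K" if z: "z \<in> T" for z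
  proof -
    show FK: "F z \<in> \<Omega> \<inter> K" using z by (auto simp: T_def A_def pullback_def)
    have zQ: "z \<in> Q" using T(2) z by blast
    obtain G' where G': "(G has_derivative G') (at (F z))" using G_derivative[of "F z"] FK by blast
    have "(q \<circ> G) differentiable (at (F z))"
      unfolding differentiable_def o_def
      using has_derivative_compose[OF G' poly_Q_has_derivative[OF q]] by blast
    \<comment> \<open>\<open>v\<close> is prescribed only on the trimmed domain; agreement on the
      open set \<open>\<Omega> \<inter> K\<close> suffices for the gradients.\<close>
    moreover have "(q \<circ> G) y = v y" if y: "y \<in> \<Omega> \<inter> K" for y
    proof -
      obtain w where w: "y = F w" "w \<in> Q" using y by blast
      have "w \<in> Q \<inter> pullback F \<Omega>" using y w Q_subset(1) by (auto simp: pullback_def)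
      then show ?thesis using v w by (simp add: G_F_Q)
    qed
    ultimately have "frechet_derivative (q \<circ> G) (at (F z)) = frechet_derivative v (at (F z))"
      by (intro frechet_derivative_transform_within_open[OF _ oK FK])
    then have gv: "grad v (F z) = grad (q \<circ> G) (F z)" by (simp add: grad_def)
    have "norm (grad q z) \<le> L * norm (grad v (F z))"
      using grad_pullback(2)[OF _ q, of "F z"] FK zQ by (simp add: gv G_F_Q)
    then have "f z \<le> (L * norm (grad v (F z)))\<^sup>2" unfolding f_def by (intro power_mono) auto
    moreover have "e < f z" using z by (simp add: T_def)
    ultimately have "e \<le> L\<^sup>2 * (norm (grad v (F z)))\<^sup>2" by (simp add: power_mult_distrib)
    then show "e / L\<^sup>2 \<le> (norm (grad v (F z)))\<^sup>2" using L_pos by (simp add: field_simps)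
  qed
  have "ennreal (e / L\<^sup>2) * emeasure lborel (F ` T) = (\<integral>\<^sup>+y. ennreal (e / L\<^sup>2) * indicator (F ` T) y \<partial>lborel)"
    using open_image[OF T] by (simp add: nn_integral_cmult_indicator)
  also have "\<dots> \<le> ?J"
    using low in_K by (intro nn_integral_mono) (auto simp: indicator_def intro!: ennreal_leI)
  finally have "ennreal (e / L\<^sup>2) * emeasure lborel (F ` T) \<le> ?J" .
  then have "ennreal ?c * (ennreal (e / L\<^sup>2) * emeasure lborel (F ` T)) \<le> ennreal ?c * ?J"
    by (intro mult_left_mono) auto
  moreover have "ennreal (e / L\<^sup>2) * ennreal (\<kappa> * D ^ CARD('d)) \<le> ennreal (e / L\<^sup>2) * (ennreal ?c * emeasure lborel (F ` T))"
    by (intro mult_left_mono vol) auto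
  ultimately have "ennreal (e / L\<^sup>2) * ennreal (\<kappa> * D ^ CARD('d)) \<le> ennreal ?c * ?J"
    by (simp add: mult_ac)
  \<comment> \<open>This factor turns \<open>e / L\<^sup>2 * \<kappa>\<close> back into
    \<open>f x\<close>.\<close>
  then have "ennreal (2 * C * L\<^sup>2 / \<kappa>) * (ennreal (e / L\<^sup>2) * ennreal (\<kappa> * D ^ CARD('d))) \<le>
      ennreal (2 * C * L\<^sup>2 / \<kappa>) * (ennreal ?c * ?J)"
    by (intro mult_left_mono) auto
  moreover have "ennreal (2 * C * L\<^sup>2 / \<kappa>) * (ennreal (e / L\<^sup>2) * ennreal (\<kappa> * D ^ CARD('d))) =
      ennreal (f x * D ^ CARD('d))"
  proof -
    have "2 * C * L\<^sup>2 / \<kappa> * (e / L\<^sup>2 * (\<kappa> * D ^ CARD('d))) = f x * D ^ CARD('d)"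
      using C \<kappa> L_pos by (simp add: e_def)
    moreover have "ennreal u * (ennreal v * ennreal w) = ennreal (u * (v * w))"
      if "0 \<le> u" "0 \<le> v" "0 \<le> w" for u v w
      using that by (simp add: ennreal_mult)
    ultimately show ?thesis
      using C \<kappa> L_pos e D_pos by (metis (no_types, lifting) divide_nonneg_nonneg less_imp_le mult_nonneg_nonneg zero_le_numeral zero_le_power)
  qed
  moreover have "ennreal (2 * C * L\<^sup>2 / \<kappa>) * (ennreal ?c * ?J) =
      ennreal (4 * C * L\<^sup>2 * ?c / (\<theta> * \<sigma> ^ CARD('d))) * ?J"
    using C \<kappa> c_pos by (simp add: mult.assoc[symmetric] ennreal_mult[symmetric] \<kappa>_def)
  ultimately show ?thesis by (simp add: f_def)
qed simp

text \<open>On \<open>K\<close> the function differs from a constant \<open>k\<close> by at most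
  \<open>W * D\<close>, so the projection minus \<open>k\<close> is at most \<open>2 * W * D\<close>
  on half of \<open>K\<close>. Remez extends this to the ball of radius \<open>D\<close> around
  \<open>x\<close>, and Markov on that ball divides by \<open>D\<close> again, so the mesh size
  cancels.\<close>

lemma norm_grad_L2_proj_le:
  assumes q: "q \<in> poly_Q p" and W: "\<And>z. z \<in> Q \<Longrightarrow> norm (grad q z) \<le> W"
    and R: "0 < R" "K \<subseteq> cball x (R * D)"
    and CM: "0 < CM" "\<And>(f :: real^'d \<Rightarrow> real) x \<delta> B. line_poly (p * CARD('d)) f \<Longrightarrow> f differentiable (at x) \<Longrightarrow> 0 < \<delta> \<Longrightarrow>
     (\<And>y. y \<in> cball x \<delta> \<Longrightarrow> \<bar>f y\<bar> \<le> B) \<Longrightarrow> norm (grad f x) \<le> CM * B / \<delta>"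
    and remez: "0 < C" "\<And>(f :: real^'d \<Rightarrow> real) x r A e. line_poly (p * CARD('d)) f \<Longrightarrow> A \<in> sets borel \<Longrightarrow>
      A \<subseteq> cball x r \<Longrightarrow> 0 < r \<Longrightarrow>
      ennreal (\<sigma> ^ CARD('d) / (2 * lip_vol CARD('d) L * (R + 1) ^ CARD('d)) * r ^ CARD('d)) \<le> emeasure lborel A \<Longrightarrow>
      (\<And>y. y \<in> A \<Longrightarrow> \<bar>f y\<bar> \<le> e) \<Longrightarrow> \<bar>f x\<bar> \<le> C * e"
  shows "norm (grad (L2_proj p K (q \<circ> G)) x) \<le> 2 * CM * C * W"
proof -
  obtain z0 where z0: "z0 \<in> Q" using Q_nonempty by blast
  define k where "k = q z0"
  have W0: "0 \<le> W" using W[OF z0] norm_ge_zero order_trans by blast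
  have osc: "\<bar>(q \<circ> G) y - k\<bar> \<le> W * D" if y: "y \<in> K" for y
  proof -
    have Gy: "G y \<in> Q" using y by (auto simp: G_F_Q)
    \<comment> \<open>The mean value inequality is used on the convex box \<open>Q\<close>;
      \<open>K\<close> need not be convex.\<close>
    have "norm (q (G y) - q z0) \<le> W * norm (G y - z0)"
    proof (rule differentiable_bound[of Q q "\<lambda>z w. grad q z \<bullet> w"])
      show "(q has_derivative (\<lambda>w. grad q z \<bullet> w)) (at z within Q)" if "z \<in> Q" for z
        by (rule has_derivative_at_withinI[OF poly_Q_has_derivative[OF q]])
      show "onorm (\<lambda>w. grad q z \<bullet> w) \<le> W" if "z \<in> Q" for z
      proof (rule onorm_bound[OF W0])
        fix w
        have "norm (grad q z \<bullet> w) \<le> norm (grad q z) * norm w" by (simp add: Cauchy_Schwarz_ineq2)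
        also have "\<dots> \<le> W * norm w" using W[OF that] by (intro mult_right_mono) auto
        finally show "norm (grad q z \<bullet> w) \<le> W * norm w" .
      qed
    qed (use Gy z0 in auto)
    also have "\<dots> \<le> W * D"
      using W0 Gy z0 diameter_bounded_bound[of Q "G y" z0] by (intro mult_left_mono) (auto simp: dist_norm)
    finally show ?thesis by (simp add: k_def)
  qed
  have G_cont: "continuous_on K G"
    by (rule continuous_on_subset[OF lipschitz_on_continuous_on[OF lip_inv]]) (use Q_subset(2) in auto)
  have w: "bounded_cont K (q \<circ> G)"
    unfolding bounded_cont_def
  proof (intro conjI exI ballI)
    show "continuous_on K (q \<circ> G)"
      by (intro continuous_on_compose G_cont poly_Q_continuous[OF q])
    fix y assume "y \<in> K"
    then show "\<bar>(q \<circ> G) y\<bar> \<le> W * D + \<bar>k\<bar>" using osc[of y] by linarith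
  qed
  have K_ne: "K \<noteq> {}" using Q_nonempty by blast
  have WD: "0 \<le> W * D" using W0 D_pos by simp
  define \<pi> where "\<pi> = L2_proj p K (q \<circ> G)"
  obtain A where A: "A \<in> sets borel" "A \<subseteq> K" "measure lborel K / 2 \<le> measure lborel A"
    "\<And>y. y \<in> A \<Longrightarrow> \<bar>\<pi> y - k\<bar> \<le> 2 * (W * D)"
    using L2_proj_small_set[OF open_K bounded_K K_ne w WD osc, of p] unfolding \<pi>_def by blast
  have \<pi>: "\<pi> \<in> poly_Q p" unfolding \<pi>_def by (rule L2_proj_poly_Q[OF open_K bounded_K K_ne w])
  define r where "r y = \<pi> y - k" for y
  have r: "r \<in> poly_Q p" unfolding r_def[abs_def] by (intro poly_Q_diff \<pi> poly_Q_const)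
  have grad_r: "grad r x = grad \<pi> x"
    by (rule grad_eqI) (use poly_Q_has_derivative[OF \<pi>] in \<open>auto simp: r_def[abs_def] intro!: derivative_eq_intros\<close>)
  \<comment> \<open>Remez is centred at \<open>y\<close>, which may lie outside \<open>K\<close>;
    the radius \<open>(R + 1) * D\<close> allows for the distance from \<open>y\<close> to
    \<open>x\<close>.\<close>
  have "\<bar>r y\<bar> \<le> C * (2 * (W * D))" if y: "y \<in> cball x D" for y
  proof (rule remez(2)[OF line_poly_poly_Q[OF r] A(1), of y "(R + 1) * D"])
    show "A \<subseteq> cball y ((R + 1) * D)"
    proof
      fix z assume "z \<in> A"
      then have "z \<in> cball x (R * D)" using A(2) R(2) by blast
      then have "dist x z \<le> R * D" by simp
      then show "z \<in> cball y ((R + 1) * D)"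
        using y dist_triangle[of y z x] by (simp add: dist_commute algebra_simps)
    qed
    show "0 < (R + 1) * D" using R(1) D_pos by simp
    \<comment> \<open>The power of \<open>R + 1\<close> in the density cancels against the radius,
      leaving half of the lower bound for the volume of \<open>K\<close>.\<close>
    have "u / (2 * w * t ^ CARD('d)) * (t * D) ^ CARD('d) = (u / w * D ^ CARD('d)) / 2"
      if "0 < t" for u w t :: real
      using that by (simp add: power_mult_distrib)
    then have "\<sigma> ^ CARD('d) / (2 * lip_vol CARD('d) L * (R + 1) ^ CARD('d)) * ((R + 1) * D) ^ CARD('d) =
        (\<sigma> ^ CARD('d) / lip_vol CARD('d) L * D ^ CARD('d)) / 2"
      using R(1) by simp
    also have "\<dots> \<le> measure lborel A" by (rule order_trans[OF divide_right_mono[OF measure_K_ge] A(3)]) simp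
    finally have "ennreal (\<sigma> ^ CARD('d) / (2 * lip_vol CARD('d) L * (R + 1) ^ CARD('d)) * ((R + 1) * D) ^ CARD('d))
        \<le> ennreal (measure lborel A)" by (rule ennreal_leI)
    also have "\<dots> \<le> emeasure lborel A" by (simp add: measure_def ennreal_enn2real_if)
    finally show "ennreal (\<sigma> ^ CARD('d) / (2 * lip_vol CARD('d) L * (R + 1) ^ CARD('d)) * ((R + 1) * D) ^ CARD('d))
        \<le> emeasure lborel A" .
    show "\<bar>r z\<bar> \<le> 2 * (W * D)" if "z \<in> A" for z using A(4)[OF that] by (simp add: r_def)
  qed
  then have "norm (grad r x) \<le> CM * (C * (2 * (W * D))) / D"
    using CM(2)[OF line_poly_poly_Q[OF r] poly_Q_differentiable[OF r] D_pos] by blast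
  also have "\<dots> = 2 * CM * C * W" using D_pos by simp
  finally show ?thesis by (simp add: grad_r \<pi>_def)
qed

end

lemma norm_outward_normal_le: "norm (outward_normal \<Omega> x) \<le> 1"
proof (cases "\<exists>\<nu>. is_outward_normal \<Omega> x \<nu>")
  case True
  then show ?thesis using outward_normal_eq by (metis is_outward_normal_def order_refl)
qed (simp add: outward_normal_def)

text \<open>Reduces the claim to squared integrals with finite right-hand side. If the right-hand
  norm is infinite, \<open>c > 0\<close> keeps the product infinite.\<close>

lemma L2_norm_le:
  assumes c: "0 < c" and fin: "(\<integral>\<^sup>+y\<in>T. ennreal ((norm (g y))\<^sup>2) \<partial>N) < top \<Longrightarrow>
    (\<integral>\<^sup>+x\<in>S. ennreal ((norm (f x))\<^sup>2) \<partial>M) \<le> ennreal (c\<^sup>2 * enn2real (\<integral>\<^sup>+y\<in>T. ennreal ((norm (g y))\<^sup>2) \<partial>N))"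
  shows "L2_norm M S f \<le> ennreal c * L2_norm N T g"
proof -
  let ?I = "\<integral>\<^sup>+x\<in>S. ennreal ((norm (f x))\<^sup>2) \<partial>M"
  let ?J = "\<integral>\<^sup>+y\<in>T. ennreal ((norm (g y))\<^sup>2) \<partial>N"
  show ?thesis
  proof (cases "?J = top")
    case True
    then show ?thesis using c by (simp add: L2_norm_def Let_def ennreal_mult_top)
  next
    case False
    then have le: "?I \<le> ennreal (c\<^sup>2 * enn2real ?J)" using fin by (simp add: less_top)
    then have "?I < top" using ennreal_less_top le_less_trans by blast
    then have "L2_norm M S f = ennreal (sqrt (enn2real ?I))" by (simp add: L2_norm_def Let_def)
    also have "\<dots> \<le> ennreal (sqrt (c\<^sup>2 * enn2real ?J))"
      using le by (intro ennreal_leI real_sqrt_le_mono enn2real_leI) auto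
    also have "\<dots> = ennreal c * L2_norm N T g"
      using False c by (simp add: L2_norm_def Let_def real_sqrt_mult ennreal_mult)
    finally show ?thesis .
  qed
qed

section \<open>The stabilization estimate\<close>

text \<open>The path runs through a nearly closest pair of points; the slack \<open>e\<close> is
  there because \<open>setdist\<close> is an infimum.\<close>

lemma dist_le_diameter_setdist:
  assumes K: "bounded K" "K \<noteq> {}" and K': "bounded K'" "K' \<noteq> {}" and x: "x \<in> closure K" and y: "y \<in> K'"
  shows "dist x y \<le> diameter K + setdist K K' + diameter K'"
proof (rule field_le_epsilon)
  fix e :: real assume "e > 0"
  then obtain u v where uv: "u \<in> K" "v \<in> K'" "dist u v < setdist K K' + e"
    using setdist_ltE[of K K' "setdist K K' + e"] K K' by auto
  have "dist x u \<le> diameter (closure K)"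
    using K x uv closure_subset by (intro diameter_bounded_bound) auto
  then have "dist x u \<le> diameter K" using K by (simp add: diameter_closure)
  moreover have "dist v y \<le> diameter K'" using K' uv y by (intro diameter_bounded_bound) auto
  moreover have "dist x y \<le> dist x u + dist u v + dist v y"
    using dist_triangle[of x y u] dist_triangle[of u y v] by linarith
  ultimately show "dist x y \<le> diameter K + setdist K K' + diameter K' + e" using uv by linarith
qed

theorem theorem6p8:
  fixes F :: "real^'d \<Rightarrow> real^'d"
    and \<Omega>\<^sub>0 \<Omega>\<^sub>1 \<Omega> \<Gamma>\<^sub>D \<Gamma>\<^sub>N \<Gamma>\<^sub>t\<^sub>r\<^sub>i\<^sub>m :: "(real^'d) set"
    and p p\<^sub>0 :: nat
    and \<Xi>\<^sub>0 :: "'d \<Rightarrow> real list"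
    and \<Xi> :: "'h \<Rightarrow> 'd \<Rightarrow> real list"
    and \<theta> C\<^sub>N :: real
    and nb :: "'h \<Rightarrow> (real^'d) set \<Rightarrow> (real^'d) set"
  assumes dim: "CARD('d) \<in> {2, 3}"
    and degrees: "p \<ge> 1" "p\<^sub>0 \<ge> 1"
    and knots0: "\<And>l. open_knot_vector p\<^sub>0 (\<Xi>\<^sub>0 l)"
    and knots: "\<And>h l. open_knot_vector p (\<Xi> h l)"
    and regular: "shape_regular \<Xi>"
    and F_spline: "spline_param p\<^sub>0 \<Xi>\<^sub>0 F"
    and F_bilip: "bilipschitz_on (cbox 0 1) F"
    and F_smooth: "\<And>h Q. Q \<in> ref_mesh (\<Xi> h) \<Longrightarrow> smooth_on_closed (closure Q) F"
    and F_inv_smooth: "\<And>h Q. Q \<in> ref_mesh (\<Xi> h) \<Longrightarrow> smooth_on_closed (closure (F ` Q)) (geo_inv F)"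
    and refinement: "\<And>h. spline_space p\<^sub>0 \<Xi>\<^sub>0 \<subseteq> spline_space p (\<Xi> h)"
    and Omega0: "\<Omega>\<^sub>0 = F ` box 0 1"
    and Omega1: "open \<Omega>\<^sub>1" "connected \<Omega>\<^sub>1" "\<Omega>\<^sub>1 \<noteq> {}" "bounded \<Omega>\<^sub>1"
    and Omega: "\<Omega> = \<Omega>\<^sub>0 - closure \<Omega>\<^sub>1" "lipschitz_domain \<Omega>"
    and Gamma_trim: "\<Gamma>\<^sub>t\<^sub>r\<^sub>i\<^sub>m = frontier \<Omega> \<inter> frontier \<Omega>\<^sub>1"
    and Gamma_borel: "\<Gamma>\<^sub>D \<in> sets borel" "\<Gamma>\<^sub>N \<in> sets borel"
    and Gamma_Un: "frontier \<Omega> = \<Gamma>\<^sub>D \<union> \<Gamma>\<^sub>N"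
    and Gamma_disj: "top_of_set (frontier \<Omega>) interior_of \<Gamma>\<^sub>D \<inter>
                     top_of_set (frontier \<Omega>) interior_of \<Gamma>\<^sub>N = {}"
    and Gamma_K: "\<exists>C. \<forall>h. \<forall>K\<in>phys_mesh F \<Omega> (\<Xi> h).
                    emeasure (hausdorff_measure (CARD('d) - 1)) (\<Gamma>\<^sub>D \<inter> closure K)
                      \<le> ennreal (C * diameter K ^ (CARD('d) - 1))"
    and theta: "0 < \<theta>" "\<theta> \<le> 1"
    and good_neighbor: "\<And>h K. K \<in> bad_elements F \<Omega> \<theta> (\<Xi> h) \<Longrightarrow>
                    nb h K \<in> neighbors F \<Omega> (\<Xi> h) C\<^sub>N K \<inter> good_elements F \<Omega> \<theta> (\<Xi> h)"
  shows "\<exists>C>0. \<forall>h. \<forall>K\<in>cut_mesh F \<Omega> \<Gamma>\<^sub>t\<^sub>r\<^sub>i\<^sub>m (\<Xi> h). \<forall>v\<in>trimmed_space F \<Omega> p (\<Xi> h).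
           let K' = (if K \<in> good_elements F \<Omega> \<theta> (\<Xi> h) then K else nb h K) in
           L2_norm (hausdorff_measure (CARD('d) - 1)) (\<Gamma>\<^sub>D \<inter> closure K)
               (\<lambda>x. sqrt (diameter K) * stab_op F \<Omega> p \<theta> (\<Xi> h) (nb h) K v x)
             \<le> ennreal C * L2_norm lborel (\<Omega> \<inter> K') (grad v)"
proof -
  let ?n = "CARD('d)"
  let ?H = "hausdorff_measure (?n - 1) :: (real^'d) measure"
  have n2: "2 \<le> ?n" using dim by auto
  obtain \<sigma> where \<sigma>: "0 < \<sigma>" "\<And>h (a :: real^'d) b l. (\<And>l. knot_span (\<Xi> h l) (a $ l) (b $ l)) \<Longrightarrow>
    \<sigma> * diameter (box a b) \<le> b $ l - a $ l"
    using shape_regular_edge_ge[OF regular] by blast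
  obtain L1 L2 where L12: "L1-lipschitz_on (cbox 0 1) F" "L2-lipschitz_on (F ` cbox 0 1) (geo_inv F)"
    and injF: "inj_on F (cbox 0 1)"
    using F_bilip unfolding bilipschitz_on_def geo_inv_def by blast
  define L where "L = max (max L1 L2) 1"
  have L: "0 < L" "L-lipschitz_on (cbox 0 1) F" "L-lipschitz_on (F ` cbox 0 1) (geo_inv F)"
    using lipschitz_on_le[OF L12(1)] lipschitz_on_le[OF L12(2)] by (auto simp: L_def)
  have el: "element F \<Omega> (\<Xi> h) a b L \<sigma>" if s: "\<And>l. knot_span (\<Xi> h l) (a $ l) (b $ l)" for h and a b :: "real^'d"
  proof
    show "\<sigma> * diameter (box a b) \<le> b $ l - a $ l" for l by (rule \<sigma>(2)[OF s])
    show "open \<Omega>" using Omega(2) by (simp add: lipschitz_domain_def)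
    show "set (\<Xi> h l) \<subseteq> {0..1}" for l using knots[of h l] by (simp add: open_knot_vector_def)
    have "box a b \<in> ref_mesh (\<Xi> h)" using s by (auto simp: ref_mesh_def)
    then show "smooth_on_closed (closure (F ` box a b)) (geo_inv F)" by (rule F_inv_smooth)
  qed (fact s \<sigma>(1) L injF)+
  have mesh: "\<exists>a b. K = F ` box a b \<and> (\<forall>l. knot_span (\<Xi> h l) (a $ l) (b $ l)) \<and> box a b \<inter> pullback F \<Omega> \<noteq> {}"
    if "K \<in> phys_mesh F \<Omega> (\<Xi> h)" for h K
    using that by (auto simp: phys_mesh_def ref_mesh_def)
  obtain C\<^sub>0 where C0: "\<And>h K. K \<in> phys_mesh F \<Omega> (\<Xi> h) \<Longrightarrow>
      emeasure ?H (\<Gamma>\<^sub>D \<inter> closure K) \<le> ennreal (C\<^sub>0 * diameter K ^ (?n - 1))"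
    using Gamma_K by blast
  \<comment> \<open>The given constant carries no sign; the maximum makes it positive.\<close>
  define C\<^sub>\<Gamma> where "C\<^sub>\<Gamma> = max C\<^sub>0 1"
  \<comment> \<open>Points of \<open>K'\<close> have distance at most
    \<open>(\<bar>C\<^sub>N\<bar> + 1) * diameter K + diameter K'\<close> from points of
    \<open>closure K\<close>; the two terms are bounded by \<open>L / \<sigma>\<^sup>2\<close> and
    \<open>L\<close> times the size of the reference box of \<open>K'\<close>.\<close>
  define R where "R = (\<bar>C\<^sub>N\<bar> + 1) * L / \<sigma>\<^sup>2 + L"
  have R: "0 < R" using L(1) \<sigma>(1) by (simp add: R_def add_nonneg_pos)
  have vol: "0 < lip_vol ?n L" using L(1) by (simp add: lip_vol_def)
  have "0 < \<theta> * \<sigma> ^ ?n / 2" using theta \<sigma>(1) by simp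
  from remez[OF this, of "2 * (p * ?n)", where 'a = "real^'d"]
  obtain C1 where C1: "0 < C1" "\<And>(f :: real^'d \<Rightarrow> real) x R A e. line_poly (2 * (p * ?n)) f \<Longrightarrow> A \<in> sets borel \<Longrightarrow>
      A \<subseteq> cball x R \<Longrightarrow> 0 < R \<Longrightarrow> ennreal (\<theta> * \<sigma> ^ ?n / 2 * R ^ ?n) \<le> emeasure lborel A \<Longrightarrow>
      (\<And>y. y \<in> A \<Longrightarrow> \<bar>f y\<bar> \<le> e) \<Longrightarrow> \<bar>f x\<bar> \<le> C1 * e"
    by auto
  have "0 < \<sigma> ^ ?n / (2 * lip_vol ?n L * (R + 1) ^ ?n)" using R vol \<sigma>(1) by simp
  from remez[OF this, of "p * ?n", where 'a = "real^'d"]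
  obtain C2 where C2: "0 < C2" "\<And>(f :: real^'d \<Rightarrow> real) x r A e. line_poly (p * ?n) f \<Longrightarrow> A \<in> sets borel \<Longrightarrow>
      A \<subseteq> cball x r \<Longrightarrow> 0 < r \<Longrightarrow>
      ennreal (\<sigma> ^ ?n / (2 * lip_vol ?n L * (R + 1) ^ ?n) * r ^ ?n) \<le> emeasure lborel A \<Longrightarrow>
      (\<And>y. y \<in> A \<Longrightarrow> \<bar>f y\<bar> \<le> e) \<Longrightarrow> \<bar>f x\<bar> \<le> C2 * e"
    by auto
  obtain CM where CM: "0 < CM" "\<And>(f :: real^'d \<Rightarrow> real) x \<delta> B. line_poly (p * ?n) f \<Longrightarrow> f differentiable (at x) \<Longrightarrow> 0 < \<delta> \<Longrightarrow>
     (\<And>y. y \<in> cball x \<delta> \<Longrightarrow> \<bar>f y\<bar> \<le> B) \<Longrightarrow> norm (grad f x) \<le> CM * B / \<delta>"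
    using markov_grad[of "p * ?n", where 'd = 'd] by auto
  \<comment> \<open>The pointwise stability constant: \<open>L\<close> for good elements, the
    projection bound for bad ones.\<close>
  define C\<^sub>S where "C\<^sub>S = max L (2 * CM * C2)"
  define E where "E = 4 * C1 * L\<^sup>2 * lip_vol ?n L / (\<theta> * \<sigma> ^ ?n)"
  have pos: "0 < C\<^sub>\<Gamma>" "0 < C\<^sub>S" "0 < E"
    using L(1) C1(1) vol theta \<sigma>(1) by (auto simp: C\<^sub>\<Gamma>_def C\<^sub>S_def E_def)
  \<comment> \<open>The factors of \<open>c\<^sup>2\<close> come from the size of the boundary
    piece, the squared pointwise bound, the energy estimate, and the comparison of
    \<open>diameter K\<close> with the size of the box of \<open>K'\<close>.\<close>
  define c where "c = sqrt (C\<^sub>\<Gamma> * C\<^sub>S\<^sup>2 * E * (L / \<sigma>\<^sup>2) ^ ?n)"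
  have c: "0 < c" "c\<^sup>2 = C\<^sub>\<Gamma> * C\<^sub>S\<^sup>2 * E * (L / \<sigma>\<^sup>2) ^ ?n"
    using pos L(1) \<sigma>(1) by (auto simp: c_def)
  have main: "L2_norm ?H (\<Gamma>\<^sub>D \<inter> closure K) (\<lambda>x. sqrt (diameter K) * stab_op F \<Omega> p \<theta> (\<Xi> h) (nb h) K v x)
      \<le> ennreal c * L2_norm lborel (\<Omega> \<inter> K') (grad v)"
    if K: "K \<in> phys_mesh F \<Omega> (\<Xi> h)" and v: "v \<in> trimmed_space F \<Omega> p (\<Xi> h)"
      and K': "K' = (if K \<in> good_elements F \<Omega> \<theta> (\<Xi> h) then K else nb h K)"
    for h K v K'
  proof -
    obtain a b where ab: "K = F ` box a b" "\<And>l. knot_span (\<Xi> h l) (a $ l) (b $ l)" "box a b \<inter> pullback F \<Omega> \<noteq> {}"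
      using mesh[OF K] by blast
    interpret el: element F \<Omega> "\<Xi> h" a b L \<sigma> by (rule el[OF ab(2)])
    have nb: "nb h K \<in> neighbors F \<Omega> (\<Xi> h) C\<^sub>N K \<inter> good_elements F \<Omega> \<theta> (\<Xi> h)"
      if "K \<notin> good_elements F \<Omega> \<theta> (\<Xi> h)"
      using good_neighbor K that by (simp add: bad_elements_def)
    have good: "K' \<in> good_elements F \<Omega> \<theta> (\<Xi> h)" using nb by (auto simp: K')
    then have "K' \<in> phys_mesh F \<Omega> (\<Xi> h)" by (simp add: good_elements_def)
    then obtain a' b' where ab': "K' = F ` box a' b'" "\<And>l. knot_span (\<Xi> h l) (a' $ l) (b' $ l)"
        "box a' b' \<inter> pullback F \<Omega> \<noteq> {}"
      using mesh by blast
    interpret el': element F \<Omega> "\<Xi> h" a' b' L \<sigma> by (rule el[OF ab'(2)])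
    let ?D = "diameter (box a b)" and ?D' = "diameter (box a' b')"
    \<comment> \<open>Quasi-uniformity in the direction needed: the possibly bad \<open>K\<close> is
      not much larger than \<open>K'\<close>.\<close>
    have "\<sigma>\<^sup>2 * ?D \<le> ?D'" by (rule shape_regular_quasi_uniform[OF n2 \<sigma> ab'(2) ab(2)])
    then have D_le: "?D \<le> ?D' / \<sigma>\<^sup>2" using \<sigma>(1) by (simp add: field_simps)
    have diam_K: "diameter K \<le> L / \<sigma>\<^sup>2 * ?D'"
      using el.diameter_K_le mult_left_mono[OF D_le, of L] L(1) by (simp add: ab(1))
    obtain q where q: "q \<in> poly_Q p" "\<And>x. x \<in> box a' b' \<inter> pullback F \<Omega> \<Longrightarrow> q x = v (F x)"
      using el'.ex_element_poly[OF v] by blast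
    have ext: "element_ext F \<Omega> p K' v = q \<circ> geo_inv F"
      unfolding ab'(1) by (rule el'.element_ext_eq[OF q ab'(3)])
    have stab: "\<bar>stab_op F \<Omega> p \<theta> (\<Xi> h) (nb h) K v x\<bar> \<le> C\<^sub>S * W"
      if W: "\<And>z. z \<in> box a' b' \<Longrightarrow> norm (grad q z) \<le> W" and x: "x \<in> closure K" for W x
    proof -
      have W0: "0 \<le> W" using W el'.Q_nonempty norm_ge_zero order_trans by blast
      have inner: "\<bar>w \<bullet> outward_normal \<Omega> x\<bar> \<le> C\<^sub>S * W" if w: "norm w \<le> C\<^sub>S * W" for w
      proof -
        have "\<bar>w \<bullet> outward_normal \<Omega> x\<bar> \<le> norm w * norm (outward_normal \<Omega> x)" by (rule Cauchy_Schwarz_ineq2)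
        also have "\<dots> \<le> norm w * 1" by (intro mult_left_mono norm_outward_normal_le) auto
        finally show ?thesis using w by simp
      qed
      show ?thesis
      proof (cases "K \<in> good_elements F \<Omega> \<theta> (\<Xi> h)")
        case True
        then have KK': "K = K'" by (simp add: K')
        have "norm (Lim (at x within K) (\<lambda>y. grad (q \<circ> geo_inv F) y)) \<le> L * W"
          using el'.norm_Lim_grad_le[OF _ q(1) W, of x] x by (simp add: KK' ab'(1))
        also have "\<dots> \<le> C\<^sub>S * W" using W0 by (intro mult_right_mono) (auto simp: C\<^sub>S_def)
        finally show ?thesis
          using True ext by (simp only: stab_op_def KK' if_True inner)
      next
        case False
        have nbK: "K' = nb h K" using False by (simp add: K')
        have sd: "setdist K K' \<le> C\<^sub>N * diameter K" using nb[OF False] by (simp add: neighbors_def nbK)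
        have sub: "F ` box a' b' \<subseteq> cball x (R * ?D')"
        proof
          fix y assume y: "y \<in> F ` box a' b'"
          have dK: "0 \<le> diameter K" using el.bounded_K by (simp add: ab(1) diameter_ge_0)
          have "dist x y \<le> diameter K + setdist K K' + diameter K'"
            by (rule dist_le_diameter_setdist) (use x y ab(1) ab'(1) el.bounded_K el'.bounded_K el.Q_nonempty in auto)
          also have "\<dots> \<le> diameter K + \<bar>C\<^sub>N\<bar> * diameter K + L * ?D'"
            using sd el'.diameter_K_le mult_right_mono[OF abs_ge_self[of C\<^sub>N] dK] by (simp add: ab'(1))
          also have "\<dots> = (\<bar>C\<^sub>N\<bar> + 1) * diameter K + L * ?D'" by (simp add: algebra_simps)
          also have "\<dots> \<le> (\<bar>C\<^sub>N\<bar> + 1) * (L / \<sigma>\<^sup>2 * ?D') + L * ?D'"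
            using diam_K by (intro add_right_mono mult_left_mono) auto
          also have "\<dots> = R * ?D'" by (simp add: R_def algebra_simps)
          finally show "y \<in> cball x (R * ?D')" by simp
        qed
        have "norm (grad (L2_proj p K' (q \<circ> geo_inv F)) x) \<le> 2 * CM * C2 * W"
          unfolding ab'(1) by (rule el'.norm_grad_L2_proj_le[where R = R]) (fact q(1) W R sub CM C2)+
        also have "\<dots> \<le> C\<^sub>S * W" using W0 by (intro mult_right_mono) (auto simp: C\<^sub>S_def)
        finally show ?thesis
          using False ext by (simp only: stab_op_def nbK if_False inner)
      qed
    qed
    show ?thesis
    proof (rule L2_norm_le[OF c(1)])
      let ?J = "\<integral>\<^sup>+y\<in>\<Omega> \<inter> K'. ennreal ((norm (grad v y))\<^sup>2) \<partial>lborel"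
      let ?s = "stab_op F \<Omega> p \<theta> (\<Xi> h) (nb h) K v"
      assume fin: "?J < top"
      define j where "j = enn2real ?J"
      have j: "?J = ennreal j" "0 \<le> j" using fin by (auto simp: j_def)
      \<comment> \<open>The uniform gradient bound on the box that the energy estimate
        yields.\<close>
      define W where "W = sqrt (E * j / ?D' ^ ?n)"
      have W2: "W\<^sup>2 = E * j / ?D' ^ ?n" using pos j el'.D_pos by (simp add: W_def)
      have "norm (grad q z) \<le> W" if z: "z \<in> box a' b'" for z
      proof -
        have large: "\<theta> * measure lborel (box a' b') \<le> measure lborel (pullback F \<Omega> \<inter> box a' b')"
          using good el'.pullback_K by (simp add: good_elements_def ab'(1))
        have "ennreal ((norm (grad q z))\<^sup>2 * ?D' ^ ?n) \<le> ennreal E * ?J"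
          unfolding E_def ab'(1) by (rule el'.energy_bound) (fact theta(1) large q C1 z)+
        then have "ennreal ((norm (grad q z))\<^sup>2 * ?D' ^ ?n) \<le> ennreal (E * j)"
          using pos j by (simp add: ennreal_mult)
        then have "(norm (grad q z))\<^sup>2 * ?D' ^ ?n \<le> E * j"
          using pos j by (subst (asm) ennreal_le_iff) auto
        then have "(norm (grad q z))\<^sup>2 \<le> W\<^sup>2" using el'.D_pos by (simp add: W2 field_simps)
        then show ?thesis by (rule power2_le_imp_le) (use pos j el'.D_pos in \<open>simp add: W_def\<close>)
      qed
      then have bound: "\<bar>?s x\<bar> \<le> C\<^sub>S * W" if "x \<in> closure K" for x using stab that by blast
      have dK: "0 \<le> diameter K" using el.bounded_K by (simp add: ab(1) diameter_ge_0)
      let ?B = "diameter K * (C\<^sub>S * W)\<^sup>2"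
      have "(norm (sqrt (diameter K) * ?s x))\<^sup>2 \<le> ?B" if "x \<in> closure K" for x
      proof -
        have "(norm (sqrt (diameter K) * ?s x))\<^sup>2 = diameter K * \<bar>?s x\<bar>\<^sup>2"
          using dK by (simp add: power_mult_distrib)
        also have "\<dots> \<le> ?B" using bound[OF that] dK by (intro mult_left_mono power_mono) auto
        finally show ?thesis .
      qed
      then have "(\<integral>\<^sup>+x\<in>\<Gamma>\<^sub>D \<inter> closure K. ennreal ((norm (sqrt (diameter K) * ?s x))\<^sup>2) \<partial>?H) \<le>
          (\<integral>\<^sup>+x. ennreal ?B * indicator (\<Gamma>\<^sub>D \<inter> closure K) x \<partial>?H)"
        by (intro nn_integral_mono) (auto simp: indicator_def intro!: ennreal_leI)
      also have "\<dots> = ennreal ?B * emeasure ?H (\<Gamma>\<^sub>D \<inter> closure K)"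
        using Gamma_borel(1) by (intro nn_integral_cmult_indicator) auto
      also have "\<dots> \<le> ennreal ?B * ennreal (C\<^sub>\<Gamma> * diameter K ^ (?n - 1))"
        using dK by (intro mult_left_mono order_trans[OF C0[OF K]] ennreal_leI mult_right_mono)
          (auto simp: C\<^sub>\<Gamma>_def)
      also have "\<dots> = ennreal (?B * (C\<^sub>\<Gamma> * diameter K ^ (?n - 1)))"
        using dK pos by (simp add: ennreal_mult)
      also have "?B * (C\<^sub>\<Gamma> * diameter K ^ (?n - 1)) = C\<^sub>\<Gamma> * C\<^sub>S\<^sup>2 * W\<^sup>2 * (diameter K * diameter K ^ (?n - 1))"
        by (simp add: power_mult_distrib mult_ac)
      \<comment> \<open>The weight contributes one power and the boundary piece
        \<open>?n - 1\<close>; together they cancel the \<open>?n\<close> powers in the denominator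
        of \<open>W\<^sup>2\<close>.\<close>
      also have "diameter K * diameter K ^ (?n - 1) = diameter K ^ ?n"
        using n2 by (simp flip: power_Suc)
      also have "ennreal (C\<^sub>\<Gamma> * C\<^sub>S\<^sup>2 * W\<^sup>2 * diameter K ^ ?n) \<le>
          ennreal (C\<^sub>\<Gamma> * C\<^sub>S\<^sup>2 * W\<^sup>2 * (L / \<sigma>\<^sup>2 * ?D') ^ ?n)"
        using pos diam_K dK by (intro ennreal_leI mult_left_mono power_mono) auto
      also have "C\<^sub>\<Gamma> * C\<^sub>S\<^sup>2 * W\<^sup>2 * (L / \<sigma>\<^sup>2 * ?D') ^ ?n = c\<^sup>2 * j"
        unfolding W2 c(2) power_mult_distrib using el'.D_pos by simp
      finally show "(\<integral>\<^sup>+x\<in>\<Gamma>\<^sub>D \<inter> closure K. ennreal ((norm (sqrt (diameter K) * ?s x))\<^sup>2) \<partial>?H) \<le>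
          ennreal (c\<^sup>2 * enn2real ?J)" by (simp only: j_def)
    qed
  qed
  show ?thesis
    unfolding Let_def cut_mesh_def using main c(1) by blast
qed

end
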